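(* Let $f$ be a smooth, volume-preserving ($\det Df\equiv 1$) diffeomorphism of a neighborhood of $0$ in $\mathbb{R}^3$, $\xi=(x,y,z)^T$, of the form $f(\xi)=J(\xi+b(\xi))$ with $b(\xi)=O(|\xi|^2)$ and $$Df(0)=J=\begin{pmatrix}1&1&0\\0&1&1\\0&0&1\end{pmatrix}=\mathbb{I}+N .$$ Then for every integer $D\ge2$ there exist a volume-preserving, near-identity change of coordinates $\eta=\psi(\xi)=\xi+h(\xi)$, $h(\xi)=O(|\xi|^2)$, and a polynomial $p$ in two variables with only terms of degree $\ge2$, such that $$\psi\circ f\circ\psi^{-1}(\eta)=g(\eta)+O(|\eta|^{D+1}),\qquad g(\eta)=J\big(\eta+\hat e_3\,p(\eta_1,\eta_2)\big),\quad \hat e_3=(0,0,1)^T.$$ Moreover, for every polynomial $p(x,y)$ (in particular every truncation of the normal form at any degree), the map $g(\xi)=J(\xi+\hat e_3 p(x,y))$ is exactly volume preserving and has a polynomial inverse of the same degree as $g$.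
   Context: $\mathbb{I}$ denotes the $3\times3$ identity matrix and $N$ the $3\times 3$ nilpotent Jordan block with $N_{12}=N_{23}=1$ and all other entries $0$. *)

theory Defs
  imports "HOL-Analysis.Analysis"
begin

definition Nmat :: "real^3^3" where
  "Nmat = vector [vector [0,1,0], vector [0,0,1], vector [0,0,0]]"

definition Jmat :: "real^3^3" where
  "Jmat = mat 1 + Nmat"

definition e3 :: "real^3" where
  "e3 = vector [0,0,1]"

fun Ck :: "nat \<Rightarrow> (real^'n) set \<Rightarrow> (real^'n \<Rightarrow> real) \<Rightarrow> bool" where
  "Ck 0 U \<phi> = continuous_on U \<phi>"
| "Ck (Suc k) U \<phi> = ((\<forall>x\<in>U. \<phi> differentiable (at x)) \<and>
      (\<forall>i. Ck k U (\<lambda>x. frechet_derivative \<phi> (at x) (axis i 1))))"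

definition smooth_on :: "(real^'n) set \<Rightarrow> (real^'n \<Rightarrow> real^'m) \<Rightarrow> bool" where
  "smooth_on U f = (\<forall>k i. Ck k U (\<lambda>x. f x $ i))"

definition diffeo_on :: "(real^'n) set \<Rightarrow> (real^'n \<Rightarrow> real^'n) \<Rightarrow> bool" where
  "diffeo_on U f = (open U \<and> smooth_on U f \<and> inj_on f U \<and> open (f ` U) \<and>
                    smooth_on (f ` U) (inv_into U f))"

definition vol_pres_on :: "(real^'n) set \<Rightarrow> (real^'n \<Rightarrow> real^'n) \<Rightarrow> bool" where
  "vol_pres_on U f = (\<forall>x\<in>U. f differentiable (at x) \<and>
                       det (matrix (frechet_derivative f (at x))) = 1)"

definition bigO0 :: "nat \<Rightarrow> (real^'n \<Rightarrow> real^'m) \<Rightarrow> bool" where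
  "bigO0 k b = (\<exists>C r. r > 0 \<and> (\<forall>\<xi>. norm \<xi> < r \<longrightarrow> norm (b \<xi>) \<le> C * norm \<xi> ^ k))"

definition poly2 :: "(real \<Rightarrow> real \<Rightarrow> real) \<Rightarrow> bool" where
  "poly2 p = (\<exists>n c. \<forall>x y. p x y = (\<Sum>i\<le>n. \<Sum>j\<le>n. c i j * x ^ i * y ^ j))"

definition poly2_ord2 :: "(real \<Rightarrow> real \<Rightarrow> real) \<Rightarrow> bool" where
  "poly2_ord2 p = (\<exists>n c. (\<forall>i j. i + j < 2 \<longrightarrow> c i j = (0::real)) \<and>
       (\<forall>x y. p x y = (\<Sum>i\<le>n. \<Sum>j\<le>n. c i j * x ^ i * y ^ j)))"

definition poly3_deg_le :: "nat \<Rightarrow> (real^3 \<Rightarrow> real) \<Rightarrow> bool" where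
  "poly3_deg_le n q = (\<exists>c. \<forall>\<xi>. q \<xi> =
      (\<Sum>(i,j,k) \<in> {(i,j,k). i + j + k \<le> n}. c i j k * (\<xi>$1) ^ i * (\<xi>$2) ^ j * (\<xi>$3) ^ k))"

definition polymap3 :: "(real^3 \<Rightarrow> real^3) \<Rightarrow> bool" where
  "polymap3 G = (\<exists>n. \<forall>i. poly3_deg_le n (\<lambda>\<xi>. G \<xi> $ i))"

definition polymap3_deg :: "(real^3 \<Rightarrow> real^3) \<Rightarrow> nat" where
  "polymap3_deg G = (LEAST n. \<forall>i. poly3_deg_le n (\<lambda>\<xi>. G \<xi> $ i))"

end

theory Submission
  imports Defs "HOL-Computational_Algebra.Polynomial"
begin

text \<open>
  Only the Taylor polynomial of \<open>f\<close> matters, and it is normalized degree by degree. If \<open>f\<close> agrees with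
  the normal form up to a term \<open>J R\<close> with \<open>R\<close> homogeneous of degree \<open>d\<close>, volume preservation makes \<open>R\<close>
  divergence free, and conjugation by \<open>\<xi> + h(\<xi>)\<close> changes \<open>J R\<close> by \<open>h \<circ> J - J h\<close>. All corrections \<open>h\<close> are
  taken to be sums of shears \<open>(l \<cdot> \<xi>)\<^bsup>d\<^esup> v\<close> with \<open>l \<cdot> v = 0\<close>, so \<open>\<psi>\<close> can be chosen as a composition of
  polynomial shears, which is exactly volume preserving with polynomial inverse on the whole space.

  It remains to see that modulo \<open>J h - h \<circ> J\<close> every homogeneous divergence-free field is of the form
  \<open>J e\<^sub>3 p(x, y)\<close>. Modulo this range, transport by \<open>J\<close> acts trivially; transporting the fields
  \<open>e\<^sub>3 (a x + b y)\<^bsup>d\<^esup>\<close> by powers of \<open>J\<close> gives shears that depend polynomially on the exponent, so real exponents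
  are allowed as well. For \<open>l\<close> in an open set, \<open>l J\<^bsup>s\<^esup> e\<^sub>3\<close> is a quadratic in \<open>s\<close> with two distinct real
  roots, whose vectors \<open>J\<^bsup>s\<^esup> e\<^sub>3\<close> span the orthogonal complement of \<open>l\<close>. The coefficients of the resulting
  polynomial family of shears span the divergence-free fields.
\<close>

section \<open>Orders of vanishing and polynomials\<close>

text \<open>Order estimates do not survive differentiation, yet volume preservation is a statement
  about derivatives. The partial derivatives of \<open>f\<close> are therefore compared with those
  of its Taylor polynomial, at the cost of one order: the Jacobian determinant of the Taylor
  polynomial is 1 only up to O(|xi|^D). This suffices, since the step in degree d <= D needs the
  determinant modulo order d: the divergence of a homogeneous field of degree d sits in degree d -
  1. Adding a divergence-free correction to the identity does not preserve volume exactly. For a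
  shear, however, the derivative of (l . xi)^d v is nilpotent because l . v = 0, so the determinant
  is exactly 1 and the inverse is the shear with -v; composing shears instead of adding them changes
  only terms of order d + 1. The two roots depend on l = (2, rho, pi) through a square root, but the
  plane orthogonal to l has the basis (-rho/2, 1, 0), (-pi/2, 0, 1), polynomial in l. This is what
  makes coefficients available. They give arbitrary second and third components; vanishing
  divergence then leaves a first component independent of x.\<close>

definition vanish :: "nat \<Rightarrow> (real^3 \<Rightarrow> 'b::real_normed_vector) \<Rightarrow> bool" where
  "vanish k \<phi> \<longleftrightarrow> (\<exists>C. \<forall>\<^sub>F \<xi> in nhds 0. norm (\<phi> \<xi>) \<le> C * norm \<xi> ^ k)"

lemma vanishI: "\<forall>\<^sub>F \<xi> in nhds 0. norm (\<phi> \<xi>) \<le> C * norm \<xi> ^ k \<Longrightarrow> vanish k \<phi>"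
  unfolding vanish_def by blast

lemma vanishE:
  assumes "vanish k \<phi>"
  obtains C where "C > 0" "\<forall>\<^sub>F \<xi> in nhds 0. norm (\<phi> \<xi>) \<le> C * norm \<xi> ^ k"
proof -
  from assms obtain C where C: "\<forall>\<^sub>F \<xi> in nhds 0. norm (\<phi> \<xi>) \<le> C * norm \<xi> ^ k"
    unfolding vanish_def by blast
  have "\<forall>\<^sub>F \<xi> in nhds 0. norm (\<phi> \<xi>) \<le> (\<bar>C\<bar> + 1) * norm \<xi> ^ k"
    using C
  proof eventually_elim
    case (elim \<xi>)
    have "C * norm \<xi> ^ k \<le> (\<bar>C\<bar> + 1) * norm \<xi> ^ k"
      by (intro mult_right_mono) auto
    with elim show ?case by linarith
  qed
  then show thesis by (intro that[of "\<bar>C\<bar> + 1"]) auto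
qed

text \<open>\<open>vanish\<close> restates \<open>bigO0\<close> through the filter
  \<open>nhds 0\<close>, so that estimates combine by \<open>eventually\<close> and compose by
  limits. Its codomain is any normed space, which covers components and determinants.\<close>

lemma bigO0_iff_vanish: "bigO0 k b \<longleftrightarrow> vanish k b"
  unfolding bigO0_def vanish_def eventually_nhds_metric by auto

lemma vanish_zero [simp, intro]: "vanish k (\<lambda>_. 0)"
  by (rule vanishI[of _ 0]) simp

lemma vanish_cong:
  assumes "\<forall>\<^sub>F \<xi> in nhds 0. \<phi> \<xi> = \<omega> \<xi>" "vanish k \<phi>"
  shows "vanish k \<omega>"
proof -
  obtain C where "\<forall>\<^sub>F \<xi> in nhds 0. norm (\<phi> \<xi>) \<le> C * norm \<xi> ^ k"
    using assms(2) by (rule vanishE)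
  with assms(1) have "\<forall>\<^sub>F \<xi> in nhds 0. norm (\<omega> \<xi>) \<le> C * norm \<xi> ^ k"
    by eventually_elim auto
  then show ?thesis by (rule vanishI)
qed

lemma vanish_add:
  assumes "vanish k \<phi>" "vanish k \<omega>"
  shows "vanish k (\<lambda>\<xi>. \<phi> \<xi> + \<omega> \<xi>)"
proof -
  obtain B where B: "\<forall>\<^sub>F \<xi> in nhds 0. norm (\<phi> \<xi>) \<le> B * norm \<xi> ^ k"
    using assms(1) by (rule vanishE)
  obtain C where C: "\<forall>\<^sub>F \<xi> in nhds 0. norm (\<omega> \<xi>) \<le> C * norm \<xi> ^ k"
    using assms(2) by (rule vanishE)
  from B C have "\<forall>\<^sub>F \<xi> in nhds 0. norm (\<phi> \<xi> + \<omega> \<xi>) \<le> (B + C) * norm \<xi> ^ k"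
  proof eventually_elim
    case (elim \<xi>)
    then show ?case using norm_triangle_ineq[of "\<phi> \<xi>" "\<omega> \<xi>"] by (simp add: distrib_right)
  qed
  then show ?thesis by (rule vanishI)
qed

lemma vanish_minus: "vanish k \<phi> \<Longrightarrow> vanish k (\<lambda>\<xi>. - \<phi> \<xi>)"
  by (simp add: vanish_def)

lemma vanish_diff:
  assumes "vanish k \<phi>" "vanish k \<omega>"
  shows "vanish k (\<lambda>\<xi>. \<phi> \<xi> - \<omega> \<xi>)"
  using vanish_add[OF assms(1) vanish_minus[OF assms(2)]] by simp

lemma vanish_trans:
  assumes "vanish k (\<lambda>\<xi>. \<phi> \<xi> - \<omega> \<xi>)" "vanish k (\<lambda>\<xi>. \<omega> \<xi> - \<theta> \<xi>)"
  shows "vanish k (\<lambda>\<xi>. \<phi> \<xi> - \<theta> \<xi>)"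
  using vanish_add[OF assms] by simp

lemma vanish_sum: "(\<And>i. i \<in> I \<Longrightarrow> vanish k (\<phi> i)) \<Longrightarrow> vanish k (\<lambda>\<xi>. \<Sum>i\<in>I. \<phi> i \<xi>)"
  by (induction I rule: infinite_finite_induct) (simp_all add: vanish_add)

lemma vanish_scaleR:
  assumes "vanish k \<phi>" "vanish l \<omega>"
  shows "vanish (k + l) (\<lambda>\<xi>. \<phi> \<xi> *\<^sub>R \<omega> \<xi>)"
proof -
  obtain B where B: "B > 0" "\<forall>\<^sub>F \<xi> in nhds 0. norm (\<phi> \<xi>) \<le> B * norm \<xi> ^ k"
    using assms(1) by (rule vanishE)
  obtain C where C: "C > 0" "\<forall>\<^sub>F \<xi> in nhds 0. norm (\<omega> \<xi>) \<le> C * norm \<xi> ^ l"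
    using assms(2) by (rule vanishE)
  have "\<forall>\<^sub>F \<xi> in nhds 0. norm (\<phi> \<xi> *\<^sub>R \<omega> \<xi>) \<le> (B * C) * norm \<xi> ^ (k + l)"
    using B(2) C(2)
  proof eventually_elim
    case (elim \<xi>)
    have "norm (\<phi> \<xi>) * norm (\<omega> \<xi>) \<le> (B * norm \<xi> ^ k) * (C * norm \<xi> ^ l)"
      using elim B(1) C(1) by (intro mult_mono) auto
    then show ?case by (simp add: power_add mult_ac)
  qed
  then show ?thesis by (rule vanishI)
qed

lemma vanish_mult:
  fixes \<phi> \<omega> :: "real^3 \<Rightarrow> real"
  shows "vanish k \<phi> \<Longrightarrow> vanish l \<omega> \<Longrightarrow> vanish (k + l) (\<lambda>\<xi>. \<phi> \<xi> * \<omega> \<xi>)"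
  using vanish_scaleR[of k \<phi> l \<omega>] by simp

lemma vanish_mono:
  assumes "vanish l \<phi>" "k \<le> l"
  shows "vanish k \<phi>"
proof -
  obtain C where C: "C > 0" "\<forall>\<^sub>F \<xi> in nhds 0. norm (\<phi> \<xi>) \<le> C * norm \<xi> ^ l"
    using assms(1) by (rule vanishE)
  have 1: "\<forall>\<^sub>F \<xi>::real^3 in nhds 0. norm \<xi> < 1"
    unfolding eventually_nhds_metric by (intro exI[of _ 1]) auto
  have "\<forall>\<^sub>F \<xi> in nhds 0. norm (\<phi> \<xi>) \<le> C * norm \<xi> ^ k"
    using C(2) 1
  proof eventually_elim
    case (elim \<xi>)
    have "norm \<xi> ^ l \<le> norm \<xi> ^ k"
      using elim assms(2) by (intro power_decreasing) auto
    then have "C * norm \<xi> ^ l \<le> C * norm \<xi> ^ k" using C(1) by simp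
    with elim show ?case by linarith
  qed
  then show ?thesis by (rule vanishI)
qed

lemma vanish_bounded_linear:
  assumes "bounded_linear L" "vanish k \<phi>"
  shows "vanish k (\<lambda>\<xi>. L (\<phi> \<xi>))"
proof -
  obtain C where C: "C > 0" "\<forall>\<^sub>F \<xi> in nhds 0. norm (\<phi> \<xi>) \<le> C * norm \<xi> ^ k"
    using assms(2) by (rule vanishE)
  obtain K where K: "K > 0" "\<And>x. norm (L x) \<le> norm x * K"
    using bounded_linear.pos_bounded[OF assms(1)] by blast
  have "\<forall>\<^sub>F \<xi> in nhds 0. norm (L (\<phi> \<xi>)) \<le> (C * K) * norm \<xi> ^ k"
    using C(2)
  proof eventually_elim
    case (elim \<xi>)
    have "norm (L (\<phi> \<xi>)) \<le> norm (\<phi> \<xi>) * K" by (rule K)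
    also have "\<dots> \<le> (C * norm \<xi> ^ k) * K" using elim K(1) by (intro mult_right_mono) auto
    finally show ?case by (simp add: mult_ac)
  qed
  then show ?thesis by (rule vanishI)
qed

lemma vanish_nth: "vanish k \<phi> \<Longrightarrow> vanish k (\<lambda>\<xi>. \<phi> \<xi> $ i)"
  by (rule vanish_bounded_linear[OF bounded_linear_vec_nth])

lemma vanish_matrix:
  fixes \<phi> :: "real^3 \<Rightarrow> real^'n"
  shows "vanish k \<phi> \<Longrightarrow> vanish k (\<lambda>\<xi>. M *v \<phi> \<xi>)"
  by (rule vanish_bounded_linear[OF matrix_vector_mul_bounded_linear])

lemma vanish_vec:
  fixes \<phi> :: "real^3 \<Rightarrow> real^'n"
  assumes "\<And>i. vanish k (\<lambda>\<xi>. \<phi> \<xi> $ i)"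
  shows "vanish k \<phi>"
proof -
  have "vanish k (\<lambda>\<xi>. \<Sum>i\<in>UNIV. axis i (\<phi> \<xi> $ i))"
  proof (rule vanish_sum)
    fix i
    have "vanish k (\<lambda>\<xi>. (\<phi> \<xi> $ i) *\<^sub>R (axis i 1 :: real^'n))"
      by (rule vanish_bounded_linear[OF bounded_linear_scaleR_left assms])
    moreover have "(\<phi> \<xi> $ i) *\<^sub>R (axis i 1 :: real^'n) = axis i (\<phi> \<xi> $ i)" for \<xi>
      by (simp add: vec_eq_iff axis_def)
    ultimately show "vanish k (\<lambda>\<xi>. axis i (\<phi> \<xi> $ i))" by simp
  qed
  moreover have "(\<Sum>i\<in>UNIV. axis i (\<phi> \<xi> $ i)) = \<phi> \<xi>" for \<xi>
    by (simp add: vec_eq_iff axis_def if_distrib cong: if_cong)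
  ultimately show ?thesis by simp
qed

lemma vanish_const: "vanish 0 (\<lambda>_. a)"
  by (rule vanishI[of _ "norm a"]) simp

lemma vanish_id: "vanish 1 (\<lambda>\<xi>. \<xi>)"
  by (rule vanishI[of _ 1]) simp

lemma vanish_imp_tendsto:
  assumes "vanish 1 \<omega>"
  shows "(\<omega> \<longlongrightarrow> 0) (nhds 0)"
proof -
  obtain C where C: "\<forall>\<^sub>F \<xi> in nhds 0. norm (\<omega> \<xi>) \<le> C * norm \<xi> ^ 1"
    using assms by (rule vanishE)
  have "((\<lambda>\<xi>::real^3. C * norm \<xi> ^ 1) \<longlongrightarrow> C * norm (0::real^3) ^ 1) (nhds 0)"
    by (intro tendsto_intros filterlim_ident)
  then have "((\<lambda>\<xi>::real^3. C * norm \<xi> ^ 1) \<longlongrightarrow> 0) (nhds 0)" by simp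
  with C show ?thesis by (rule Lim_null_comparison)
qed

lemma vanish_comp:
  assumes "vanish k \<phi>" "vanish 1 \<omega>"
  shows "vanish k (\<lambda>\<xi>. \<phi> (\<omega> \<xi>))"
proof -
  obtain B where B: "B > 0" "\<forall>\<^sub>F \<xi> in nhds 0. norm (\<phi> \<xi>) \<le> B * norm \<xi> ^ k"
    using assms(1) by (rule vanishE)
  obtain C where C: "C > 0" "\<forall>\<^sub>F \<xi> in nhds 0. norm (\<omega> \<xi>) \<le> C * norm \<xi> ^ 1"
    using assms(2) by (rule vanishE)
  have "\<forall>\<^sub>F \<xi> in nhds 0. norm (\<phi> (\<omega> \<xi>)) \<le> B * norm (\<omega> \<xi>) ^ k"
    using B(2) vanish_imp_tendsto[OF assms(2)] by (rule eventually_compose_filterlim)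
  then have "\<forall>\<^sub>F \<xi> in nhds 0. norm (\<phi> (\<omega> \<xi>)) \<le> (B * C ^ k) * norm \<xi> ^ k"
    using C(2)
  proof eventually_elim
    case (elim \<xi>)
    have "B * norm (\<omega> \<xi>) ^ k \<le> B * (C * norm \<xi> ^ 1) ^ k"
      using elim B(1) by (intro mult_left_mono power_mono) auto
    with elim show ?case by (simp add: power_mult_distrib)
  qed
  then show ?thesis by (rule vanishI)
qed

text \<open>Generation by closure rules gives one induction for each property (scaling, order of
  vanishing, Lipschitz bound, derivative) without handling coefficients. The zero function counts as
  homogeneous of every degree.\<close>

inductive hpoly :: "nat \<Rightarrow> (real^3 \<Rightarrow> real) \<Rightarrow> bool" where
  const: "hpoly 0 (\<lambda>_. a)"
| coord: "hpoly 1 (\<lambda>\<xi>. \<xi> $ i)"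
| add: "hpoly d p \<Longrightarrow> hpoly d q \<Longrightarrow> hpoly d (\<lambda>\<xi>. p \<xi> + q \<xi>)"
| mult: "hpoly m p \<Longrightarrow> hpoly n q \<Longrightarrow> hpoly (m + n) (\<lambda>\<xi>. p \<xi> * q \<xi>)"

lemma hpoly_cmult: "hpoly d p \<Longrightarrow> hpoly d (\<lambda>\<xi>. a * p \<xi>)"
  using hpoly.mult[OF hpoly.const] by fastforce

lemma hpoly_power: "hpoly d p \<Longrightarrow> hpoly (d * n) (\<lambda>\<xi>. p \<xi> ^ n)"
proof (induction n)
  case 0
  then show ?case using hpoly.const[of 1] by simp
next
  case (Suc n)
  then show ?case using hpoly.mult[of d p "d * n"] by simp
qed

lemma hpoly_zero: "hpoly d (\<lambda>_. 0)"
  using hpoly_cmult[OF hpoly_power[OF hpoly.coord, of d], of 0] by simp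

lemma hpoly_minus: "hpoly d p \<Longrightarrow> hpoly d (\<lambda>\<xi>. - p \<xi>)"
  using hpoly_cmult[of d p "-1"] by simp

lemma hpoly_diff: "hpoly d p \<Longrightarrow> hpoly d q \<Longrightarrow> hpoly d (\<lambda>\<xi>. p \<xi> - q \<xi>)"
  using hpoly.add[OF _ hpoly_minus] by fastforce

lemma hpoly_sum: "(\<And>i. i \<in> I \<Longrightarrow> hpoly d (p i)) \<Longrightarrow> hpoly d (\<lambda>\<xi>. \<Sum>i\<in>I. p i \<xi>)"
  by (induction I rule: infinite_finite_induct) (auto intro: hpoly.add hpoly_zero)

lemma hpoly_linear: "hpoly 1 (\<lambda>\<xi>. l \<bullet> \<xi>)"
  unfolding inner_vec_def inner_real_def by (intro hpoly_sum hpoly_cmult hpoly.coord)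

lemma hpoly_matrix: "hpoly 1 (\<lambda>\<xi>. (M *v \<xi>) $ i)"
  unfolding matrix_vector_mult_def by (simp, intro hpoly_sum hpoly_cmult hpoly.coord[simplified])

lemma hpoly_comp_matrix: "hpoly d q \<Longrightarrow> hpoly d (\<lambda>\<xi>. q (M *v \<xi>))"
  by (induction rule: hpoly.induct) (auto intro: hpoly.intros hpoly_matrix[simplified])

lemma hpoly_scaleR: "hpoly d q \<Longrightarrow> q (t *\<^sub>R \<xi>) = t ^ d * q \<xi>"
  by (induction rule: hpoly.induct) (auto simp: algebra_simps power_add)

lemma hpoly_0_const: "hpoly 0 q \<Longrightarrow> \<exists>a. q = (\<lambda>_. a)"
proof -
  assume "hpoly 0 q"
  then have "q \<xi> = q 0" for \<xi> using hpoly_scaleR[of 0 q 0 \<xi>] by simp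
  then show ?thesis by blast
qed

lemma hpoly_vanish: "hpoly d q \<Longrightarrow> vanish d q"
  by (induction rule: hpoly.induct)
    (auto intro: vanish_const vanish_nth[OF vanish_id, simplified] vanish_add vanish_mult)

text \<open>Telescoping a product of d factors leaves one difference of order k + 1 and d - 1
  factors of order 1, which is k + d in total; the product rule below does this two factors at a
  time.\<close>

lemma hpoly_Lipschitz:
  assumes "hpoly d q" and A: "vanish 1 A" "vanish 1 B" "vanish (Suc k) (\<lambda>\<xi>. A \<xi> - B \<xi>)"
  shows "vanish (k + d) (\<lambda>\<xi>. q (A \<xi>) - q (B \<xi>))"
  using assms(1)
proof (induction rule: hpoly.induct)
  case (coord i)
  then show ?case using vanish_nth[OF A(3), of i] by simp
next
  case (add d p q)
  then have "vanish (k + d) (\<lambda>\<xi>. (p (A \<xi>) - p (B \<xi>)) + (q (A \<xi>) - q (B \<xi>)))"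
    by (intro vanish_add)
  then show ?case by (simp add: algebra_simps)
next
  case (mult m p n q)
  have "vanish ((k + m) + n) (\<lambda>\<xi>. (p (A \<xi>) - p (B \<xi>)) * q (A \<xi>))"
    by (intro vanish_mult mult.IH(1) vanish_comp[OF hpoly_vanish[OF mult.hyps(2)] A(1)])
  moreover have "vanish (m + (k + n)) (\<lambda>\<xi>. p (B \<xi>) * (q (A \<xi>) - q (B \<xi>)))"
    by (intro vanish_mult mult.IH(2) vanish_comp[OF hpoly_vanish[OF mult.hyps(1)] A(2)])
  ultimately have "vanish (k + (m + n)) (\<lambda>\<xi>. (p (A \<xi>) - p (B \<xi>)) * q (A \<xi>) + p (B \<xi>) * (q (A \<xi>) - q (B \<xi>)))"
    by (intro vanish_add) (simp_all only: add_ac)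
  then show ?case by (simp add: algebra_simps)
qed simp

text \<open>On the ray t \<xi> homogeneity gives t^d |q \<xi>| <= C |\<xi>|^(d+1) t^(d+1); dividing
  by t^d and letting t tend to 0 from the right forces the value 0.\<close>

lemma hpoly_eq_0:
  assumes q: "hpoly d q" and v: "vanish (Suc d) q"
  shows "q \<xi> = 0"
proof -
  obtain C where C: "\<forall>\<^sub>F \<xi> in nhds 0. norm (q \<xi>) \<le> C * norm \<xi> ^ Suc d"
    using v by (rule vanishE)
  have "((\<lambda>t::real. t *\<^sub>R \<xi>) \<longlongrightarrow> 0 *\<^sub>R \<xi>) (at_right 0)"
    by (intro tendsto_intros)
  then have "((\<lambda>t::real. t *\<^sub>R \<xi>) \<longlongrightarrow> 0) (at_right 0)" by simp
  with C have "\<forall>\<^sub>F t in at_right 0. norm (q (t *\<^sub>R \<xi>)) \<le> C * norm (t *\<^sub>R \<xi>) ^ Suc d"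
    by (rule eventually_compose_filterlim)
  then have "\<forall>\<^sub>F t in at_right 0. norm (q \<xi>) \<le> (C * norm \<xi> ^ Suc d) * t"
    using eventually_at_right_less[of 0]
  proof eventually_elim
    case (elim t)
    then have "t ^ d * \<bar>q \<xi>\<bar> \<le> t ^ d * ((C * norm \<xi> ^ Suc d) * t)"
      by (simp add: hpoly_scaleR[OF q] abs_mult power_mult_distrib mult_ac)
    then show ?case using elim by (simp del: power_Suc)
  qed
  moreover have "((\<lambda>t::real. (C * norm \<xi> ^ Suc d) * t) \<longlongrightarrow> (C * norm \<xi> ^ Suc d) * 0) (at_right 0)"
    by (intro tendsto_intros)
  ultimately have "norm (q \<xi>) \<le> (C * norm \<xi> ^ Suc d) * 0"
    by (intro tendsto_lowerbound[where F = "at_right 0"]) auto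
  then show ?thesis by simp
qed

section \<open>Polynomials as finite sums of homogeneous parts\<close>

definition pol_le :: "nat \<Rightarrow> (real^3 \<Rightarrow> real) \<Rightarrow> bool" where
  "pol_le n q \<longleftrightarrow> (\<exists>Q. (\<forall>k. hpoly k (Q k)) \<and> (\<forall>\<xi>. q \<xi> = (\<Sum>k\<le>n. Q k \<xi>)))"

definition pol :: "(real^3 \<Rightarrow> real) \<Rightarrow> bool" where
  "pol q \<longleftrightarrow> (\<exists>n. pol_le n q)"

lemma pol_le_add:
  assumes "pol_le n p" "pol_le n q"
  shows "pol_le n (\<lambda>\<xi>. p \<xi> + q \<xi>)"
proof -
  obtain P Q where "\<forall>k. hpoly k (P k)" "\<forall>\<xi>. p \<xi> = (\<Sum>k\<le>n. P k \<xi>)"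
    "\<forall>k. hpoly k (Q k)" "\<forall>\<xi>. q \<xi> = (\<Sum>k\<le>n. Q k \<xi>)"
    using assms unfolding pol_le_def by blast
  then show ?thesis unfolding pol_le_def
    by (intro exI[of _ "\<lambda>k \<xi>. P k \<xi> + Q k \<xi>"]) (auto intro: hpoly.add simp: sum.distrib)
qed

lemma hpoly_pol_le:
  assumes "hpoly k q" "k \<le> n"
  shows "pol_le n q"
  unfolding pol_le_def
proof (intro exI conjI allI)
  fix j \<xi>
  show "hpoly j (if j = k then q else (\<lambda>_. 0))" using assms(1) hpoly_zero by auto
  show "q \<xi> = (\<Sum>j\<le>n. (if j = k then q else (\<lambda>_. 0)) \<xi>)"
    using assms(2) by (simp add: if_distribR cong: if_cong)
qed

lemma pol_le_sum: "(\<And>i. i \<in> I \<Longrightarrow> pol_le n (p i)) \<Longrightarrow> pol_le n (\<lambda>\<xi>. \<Sum>i\<in>I. p i \<xi>)"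
  by (induction I rule: infinite_finite_induct)
    (auto intro: pol_le_add hpoly_pol_le[OF hpoly_zero order_refl])

lemma pol_le_mult:
  assumes "pol_le m p" "pol_le n q"
  shows "pol_le (m + n) (\<lambda>\<xi>. p \<xi> * q \<xi>)"
proof -
  obtain P Q where *: "\<And>k. hpoly k (P k)" "\<And>\<xi>. p \<xi> = (\<Sum>k\<le>m. P k \<xi>)"
    "\<And>k. hpoly k (Q k)" "\<And>\<xi>. q \<xi> = (\<Sum>k\<le>n. Q k \<xi>)"
    using assms unfolding pol_le_def by blast
  have "pol_le (m + n) (\<lambda>\<xi>. \<Sum>i\<le>m. \<Sum>j\<le>n. P i \<xi> * Q j \<xi>)"
    by (intro pol_le_sum hpoly_pol_le[OF hpoly.mult[OF *(1,3)]]) auto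
  then show ?thesis by (simp add: *(2,4) sum_product)
qed

lemma pol_le_mono:
  assumes "pol_le m p" "m \<le> n"
  shows "pol_le n p"
proof -
  obtain P where *: "\<And>k. hpoly k (P k)" "\<And>\<xi>. p \<xi> = (\<Sum>k\<le>m. P k \<xi>)"
    using assms unfolding pol_le_def by blast
  have "pol_le n (\<lambda>\<xi>. \<Sum>k\<le>m. P k \<xi>)"
    using assms(2) by (intro pol_le_sum hpoly_pol_le[OF *(1)]) auto
  moreover have "p = (\<lambda>\<xi>. \<Sum>k\<le>m. P k \<xi>)" using *(2) by auto
  ultimately show ?thesis by simp
qed

lemma pol_le_cmult: "pol_le n p \<Longrightarrow> pol_le n (\<lambda>\<xi>. a * p \<xi>)"
  using pol_le_mult[OF hpoly_pol_le[OF hpoly.const[of a], of 0]] by simp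

lemma pol_le_diff: "pol_le n p \<Longrightarrow> pol_le n q \<Longrightarrow> pol_le n (\<lambda>\<xi>. p \<xi> - q \<xi>)"
  using pol_le_add[OF _ pol_le_cmult, of n p q "-1"] by simp

lemma pol_le_comp_matrix:
  assumes "pol_le n q"
  shows "pol_le n (\<lambda>\<xi>. q (M *v \<xi>))"
proof -
  obtain Q where *: "\<And>k. hpoly k (Q k)" "\<And>\<xi>. q \<xi> = (\<Sum>k\<le>n. Q k \<xi>)"
    using assms unfolding pol_le_def by blast
  show ?thesis unfolding *(2)
    by (intro pol_le_sum hpoly_pol_le[OF hpoly_comp_matrix[OF *(1)]]) auto
qed

lemma hpoly_pol: "hpoly d q \<Longrightarrow> pol q"
  unfolding pol_def using hpoly_pol_le by blast

lemma pol_add: "pol p \<Longrightarrow> pol q \<Longrightarrow> pol (\<lambda>\<xi>. p \<xi> + q \<xi>)"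
  unfolding pol_def using pol_le_add pol_le_mono max.cobounded1 max.cobounded2 by metis

lemma pol_mult: "pol p \<Longrightarrow> pol q \<Longrightarrow> pol (\<lambda>\<xi>. p \<xi> * q \<xi>)"
  unfolding pol_def using pol_le_mult by blast

lemma pol_const: "pol (\<lambda>_. a)"
  using hpoly_pol[OF hpoly.const] .

lemma pol_coord: "pol (\<lambda>\<xi>. \<xi> $ i)"
  using hpoly_pol[OF hpoly.coord] .

lemma pol_diff: "pol p \<Longrightarrow> pol q \<Longrightarrow> pol (\<lambda>\<xi>. p \<xi> - q \<xi>)"
  using pol_add[OF _ pol_mult[OF pol_const[of "-1"]], of p q] by simp

lemma pol_sum: "(\<And>i. i \<in> I \<Longrightarrow> pol (p i)) \<Longrightarrow> pol (\<lambda>\<xi>. \<Sum>i\<in>I. p i \<xi>)"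
  by (induction I rule: infinite_finite_induct) (auto intro: pol_add pol_const)

lemma pol_power: "pol p \<Longrightarrow> pol (\<lambda>\<xi>. p \<xi> ^ n)"
  by (induction n) (auto intro: pol_mult pol_const)

lemma pol_comp:
  assumes "pol q" "\<And>i. pol (\<lambda>\<xi>. A \<xi> $ i)"
  shows "pol (\<lambda>\<xi>. q (A \<xi>))"
proof -
  have h: "pol (\<lambda>\<xi>. q (A \<xi>))" if "hpoly d q" for d q
    using that by (induction rule: hpoly.induct) (auto intro: pol_const assms(2) pol_add pol_mult)
  obtain n Q where *: "\<And>k. hpoly k (Q k)" "\<And>\<xi>. q \<xi> = (\<Sum>k\<le>n. Q k \<xi>)"
    using assms unfolding pol_le_def pol_def by blast
  show ?thesis unfolding *(2) by (intro pol_sum h[OF *(1)])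
qed

text \<open>By strong induction the parts below degree k are zero, and those above have order k + 1;
  so \<open>Q k\<close> itself has order k + 1 and is zero by homogeneity.\<close>

lemma hpoly_sum_vanish_imp_0:
  assumes Q: "\<And>k. hpoly k (Q k)" and v: "vanish m (\<lambda>\<xi>. \<Sum>k\<le>n. Q k \<xi>)"
  shows "k < m \<Longrightarrow> k \<le> n \<Longrightarrow> Q k \<xi> = 0"
proof (induction k arbitrary: \<xi> rule: less_induct)
  case (less k)
  have "vanish (Suc k) (\<lambda>\<xi>. (\<Sum>j\<le>n. Q j \<xi>) - (\<Sum>j\<in>{Suc k..n}. Q j \<xi>))"
  proof (rule vanish_diff)
    show "vanish (Suc k) (\<lambda>\<xi>. \<Sum>j\<le>n. Q j \<xi>)"
      using less.prems by (intro vanish_mono[OF v]) auto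
    show "vanish (Suc k) (\<lambda>\<xi>. \<Sum>j\<in>{Suc k..n}. Q j \<xi>)"
      by (rule vanish_sum, rule vanish_mono[OF hpoly_vanish[OF Q]]) auto
  qed
  moreover have "(\<Sum>j\<le>n. Q j \<xi>) - (\<Sum>j\<in>{Suc k..n}. Q j \<xi>) = Q k \<xi>" for \<xi>
  proof -
    have "(\<Sum>j\<le>n. Q j \<xi>) = (\<Sum>j<k. Q j \<xi>) + Q k \<xi> + (\<Sum>j\<in>{Suc k..n}. Q j \<xi>)"
    proof -
      have "{..n} = insert k {..<k} \<union> {Suc k..n}" using less.prems by auto
      then have "(\<Sum>j\<le>n. Q j \<xi>) = (\<Sum>j\<in>insert k {..<k} \<union> {Suc k..n}. Q j \<xi>)"
        by (rule arg_cong)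
      also have "\<dots> = (\<Sum>j\<in>insert k {..<k}. Q j \<xi>) + (\<Sum>j\<in>{Suc k..n}. Q j \<xi>)"
        by (intro sum.union_disjoint) auto
      finally show ?thesis by simp
    qed
    moreover have "(\<Sum>j<k. Q j \<xi>) = 0" 
      by (rule sum.neutral, rule ballI, rule less.IH) (use less.prems in auto)
    ultimately show ?thesis by simp
  qed
  ultimately have "vanish (Suc k) (Q k)" by simp
  then show ?case by (rule hpoly_eq_0[OF Q])
qed

lemma pol_leading_term:
  assumes "pol q" "vanish d q"
  obtains r where "hpoly d r" "vanish (Suc d) (\<lambda>\<xi>. q \<xi> - r \<xi>)" "pol (\<lambda>\<xi>. q \<xi> - r \<xi>)"
proof -
  obtain n0 where "pol_le n0 q" using assms(1) unfolding pol_def by blast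
  \<comment> \<open>Padding the degree bound guarantees that degree d occurs among the summands even
    if the polynomial has lower degree.\<close>
  then have "pol_le (n0 + d) q" by (rule pol_le_mono) simp
  then obtain Q where Q: "\<And>k. hpoly k (Q k)" "\<And>\<xi>. q \<xi> = (\<Sum>k\<le>n0 + d. Q k \<xi>)"
    unfolding pol_le_def by blast
  have "q = (\<lambda>\<xi>. \<Sum>k\<le>n0 + d. Q k \<xi>)" by (rule ext, rule Q(2))
  then have "vanish d (\<lambda>\<xi>. \<Sum>k\<le>n0 + d. Q k \<xi>)" using assms(2) by metis
  then have 0: "Q k \<xi> = 0" if "k < d" for k \<xi>
    using that by (rule hpoly_sum_vanish_imp_0[OF Q(1)]) (use that in simp)
  have "q \<xi> - Q d \<xi> = (\<Sum>j\<in>{Suc d..n0 + d}. Q j \<xi>)" for \<xi>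
  proof -
    have "{..n0 + d} = insert d {..<d} \<union> {Suc d..n0 + d}" by auto
    then have "q \<xi> = (\<Sum>j\<in>insert d {..<d} \<union> {Suc d..n0 + d}. Q j \<xi>)" by (simp add: Q(2))
    also have "\<dots> = (\<Sum>j\<in>insert d {..<d}. Q j \<xi>) + (\<Sum>j\<in>{Suc d..n0 + d}. Q j \<xi>)"
      by (intro sum.union_disjoint) auto
    finally show ?thesis using 0 by simp
  qed
  moreover have "vanish (Suc d) (\<lambda>\<xi>. \<Sum>j\<in>{Suc d..n0 + d}. Q j \<xi>)"
    by (intro vanish_sum vanish_mono[OF hpoly_vanish[OF Q(1)]]) auto
  moreover have "pol (\<lambda>\<xi>. q \<xi> - Q d \<xi>)"
    by (intro pol_diff assms hpoly_pol[OF Q(1)])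
  ultimately show thesis using that[OF Q(1)[of d]] by simp
qed

text \<open>The constant part cancels and every other homogeneous part has degree at least 1, so no
  order is lost. Order 0 is treated apart because \<open>hpoly_Lipschitz\<close> starts from a
  difference of order at least 1.\<close>

lemma pol_Lipschitz:
  assumes "pol q" and A: "vanish 1 A" "vanish 1 B" "vanish k (\<lambda>\<xi>. A \<xi> - B \<xi>)"
  shows "vanish k (\<lambda>\<xi>. q (A \<xi>) - q (B \<xi>))"
proof (cases k)
  case 0
  obtain n Q where *: "\<And>k. hpoly k (Q k)" "\<And>\<xi>. q \<xi> = (\<Sum>k\<le>n. Q k \<xi>)"
    using assms(1) unfolding pol_le_def pol_def by blast
  have "vanish 0 q" unfolding *(2)
    by (intro vanish_sum vanish_mono[OF hpoly_vanish[OF *(1)]]) auto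
  then show ?thesis unfolding 0 
    using vanish_diff[OF vanish_comp[OF _ A(1)] vanish_comp[OF _ A(2)]] by blast
next
  case (Suc k')
  obtain n Q where *: "\<And>k. hpoly k (Q k)" "\<And>\<xi>. q \<xi> = (\<Sum>k\<le>n. Q k \<xi>)"
    using assms(1) unfolding pol_le_def pol_def by blast
  have "vanish k (\<lambda>\<xi>. Q j (A \<xi>) - Q j (B \<xi>))" for j
  proof (cases j)
    case 0
    obtain a where "Q 0 = (\<lambda>_. a)" using hpoly_0_const[OF *(1)] by blast
    with 0 show ?thesis by simp
  next
    case (Suc j')
    have "vanish (k' + j) (\<lambda>\<xi>. Q j (A \<xi>) - Q j (B \<xi>))"
      using A \<open>k = Suc k'\<close> by (intro hpoly_Lipschitz *(1)) auto
    then show ?thesis using Suc \<open>k = Suc k'\<close> by (auto intro: vanish_mono)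
  qed
  then have "vanish k (\<lambda>\<xi>. \<Sum>j\<le>n. Q j (A \<xi>) - Q j (B \<xi>))" by (intro vanish_sum)
  then show ?thesis unfolding *(2) by (simp only: sum_subtractf)
qed

section \<open>Partial derivatives\<close>

definition pd :: "3 \<Rightarrow> (real^3 \<Rightarrow> real) \<Rightarrow> real^3 \<Rightarrow> real" where
  "pd i q \<xi> = frechet_derivative q (at \<xi>) (axis i 1)"

definition jac :: "(real^3 \<Rightarrow> real^3) \<Rightarrow> real^3 \<Rightarrow> real^3^3" where
  "jac P \<xi> = (\<chi> i j. pd j (\<lambda>\<xi>. P \<xi> $ i) \<xi>)"

lemma pd_eqI: "(q has_derivative q') (at \<xi>) \<Longrightarrow> pd i q \<xi> = q' (axis i 1)"
  unfolding pd_def using frechet_derivative_at by metis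

lemma has_derivative_pd:
  assumes "q differentiable (at \<xi>)"
  shows "(q has_derivative (\<lambda>v. \<Sum>i\<in>UNIV. v $ i * pd i q \<xi>)) (at \<xi>)"
proof -
  let ?q' = "frechet_derivative q (at \<xi>)"
  have d: "(q has_derivative ?q') (at \<xi>)"
    using assms by (simp add: frechet_derivative_works)
  then have lin: "linear ?q'" by (rule has_derivative_linear)
  have "?q' v = (\<Sum>i\<in>UNIV. v $ i * pd i q \<xi>)" for v
  proof -
    have "v = (\<Sum>i\<in>UNIV. (v $ i) *\<^sub>R axis i 1)"
      by (simp add: vec_eq_iff axis_def if_distrib cong: if_cong)
    then have "?q' v = ?q' (\<Sum>i\<in>UNIV. (v $ i) *\<^sub>R axis i 1)" by (rule arg_cong)
    then show ?thesis by (simp only: linear_sum[OF lin] linear_scale[OF lin] pd_def real_scaleR_def)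
  qed
  then have "?q' = (\<lambda>v. \<Sum>i\<in>UNIV. v $ i * pd i q \<xi>)" by (rule ext)
  with d show ?thesis by metis
qed

lemma has_derivative_jac:
  assumes "\<And>i. (\<lambda>\<xi>. P \<xi> $ i) differentiable (at \<xi>)"
  shows "(P has_derivative (*v) (jac P \<xi>)) (at \<xi>)"
proof -
  have "((\<lambda>\<xi>. P \<xi> $ i) has_derivative (\<lambda>v. (jac P \<xi> *v v) $ i)) (at \<xi>)" for i
    using has_derivative_pd[OF assms[of i]]
    by (simp add: jac_def matrix_vector_mult_def mult.commute)
  then have "((\<lambda>\<xi>. \<Sum>i\<in>UNIV. (P \<xi> $ i) *\<^sub>R (axis i 1 :: real^3)) has_derivative
      (\<lambda>v. \<Sum>i\<in>UNIV. ((jac P \<xi> *v v) $ i) *\<^sub>R (axis i 1 :: real^3))) (at \<xi>)"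
    by (intro has_derivative_sum has_derivative_scaleR_left)
  moreover have "(\<Sum>i\<in>UNIV. (v $ i) *\<^sub>R axis i 1) = v" for v :: "real^3"
    by (simp add: vec_eq_iff axis_def if_distrib cong: if_cong)
  ultimately show ?thesis by simp
qed

lemma jac_eqI:
  assumes "(P has_derivative (*v) M) (at \<xi>)"
  shows "jac P \<xi> = M"
proof -
  have "pd j (\<lambda>\<xi>. P \<xi> $ i) \<xi> = (M *v axis j 1) $ i" for i j
    by (intro pd_eqI bounded_linear.has_derivative[OF bounded_linear_vec_nth] assms)
  then show ?thesis
    by (simp add: jac_def vec_eq_iff matrix_vector_mult_basis column_def)
qed

lemma vol_pres_onI:
  assumes "\<And>x. x \<in> S \<Longrightarrow> (P has_derivative (*v) (M x)) (at x)" "\<And>x. x \<in> S \<Longrightarrow> det (M x) = 1"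
  shows "vol_pres_on S P"
  unfolding vol_pres_on_def
proof (intro ballI conjI)
  fix x assume x: "x \<in> S"
  show "P differentiable at x" using assms(1)[OF x] unfolding differentiable_def by blast
  have "frechet_derivative P (at x) = (*v) (M x)"
    using frechet_derivative_at[OF assms(1)[OF x]] by simp
  then show "det (matrix (frechet_derivative P (at x))) = 1"
    using assms(2)[OF x] by simp
qed

lemma pd_const: "pd i (\<lambda>_. a) \<xi> = 0"
  using pd_eqI[OF has_derivative_const] by simp

lemma pd_add:
  assumes "p differentiable (at \<xi>)" "q differentiable (at \<xi>)"
  shows "pd i (\<lambda>\<xi>. p \<xi> + q \<xi>) \<xi> = pd i p \<xi> + pd i q \<xi>"
  using pd_eqI[OF has_derivative_add] assms unfolding pd_def frechet_derivative_works by blast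

lemma pd_diff:
  assumes "p differentiable (at \<xi>)" "q differentiable (at \<xi>)"
  shows "pd i (\<lambda>\<xi>. p \<xi> - q \<xi>) \<xi> = pd i p \<xi> - pd i q \<xi>"
  using pd_eqI[OF has_derivative_diff] assms unfolding pd_def frechet_derivative_works by blast

lemma pd_mult:
  assumes "p differentiable (at \<xi>)" "q differentiable (at \<xi>)"
  shows "pd i (\<lambda>\<xi>. p \<xi> * q \<xi>) \<xi> = p \<xi> * pd i q \<xi> + pd i p \<xi> * q \<xi>"
  using pd_eqI[OF has_derivative_mult] assms unfolding pd_def frechet_derivative_works by blast

lemma pd_sum:
  assumes "\<And>j. j \<in> I \<Longrightarrow> p j differentiable (at \<xi>)"
  shows "pd i (\<lambda>\<xi>. \<Sum>j\<in>I. p j \<xi>) \<xi> = (\<Sum>j\<in>I. pd i (p j) \<xi>)"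
proof -
  have "((\<lambda>\<xi>. \<Sum>j\<in>I. p j \<xi>) has_derivative (\<lambda>v. \<Sum>j\<in>I. frechet_derivative (p j) (at \<xi>) v)) (at \<xi>)"
    using assms by (intro has_derivative_sum) (simp add: frechet_derivative_works)
  from pd_eqI[OF this] show ?thesis by (simp add: pd_def)
qed

text \<open>The truncated \<open>d - 1\<close> is harmless: in degree 0 the derivative is the zero
  function, homogeneous of any degree. In a product this forces a case split, since for n = 0 the
  degree m + (n - 1) would differ from m + n - 1.\<close>

lemma hpoly_deriv: "hpoly d q \<Longrightarrow> q differentiable (at \<xi>) \<and> hpoly (d - 1) (pd i q)"
proof (induction arbitrary: \<xi> rule: hpoly.induct)
  case (const a)
  have "pd i (\<lambda>_. a) = (\<lambda>_. 0)" using pd_const by (intro ext)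
  then show ?case using hpoly_zero by simp
next
  case (coord j)
  have d: "((\<lambda>\<xi>::real^3. \<xi> $ j) has_derivative (\<lambda>v. v $ j)) (at \<xi>)" for \<xi>
    by (intro bounded_linear.has_derivative[OF bounded_linear_vec_nth] has_derivative_ident)
  have "pd i (\<lambda>\<xi>. \<xi> $ j) = (\<lambda>_. axis i 1 $ j)" using pd_eqI[OF d] by (intro ext)
  then show ?case using d hpoly.const unfolding differentiable_def by fastforce
next
  case (add d p q)
  have "pd i (\<lambda>\<xi>. p \<xi> + q \<xi>) = (\<lambda>\<xi>. pd i p \<xi> + pd i q \<xi>)"
    using add.IH by (intro ext pd_add) auto
  then show ?case using add.IH by (auto intro: hpoly.add differentiable_add)
next
  case (mult m p n q)
  have eq: "pd i (\<lambda>\<xi>. p \<xi> * q \<xi>) = (\<lambda>\<xi>. p \<xi> * pd i q \<xi> + pd i p \<xi> * q \<xi>)"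
    using mult.IH by (intro ext pd_mult) auto
  have pd0: "pd i r = (\<lambda>_. 0)" if "hpoly 0 r" for r
    using hpoly_0_const[OF that] pd_const by auto
  have 1: "hpoly (m + n - 1) (\<lambda>\<xi>. p \<xi> * pd i q \<xi>)"
  proof (cases n)
    case 0
    then show ?thesis using pd0[of q] mult.hyps hpoly_zero by simp
  next
    case (Suc n')
    then show ?thesis using hpoly.mult[OF mult.hyps(1), of n' "pd i q"] mult.IH by simp
  qed
  have 2: "hpoly (m + n - 1) (\<lambda>\<xi>. pd i p \<xi> * q \<xi>)"
  proof (cases m)
    case 0
    then show ?thesis using pd0[of p] mult.hyps hpoly_zero by simp
  next
    case (Suc m')
    then show ?thesis using hpoly.mult[OF _ mult.hyps(2), of m' "pd i p"] mult.IH by simp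
  qed
  show ?case unfolding eq using mult.IH 1 2 by (auto intro: hpoly.add differentiable_mult)
qed

lemmas hpoly_differentiable = hpoly_deriv[THEN conjunct1]
lemmas hpoly_pd = hpoly_deriv[THEN conjunct2]

lemma pol_pd_sum:
  assumes "\<And>k. hpoly k (Q k)" "\<And>\<xi>. q \<xi> = (\<Sum>k\<le>(n::nat). Q k \<xi>)"
  shows "q differentiable (at \<xi>)" "pd i q = (\<lambda>\<xi>. \<Sum>k\<le>n. pd i (Q k) \<xi>)"
proof -
  have q: "q = (\<lambda>\<xi>. \<Sum>k\<le>n. Q k \<xi>)" by (rule ext, rule assms(2))
  show "q differentiable (at \<xi>)" unfolding q
    by (intro differentiable_sum) (auto intro: hpoly_differentiable[OF assms(1)])
  show "pd i q = (\<lambda>\<xi>. \<Sum>k\<le>n. pd i (Q k) \<xi>)" unfolding q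
    by (intro ext pd_sum hpoly_differentiable[OF assms(1)])
qed

lemma pol_expand:
  assumes "pol q"
  obtains n Q where "\<And>k. hpoly k (Q k)" "\<And>\<xi>. q \<xi> = (\<Sum>k\<le>n. Q k \<xi>)"
  using assms unfolding pol_def pol_le_def by blast

lemma pol_differentiable: "pol q \<Longrightarrow> q differentiable (at \<xi>)"
  by (erule pol_expand) (rule pol_pd_sum(1))

lemma pol_pd: "pol q \<Longrightarrow> pol (pd i q)"
proof (erule pol_expand)
  fix n Q assume *: "\<And>k. hpoly k (Q k)" "\<And>\<xi>. q \<xi> = (\<Sum>k\<le>(n::nat). Q k \<xi>)"
  show "pol (pd i q)" unfolding pol_pd_sum(2)[OF *]
    by (intro pol_sum hpoly_pol[OF hpoly_pd[OF *(1)]])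
qed

lemma vanish_pd_high:
  assumes "\<And>k. hpoly k (Q k)" "\<And>k. k \<le> d \<Longrightarrow> pd i (Q k) = (\<lambda>_. 0)"
  shows "vanish d (\<lambda>\<xi>. \<Sum>k\<le>(n::nat). pd i (Q k) \<xi>)"
proof (rule vanish_sum)
  fix k
  show "vanish d (pd i (Q k))"
  proof (cases "k \<le> d")
    case True
    then show ?thesis using assms(2) by simp
  next
    case False
    then show ?thesis by (intro vanish_mono[OF hpoly_vanish[OF hpoly_pd[OF assms(1)]]]) simp
  qed
qed

text \<open>Being polynomial matters: vanishing to order d + 1 kills all homogeneous parts of degree
  at most d, and the derivatives of the others have degree at least d.\<close>

lemma vanish_pd:
  assumes "pol q" "vanish (Suc d) q"
  shows "vanish d (pd i q)"
proof -
  obtain n0 where "pol_le n0 q" using assms(1) unfolding pol_def by blast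
  then have "pol_le (n0 + d) q" by (rule pol_le_mono) simp
  then obtain Q where Q: "\<And>k. hpoly k (Q k)" "\<And>\<xi>. q \<xi> = (\<Sum>k\<le>n0 + d. Q k \<xi>)"
    unfolding pol_le_def by blast
  have q: "q = (\<lambda>\<xi>. \<Sum>k\<le>n0 + d. Q k \<xi>)" by (rule ext, rule Q(2))
  have v: "vanish (Suc d) (\<lambda>\<xi>. \<Sum>k\<le>n0 + d. Q k \<xi>)" using assms(2) q by metis
  have "pd i (Q k) = (\<lambda>_. 0)" if "k \<le> d" for k
  proof -
    have "Q k \<xi> = 0" for \<xi>
      by (rule hpoly_sum_vanish_imp_0[OF Q(1) v]) (use that in auto)
    then have "Q k = (\<lambda>_. 0)" by (rule ext)
    then show ?thesis using pd_const by (metis (no_types))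
  qed
  then show ?thesis unfolding pol_pd_sum(2)[OF Q] by (rule vanish_pd_high[OF Q(1)])
qed

lemma pol_Ck: "pol q \<Longrightarrow> Ck k U q"
proof (induction k arbitrary: q)
  case 0
  then show ?case
    by (simp add: continuous_at_imp_continuous_on differentiable_imp_continuous_within pol_differentiable)
next
  case (Suc k)
  have "Ck k U (pd i q)" for i by (intro Suc.IH pol_pd Suc.prems)
  then show ?case using pol_differentiable[OF Suc.prems] by (simp add: pd_def[abs_def])
qed

lemma smooth_on_pol: "(\<And>i. pol (\<lambda>\<xi>. P \<xi> $ i)) \<Longrightarrow> smooth_on U P"
  unfolding smooth_on_def using pol_Ck by blast

text \<open>Homogeneous polynomials with explicit exponents, for the arguments that must see
  monomials: integration in one variable, matching of multinomial coefficients, and the degree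
  notion \<open>poly3_deg_le\<close>.\<close>

inductive monspan :: "nat \<Rightarrow> (real^3 \<Rightarrow> real) \<Rightarrow> bool" where
  mono: "i + j + k = d \<Longrightarrow> monspan d (\<lambda>\<xi>. a * (\<xi>$1 ^ i * \<xi>$2 ^ j * \<xi>$3 ^ k))"
| add: "monspan d p \<Longrightarrow> monspan d q \<Longrightarrow> monspan d (\<lambda>\<xi>. p \<xi> + q \<xi>)"

lemma monspan_mult:
  assumes "monspan m p" "monspan n q"
  shows "monspan (m + n) (\<lambda>\<xi>. p \<xi> * q \<xi>)"
  using assms(1)
proof (induction rule: monspan.induct)
  case (mono i j k d a)
  from assms(2) show ?case
  proof (induction rule: monspan.induct)
    case (mono i' j' k' d' a')
    have "monspan (d + d') (\<lambda>\<xi>. (a * a') * (\<xi>$1 ^ (i + i') * \<xi>$2 ^ (j + j') * \<xi>$3 ^ (k + k')))"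
      using mono \<open>i + j + k = d\<close> by (intro monspan.mono) auto
    then show ?case by (simp add: power_add mult_ac)
  next
    case (add d' p q)
    then show ?case using monspan.add by (fastforce simp: distrib_left)
  qed
next
  case (add d p q)
  then show ?case using monspan.add by (fastforce simp: distrib_right)
qed

lemma hpoly_imp_monspan: "hpoly d q \<Longrightarrow> monspan d q"
proof (induction rule: hpoly.induct)
  case (const a)
  show ?case using monspan.mono[of 0 0 0 0 a] by simp
next
  case (coord i)
  show ?case using exhaust_3[of i] monspan.mono[of 1 0 0 1 1] monspan.mono[of 0 1 0 1 1]
      monspan.mono[of 0 0 1 1 1] by auto
next
  case (add d p q)
  then show ?case by (rule_tac monspan.add)
next
  case (mult m p n q)
  then show ?case by (rule_tac monspan_mult)
qed

lemma hpoly_monomial: "hpoly (i + j + k) (\<lambda>\<xi>. a * (\<xi>$1 ^ i * \<xi>$2 ^ j * \<xi>$3 ^ k))"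
proof -
  have "hpoly (1 * i + 1 * j + 1 * k) (\<lambda>\<xi>. \<xi>$1 ^ i * \<xi>$2 ^ j * \<xi>$3 ^ k)"
    by (intro hpoly.mult hpoly_power hpoly.coord)
  then show ?thesis by (intro hpoly_cmult) simp
qed

lemma has_derivative_monomial:
  "((\<lambda>\<xi>::real^3. a * (\<xi>$1 ^ i * \<xi>$2 ^ j * \<xi>$3 ^ k)) has_derivative
    (\<lambda>v. a * (real i * v$1 * \<xi>$1 ^ (i - 1) * \<xi>$2 ^ j * \<xi>$3 ^ k
      + \<xi>$1 ^ i * (real j * v$2 * \<xi>$2 ^ (j - 1)) * \<xi>$3 ^ k
      + \<xi>$1 ^ i * \<xi>$2 ^ j * (real k * v$3 * \<xi>$3 ^ (k - 1))))) (at \<xi>)"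
  by (auto intro!: derivative_eq_intros bounded_linear_imp_has_derivative bounded_linear_vec_nth
      simp: algebra_simps)

lemma monspan_antiderivative: "monspan d q \<Longrightarrow> \<exists>B. pol B \<and> pd j B = q"
proof (induction rule: monspan.induct)
  case (mono i1 i2 i3 d a)
  have eq: "a / real (Suc k) * (real (Suc k) * t) = a * t"
    "a / real (Suc k) * (u * (real (Suc k) * t)) = a * (u * t)"
    "a / real (Suc k) * (u * (w * (real (Suc k) * t))) = a * (u * (w * t))" for k t u w by simp_all
  consider "j = 1" | "j = 2" | "j = 3" using exhaust_3[of j] by blast
  then show ?case
  proof cases
    case 1
    show ?thesis
      by (intro exI[of _ "\<lambda>\<xi>. (a / real (Suc i1)) * (\<xi>$1 ^ Suc i1 * \<xi>$2 ^ i2 * \<xi>$3 ^ i3)"] conjI ext)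
        (rule hpoly_pol[OF hpoly_monomial], subst pd_eqI[OF has_derivative_monomial],
          simp add: 1 axis_def eq mult.assoc del: power_Suc of_nat_Suc times_divide_eq_left)
  next
    case 2
    show ?thesis
      by (intro exI[of _ "\<lambda>\<xi>. (a / real (Suc i2)) * (\<xi>$1 ^ i1 * \<xi>$2 ^ Suc i2 * \<xi>$3 ^ i3)"] conjI ext)
        (rule hpoly_pol[OF hpoly_monomial], subst pd_eqI[OF has_derivative_monomial],
          simp add: 2 axis_def eq mult.assoc del: power_Suc of_nat_Suc times_divide_eq_left)
  next
    case 3
    show ?thesis
      by (intro exI[of _ "\<lambda>\<xi>. (a / real (Suc i3)) * (\<xi>$1 ^ i1 * \<xi>$2 ^ i2 * \<xi>$3 ^ Suc i3)"] conjI ext)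
        (rule hpoly_pol[OF hpoly_monomial], subst pd_eqI[OF has_derivative_monomial],
          simp add: 3 axis_def eq mult.assoc del: power_Suc of_nat_Suc times_divide_eq_left)
  qed
next
  case (add d p q)
  then obtain A B where *: "pol A" "pd j A = p" "pol B" "pd j B = q" by blast
  then have "pd j (\<lambda>\<xi>. A \<xi> + B \<xi>) = (\<lambda>\<xi>. p \<xi> + q \<xi>)"
    by (auto simp: pd_add pol_differentiable)
  then show ?case using pol_add[OF *(1,3)] by blast
qed

lemma pol_antiderivative:
  assumes "pol q"
  obtains B where "pol B" "pd j B = q"
proof -
  obtain n Q where Q: "\<And>k. hpoly k (Q k)" "\<And>\<xi>. q \<xi> = (\<Sum>k\<le>n. Q k \<xi>)"
    using assms by (rule pol_expand) blast
  have "\<exists>B. pol B \<and> pd j B = Q k" for k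
    by (rule monspan_antiderivative[OF hpoly_imp_monspan[OF Q(1)]])
  then obtain B where B: "\<And>k. pol (B k)" "\<And>k. pd j (B k) = Q k" by metis
  have "pd j (\<lambda>\<xi>. \<Sum>k\<le>n. B k \<xi>) = q"
    by (rule ext) (simp add: pd_sum pol_differentiable B Q(2))
  moreover have "pol (\<lambda>\<xi>. \<Sum>k\<le>n. B k \<xi>)" by (intro pol_sum B)
  ultimately show thesis by (rule that[rotated])
qed

text \<open>Mean value inequality on the segment from B \<xi> to A \<xi>, whose points have norm at
  most (a + b)|\<xi>|. Only directions in which A and B differ contribute, so a single controlled
  partial derivative suffices when just one coordinate moves.\<close>

lemma vanish_segment:
  assumes diff: "\<forall>\<^sub>F \<xi> in nhds 0. g differentiable (at \<xi>)"
    and A: "vanish 1 A" "vanish 1 B"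
    and pd: "\<And>i. (\<forall>\<xi>. A \<xi> $ i = B \<xi> $ i) \<or> vanish D (pd i g)"
  shows "vanish (Suc D) (\<lambda>\<xi>. g (A \<xi>) - g (B \<xi>))"
proof -
  \<comment> \<open>This \<open>J\<close> is the set of controlled directions, not the matrix.
    Outside it the difference A - B has component 0, and the constant \<open>K i\<close> is an
    arbitrary positive filler.\<close>
  define J where "J = {i. vanish D (pd i g)}"
  have "\<exists>C>0. i \<in> J \<longrightarrow> (\<forall>\<^sub>F \<xi> in nhds 0. norm (pd i g \<xi>) \<le> C * norm \<xi> ^ D)" for i
  proof (cases "i \<in> J")
    case True
    then have "vanish D (pd i g)" unfolding J_def by simp
    then show ?thesis by (rule vanishE) blast
  qed (auto intro: exI[of _ 1])
  then obtain K where K: "\<And>i. K i > 0"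
    "\<And>i. i \<in> J \<Longrightarrow> \<forall>\<^sub>F \<xi> in nhds 0. norm (pd i g \<xi>) \<le> K i * norm \<xi> ^ D" by metis
  have ev: "\<forall>\<^sub>F \<xi> in nhds 0. g differentiable (at \<xi>) \<and> (\<forall>i\<in>J. norm (pd i g \<xi>) \<le> K i * norm \<xi> ^ D)"
    using diff K(2) by (intro eventually_conj eventually_ball_finite) auto
  then obtain e where e: "e > 0" "\<And>\<xi>. norm \<xi> < e \<Longrightarrow> g differentiable (at \<xi>)"
    "\<And>\<xi> i. norm \<xi> < e \<Longrightarrow> i \<in> J \<Longrightarrow> norm (pd i g \<xi>) \<le> K i * norm \<xi> ^ D"
    unfolding eventually_nhds_metric by auto
  obtain a where a: "a > 0" "\<forall>\<^sub>F \<xi> in nhds 0. norm (A \<xi>) \<le> a * norm \<xi> ^ 1"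
    using A(1) by (rule vanishE)
  obtain b where b: "b > 0" "\<forall>\<^sub>F \<xi> in nhds 0. norm (B \<xi>) \<le> b * norm \<xi> ^ 1"
    using A(2) by (rule vanishE)
  have small: "\<forall>\<^sub>F \<xi>::real^3 in nhds 0. norm \<xi> < e / (a + b)"
    unfolding eventually_nhds_metric using e(1) a(1) b(1) by (intro exI[of _ "e / (a + b)"]) auto
  define C where "C = (\<Sum>i\<in>UNIV. (a + b) * (K i * (a + b) ^ D))"
  have "\<forall>\<^sub>F \<xi> in nhds 0. norm (g (A \<xi>) - g (B \<xi>)) \<le> C * norm \<xi> ^ Suc D"
    using a(2) b(2) small
  proof eventually_elim
    case (elim \<xi>)
    let ?n = "norm \<xi>"
    have seg: "norm x \<le> (a + b) * ?n" if x: "x \<in> closed_segment (B \<xi>) (A \<xi>)" for x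
    proof -
      obtain u where u: "0 \<le> u" "u \<le> 1" "x = (1 - u) *\<^sub>R B \<xi> + u *\<^sub>R A \<xi>"
        using x by (auto simp: closed_segment_def)
      have "norm x \<le> \<bar>1 - u\<bar> * norm (B \<xi>) + \<bar>u\<bar> * norm (A \<xi>)"
        unfolding u(3) by (metis norm_triangle_ineq norm_scaleR)
      also have "\<dots> \<le> 1 * norm (B \<xi>) + 1 * norm (A \<xi>)"
        using u by (intro add_mono mult_right_mono) auto
      also have "\<dots> \<le> (a + b) * ?n" using elim by (simp add: algebra_simps)
      finally show ?thesis .
    qed
    have lt: "(a + b) * ?n < e" using elim(3) a(1) b(1) by (simp add: field_simps)
    define h where "h t = g (B \<xi> + t *\<^sub>R (A \<xi> - B \<xi>))" for t :: real
    have pt: "B \<xi> + t *\<^sub>R (A \<xi> - B \<xi>) \<in> closed_segment (B \<xi>) (A \<xi>)" if "0 \<le> t" "t \<le> 1" for t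
      using that by (auto simp: closed_segment_def algebra_simps intro!: exI[of _ t])
    let ?x = "\<lambda>t. B \<xi> + t *\<^sub>R (A \<xi> - B \<xi>)"
    have dh: "(h has_derivative (\<lambda>s. s * (\<Sum>i\<in>UNIV. (A \<xi> - B \<xi>) $ i * pd i g (?x t)))) (at t)"
      if t: "0 \<le> t" "t \<le> 1" for t
    proof -
      have "g differentiable (at (?x t))"
        using seg[OF pt[OF t]] lt by (intro e(2)) auto
      from has_derivative_pd[OF this]
      have g: "(g has_derivative (\<lambda>v. \<Sum>i\<in>UNIV. v $ i * pd i g (?x t))) (at (?x t))" .
      have x: "(?x has_derivative (\<lambda>s. s *\<^sub>R (A \<xi> - B \<xi>))) (at t)"
        by (auto intro!: derivative_eq_intros)
      from has_derivative_compose[OF x g] show ?thesis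
        unfolding h_def by (simp add: sum_distrib_left mult.assoc)
    qed
    have bd: "\<bar>\<Sum>i\<in>UNIV. (A \<xi> - B \<xi>) $ i * pd i g (?x t)\<bar> \<le> C * ?n ^ Suc D"
      if t: "0 \<le> t" "t \<le> 1" for t
    proof -
      have "\<bar>(A \<xi> - B \<xi>) $ i * pd i g (?x t)\<bar> \<le> (a + b) * (K i * (a + b) ^ D) * ?n ^ Suc D" for i
      proof (cases "i \<in> J")
        case True
        have "\<bar>(A \<xi> - B \<xi>) $ i\<bar> \<le> norm (A \<xi> - B \<xi>)" by (rule component_le_norm_cart)
        also have "\<dots> \<le> norm (A \<xi>) + norm (B \<xi>)" by (rule norm_triangle_ineq4)
        also have "\<dots> \<le> (a + b) * ?n" using elim by (simp add: algebra_simps)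
        finally have 1: "\<bar>(A \<xi> - B \<xi>) $ i\<bar> \<le> (a + b) * ?n" .
        have "\<bar>pd i g (?x t)\<bar> \<le> K i * norm (?x t) ^ D"
          using e(3)[OF _ True, of "?x t"] seg[OF pt[OF t]] lt by auto
        also have "\<dots> \<le> K i * ((a + b) * ?n) ^ D"
          using K(1)[of i] seg[OF pt[OF t]] by (intro mult_left_mono power_mono) auto
        finally have 2: "\<bar>pd i g (?x t)\<bar> \<le> K i * ((a + b) * ?n) ^ D" .
        have "\<bar>(A \<xi> - B \<xi>) $ i * pd i g (?x t)\<bar> \<le> ((a + b) * ?n) * (K i * ((a + b) * ?n) ^ D)"
          unfolding abs_mult using 1 2 a(1) b(1) by (intro mult_mono) auto
        also have "\<dots> = (a + b) * (K i * (a + b) ^ D) * ?n ^ Suc D"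
          by (simp add: power_mult_distrib mult_ac)
        finally show ?thesis .
      next
        case False
        then have "(A \<xi> - B \<xi>) $ i = 0" using pd[of i] unfolding J_def by auto
        moreover have "0 \<le> (a + b) * (K i * (a + b) ^ D) * ?n ^ Suc D"
          using a(1) b(1) K(1)[of i] by (intro mult_nonneg_nonneg) auto
        ultimately show ?thesis by simp
      qed
      then have "(\<Sum>i\<in>UNIV. \<bar>(A \<xi> - B \<xi>) $ i * pd i g (?x t)\<bar>) \<le> C * ?n ^ Suc D"
        unfolding C_def sum_distrib_right by (intro sum_mono)
      then show ?thesis by (rule order_trans[OF sum_abs])
    qed
    have "norm (h 1 - h 0) \<le> C * ?n ^ Suc D * norm (1 - 0 :: real)"
    proof (rule differentiable_bound[of "{0..1}" h])
      fix t :: real assume t: "t \<in> {0..1}"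
      show "(h has_derivative (\<lambda>s. s * (\<Sum>i\<in>UNIV. (A \<xi> - B \<xi>) $ i * pd i g (?x t)))) (at t within {0..1})"
        using t by (intro has_derivative_at_withinI[OF dh]) auto
      show "onorm (\<lambda>s. s * (\<Sum>i\<in>UNIV. (A \<xi> - B \<xi>) $ i * pd i g (?x t))) \<le> C * ?n ^ Suc D"
        using mult_left_mono[OF bd[of t] abs_ge_zero] t
        by (intro onorm_le) (auto simp: abs_mult mult.commute)
    qed auto
    then show ?case by (simp add: h_def)
  qed
  then show ?thesis by (rule vanishI)
qed

section \<open>Taylor polynomials\<close>

lemma pd_eq_0_if_const_on_line:
  assumes "q differentiable (at \<xi>)" "\<And>u. q (\<xi> + u *\<^sub>R axis j 1) = q \<xi>"
  shows "pd j q \<xi> = 0"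
proof -
  have q: "(q has_derivative (\<lambda>v. \<Sum>i\<in>UNIV. v $ i * pd i q \<xi>)) (at (\<xi> + 0 *\<^sub>R axis j 1))"
    using has_derivative_pd[OF assms(1)] by simp
  have "((\<lambda>u. \<xi> + u *\<^sub>R axis j 1) has_derivative (\<lambda>s. s *\<^sub>R axis j 1)) (at (0::real))"
    by (auto intro!: derivative_eq_intros)
  from has_derivative_compose[OF this q]
  have "((\<lambda>u. q \<xi>) has_derivative (\<lambda>s. \<Sum>i\<in>UNIV. (s *\<^sub>R axis j 1) $ i * pd i q \<xi>)) (at (0::real))"
    by (simp add: assms(2))
  moreover have "((\<lambda>u. q \<xi>) has_derivative (\<lambda>s. 0)) (at (0::real))" by simp
  ultimately have "(\<lambda>s::real. \<Sum>i\<in>UNIV. (s *\<^sub>R axis j 1) $ i * pd i q \<xi>) = (\<lambda>s. 0)"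
    by (rule has_derivative_unique)
  from fun_cong[OF this, of 1] show ?thesis
    by (simp add: axis_def if_distribR if_distrib[of "\<lambda>x. x * _"] cong: if_cong)
qed

text \<open>
  With \<open>B\<close> a polynomial antiderivative of \<open>Q\<close>, the increments of \<open>B\<close> along the scaled segments
  from \<open>t \<xi>\<close> to \<open>t (\<xi> + u e\<^sub>j)\<close> are \<open>O(t\<^bsup>D+1\<^esup>)\<close>; being polynomial in \<open>t\<close>, they force all
  homogeneous parts of \<open>B\<close> of degree at most \<open>D\<close> to be constant along \<open>e\<^sub>j\<close>.
\<close>

lemma vanish_pd_of_pol_approx:
  assumes diff: "\<forall>\<^sub>F \<xi> in nhds 0. \<phi> differentiable (at \<xi>)"
    and v: "vanish (Suc D) \<phi>" and Q: "pol Q" and approx: "vanish D (\<lambda>\<xi>. pd j \<phi> \<xi> - Q \<xi>)"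
  shows "vanish D (pd j \<phi>)"
proof -
  obtain B where B: "pol B" "pd j B = Q" using Q by (rule pol_antiderivative)
  obtain n0 where "pol_le n0 B" using B(1) unfolding pol_def by blast
  then have "pol_le (n0 + D) B" by (rule pol_le_mono) simp
  then obtain R where R: "\<And>k. hpoly k (R k)" "\<And>\<xi>. B \<xi> = (\<Sum>k\<le>n0 + D. R k \<xi>)"
    unfolding pol_le_def by blast
  have "pd j (R k) = (\<lambda>_. 0)" if k: "k \<le> D" for k
  proof (rule ext, rule pd_eq_0_if_const_on_line)
    fix \<xi> :: "real^3" and u :: real
    show "R k differentiable at \<xi>" by (rule hpoly_differentiable[OF R(1)])
    define a where "a = \<xi> + u *\<^sub>R axis j 1"
    let ?g = "\<lambda>\<xi>. \<phi> \<xi> - B \<xi>"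
    \<comment> \<open>The first coordinate of \<eta> plays the scaling parameter t:
      \<open>?l a\<close> maps \<eta> to t a. A one-variable estimate in t thereby becomes an order
      of vanishing on real^3.\<close>
    let ?l = "\<lambda>a (\<eta>::real^3). \<eta> $ 1 *\<^sub>R (a::real^3)"
    have lin: "vanish 1 (?l b)" for b
      by (intro vanish_bounded_linear[OF bounded_linear_scaleR_left] vanish_nth vanish_id)
    have "\<forall>\<^sub>F \<xi> in nhds 0. pd j \<phi> \<xi> - Q \<xi> = pd j ?g \<xi>"
      using diff by eventually_elim (simp add: pd_diff pol_differentiable B)
    then have "vanish D (pd j ?g)" using approx by (rule vanish_cong)
    then have "(\<forall>\<eta>. ?l a \<eta> $ i = ?l \<xi> \<eta> $ i) \<or> vanish D (pd i ?g)" for i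
      by (cases "i = j") (auto simp: a_def axis_def)
    moreover have "\<forall>\<^sub>F \<xi> in nhds 0. ?g differentiable (at \<xi>)"
      using diff by eventually_elim (rule differentiable_diff[OF _ pol_differentiable[OF B(1)]])
    ultimately have 1: "vanish (Suc D) (\<lambda>\<eta>. ?g (?l a \<eta>) - ?g (?l \<xi> \<eta>))"
      using vanish_segment[OF _ lin lin] by blast
    have 2: "vanish (Suc D) (\<lambda>\<eta>. \<phi> (?l a \<eta>) - \<phi> (?l \<xi> \<eta>))"
      by (rule vanish_diff[OF vanish_comp[OF v lin] vanish_comp[OF v lin]])
    have "vanish (Suc D) (\<lambda>\<eta>. B (?l a \<eta>) - B (?l \<xi> \<eta>))"
      using vanish_diff[OF 2 1] by (simp add: algebra_simps)
    moreover have "B (?l a \<eta>) - B (?l \<xi> \<eta>) = (\<Sum>k\<le>n0 + D. (R k a - R k \<xi>) * \<eta> $ 1 ^ k)" for \<eta>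
      by (simp add: R(2) hpoly_scaleR[OF R(1)] sum_subtractf algebra_simps)
    ultimately have w: "vanish (Suc D) (\<lambda>\<eta>. \<Sum>k\<le>n0 + D. (R k a - R k \<xi>) * \<eta> $ 1 ^ k)" by simp
    have h: "hpoly k (\<lambda>\<eta>. (R k a - R k \<xi>) * \<eta> $ 1 ^ k)" for k
      using hpoly_cmult[OF hpoly_power[OF hpoly.coord]] by fastforce
    \<comment> \<open>Evaluation at the first unit vector sets t = 1 and isolates the
      coefficient.\<close>
    have "(R k a - R k \<xi>) * (axis 1 1 :: real^3) $ 1 ^ k = 0"
      by (rule hpoly_sum_vanish_imp_0[OF h w]) (use k in auto)
    then show "R k (\<xi> + u *\<^sub>R axis j 1) = R k \<xi>" by (simp add: a_def)
  qed
  then have "vanish D (pd j B)" unfolding pol_pd_sum(2)[OF R] by (rule vanish_pd_high[OF R(1)])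
  then have "vanish D Q" by (simp add: B(2))
  from vanish_add[OF approx this] show ?thesis by simp
qed

lemma Ck_pd: "(\<And>k. Ck k U \<phi>) \<Longrightarrow> Ck k U (pd i \<phi>)"
  using Ck.simps(2)[of k U \<phi>] unfolding pd_def[abs_def] by blast

lemma Ck_differentiable: "(\<And>k. Ck k U \<phi>) \<Longrightarrow> x \<in> U \<Longrightarrow> \<phi> differentiable (at x)"
  using Ck.simps(2)[of 0 U \<phi>] by blast

lemma Ck_eventually_differentiable:
  assumes "open U" "0 \<in> U" "\<And>k. Ck k U \<phi>"
  shows "\<forall>\<^sub>F \<xi> in nhds 0. \<phi> differentiable (at \<xi>)"
  using eventually_nhds_in_open[OF assms(1,2)]
  by eventually_elim (rule Ck_differentiable[OF assms(3)])

text \<open>Induction over the order, for all smooth functions at once: polynomial approximations of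
  the partial derivatives are integrated separately in each variable. The path (x,y,z), (0,y,z),
  (0,0,z), 0 moves one coordinate per leg, so each leg only involves its own antiderivative and no
  compatibility of the three is required.\<close>

lemma Taylor_pol:
  assumes U: "open U" "0 \<in> U"
  shows "(\<And>k. Ck k U \<phi>) \<Longrightarrow> \<exists>T. pol T \<and> vanish D (\<lambda>\<xi>. \<phi> \<xi> - T \<xi>)"
proof (induction D arbitrary: \<phi>)
  case 0
  have "isCont \<phi> 0"
    using Ck_differentiable[OF 0 U(2)] by (rule differentiable_imp_continuous_within)
  then have "(\<phi> \<longlongrightarrow> \<phi> 0) (nhds 0)" by (simp add: continuous_at tendsto_nhds_iff)
  then have "\<forall>\<^sub>F \<xi> in nhds 0. dist (\<phi> \<xi>) (\<phi> 0) < 1" by (rule tendstoD) simp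
  then have "\<forall>\<^sub>F \<xi> in nhds 0. norm (\<phi> \<xi>) \<le> (\<bar>\<phi> 0\<bar> + 1) * norm \<xi> ^ 0"
    by eventually_elim (simp add: dist_real_def)
  then have "vanish 0 \<phi>" by (rule vanishI)
  then show ?case using pol_const[of 0] by (intro exI[of _ "\<lambda>_. 0"]) auto
next
  case (Suc D)
  have "\<exists>T. pol T \<and> vanish D (\<lambda>\<xi>. pd i \<phi> \<xi> - T \<xi>)" for i
    by (rule Suc.IH) (rule Ck_pd[OF Suc.prems])
  then obtain T where T: "\<And>i. pol (T i)" "\<And>i. vanish D (\<lambda>\<xi>. pd i \<phi> \<xi> - T i \<xi>)" by metis
  have "\<exists>B. pol B \<and> pd i B = T i" for i using pol_antiderivative[OF T(1)] by metis
  then obtain B where B: "\<And>i. pol (B i)" "\<And>i. pd i (B i) = T i" by metis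
  define A2 :: "real^3 \<Rightarrow> real^3" where "A2 \<xi> = vector [0, \<xi>$2, \<xi>$3]" for \<xi>
  define A3 :: "real^3 \<Rightarrow> real^3" where "A3 \<xi> = vector [0, 0, \<xi>$3]" for \<xi>
  have coord: "vanish 1 (\<lambda>\<xi>::real^3. \<xi> $ i)" for i by (intro vanish_nth vanish_id)
  have "vanish 1 (\<lambda>\<xi>. A2 \<xi> $ i) \<and> pol (\<lambda>\<xi>. A2 \<xi> $ i)" for i
    using exhaust_3[of i] coord pol_const pol_coord by (auto simp: A2_def)
  then have A2: "vanish 1 A2" "pol (\<lambda>\<xi>. A2 \<xi> $ i)" for i
    by (auto intro: vanish_vec)
  have "vanish 1 (\<lambda>\<xi>. A3 \<xi> $ i) \<and> pol (\<lambda>\<xi>. A3 \<xi> $ i)" for i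
    using exhaust_3[of i] coord pol_const pol_coord by (auto simp: A3_def)
  then have A3: "vanish 1 A3" "pol (\<lambda>\<xi>. A3 \<xi> $ i)" for i
    by (auto intro: vanish_vec)
  let ?g = "\<lambda>i \<xi>. \<phi> \<xi> - B i \<xi>"
  have diff: "\<forall>\<^sub>F \<xi> in nhds 0. \<phi> differentiable (at \<xi>)"
    by (rule Ck_eventually_differentiable[OF U Suc.prems])
  have gd: "\<forall>\<^sub>F \<xi> in nhds 0. ?g i differentiable (at \<xi>)" for i
    using diff by eventually_elim (rule differentiable_diff[OF _ pol_differentiable[OF B(1)]])
  have gv: "vanish D (pd i (?g i))" for i
  proof (rule vanish_cong[OF _ T(2)])
    show "\<forall>\<^sub>F \<xi> in nhds 0. pd i \<phi> \<xi> - T i \<xi> = pd i (?g i) \<xi>"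
      using diff by eventually_elim (simp add: pd_diff pol_differentiable B)
  qed
  have 1: "vanish (Suc D) (\<lambda>\<xi>. ?g 1 \<xi> - ?g 1 (A2 \<xi>))"
  proof (rule vanish_segment[OF gd vanish_id A2(1)])
    fix i show "(\<forall>\<xi>. \<xi> $ i = A2 \<xi> $ i) \<or> vanish D (pd i (?g 1))"
      using exhaust_3[of i] gv[of 1] by (auto simp: A2_def)
  qed
  have 2: "vanish (Suc D) (\<lambda>\<xi>. ?g 2 (A2 \<xi>) - ?g 2 (A3 \<xi>))"
  proof (rule vanish_segment[OF gd A2(1) A3(1)])
    fix i show "(\<forall>\<xi>. A2 \<xi> $ i = A3 \<xi> $ i) \<or> vanish D (pd i (?g 2))"
      using exhaust_3[of i] gv[of 2] by (auto simp: A2_def A3_def)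
  qed
  have 3: "vanish (Suc D) (\<lambda>\<xi>. ?g 3 (A3 \<xi>) - ?g 3 0)"
  proof (rule vanish_segment[OF gd A3(1) vanish_zero])
    fix i show "(\<forall>\<xi>. A3 \<xi> $ i = 0 $ i) \<or> vanish D (pd i (?g 3))"
      using exhaust_3[of i] gv[of 3] by (auto simp: A3_def)
  qed
  \<comment> \<open>The increments of \<open>B 1\<close>, \<open>B 2\<close>, \<open>B 3\<close>
    along the three legs, plus the value at the origin.\<close>
  let ?T = "\<lambda>\<xi>. (B 1 \<xi> - B 1 (A2 \<xi>)) + (B 2 (A2 \<xi>) - B 2 (A3 \<xi>)) + (B 3 (A3 \<xi>) - B 3 0) + \<phi> 0"
  have "pol ?T"
    by (rule pol_add pol_diff pol_const B(1) pol_comp[OF B(1) A2(2)] pol_comp[OF B(1) A3(2)])+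
  moreover have "vanish (Suc D) (\<lambda>\<xi>. \<phi> \<xi> - ?T \<xi>)"
    using vanish_add[OF vanish_add[OF 1 2] 3] by (simp add: algebra_simps)
  ultimately show ?case by blast
qed

text \<open>The remainder bound cannot be differentiated directly. But the partial derivative is
  smooth as well and has its own Taylor polynomial \<open>S\<close>, so the derivative of the
  remainder is close to the polynomial \<open>S - pd j T\<close>, which is what
  \<open>vanish_pd_of_pol_approx\<close> asks for.\<close>

lemma Taylor_pol_pd:
  assumes U: "open U" "0 \<in> U" and sm: "\<And>k. Ck k U \<phi>"
    and T: "pol T" "vanish (Suc D) (\<lambda>\<xi>. \<phi> \<xi> - T \<xi>)"
  shows "vanish D (\<lambda>\<xi>. pd j \<phi> \<xi> - pd j T \<xi>)"
proof -
  have diff: "\<forall>\<^sub>F \<xi> in nhds 0. \<phi> differentiable (at \<xi>)"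
    by (rule Ck_eventually_differentiable[OF U sm])
  have eq: "\<forall>\<^sub>F \<xi> in nhds 0. pd j \<phi> \<xi> - pd j T \<xi> = pd j (\<lambda>\<xi>. \<phi> \<xi> - T \<xi>) \<xi>"
    using diff by eventually_elim (simp add: pd_diff pol_differentiable T)
  obtain S where S: "pol S" "vanish D (\<lambda>\<xi>. pd j \<phi> \<xi> - S \<xi>)"
    using Taylor_pol[OF U Ck_pd[OF sm]] by blast
  have "vanish D (pd j (\<lambda>\<xi>. \<phi> \<xi> - T \<xi>))"
  proof (rule vanish_pd_of_pol_approx[OF _ T(2)])
    show "\<forall>\<^sub>F \<xi> in nhds 0. (\<lambda>\<xi>. \<phi> \<xi> - T \<xi>) differentiable (at \<xi>)"
      using diff by eventually_elim (rule differentiable_diff[OF _ pol_differentiable[OF T(1)]])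
    show "pol (\<lambda>\<xi>. S \<xi> - pd j T \<xi>)" by (intro pol_diff S pol_pd T)
    show "vanish D (\<lambda>\<xi>. pd j (\<lambda>\<xi>. \<phi> \<xi> - T \<xi>) \<xi> - (S \<xi> - pd j T \<xi>))"
    proof (rule vanish_cong[OF _ S(2)])
      show "\<forall>\<^sub>F \<xi> in nhds 0. pd j \<phi> \<xi> - S \<xi> = pd j (\<lambda>\<xi>. \<phi> \<xi> - T \<xi>) \<xi> - (S \<xi> - pd j T \<xi>)"
        using eq by eventually_elim simp
    qed
  qed
  from vanish_cong[OF eventually_mono[OF eq sym] this] show ?thesis .
qed

section \<open>The homological equation\<close>

lemma Jmat_mult: "Jmat *v \<xi> = vector [\<xi>$1 + \<xi>$2, \<xi>$2 + \<xi>$3, \<xi>$3]"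
  by (simp add: Jmat_def Nmat_def vec_eq_iff forall_3 matrix_vector_mult_def sum_3 mat_def)

text \<open>Scalar factors are absorbed into v, so these sums form a linear space although the rule
  has no coefficient.\<close>

inductive shear_sum :: "nat \<Rightarrow> (real^3 \<Rightarrow> real^3) \<Rightarrow> bool" where
  zero: "shear_sum d (\<lambda>_. 0)"
| step: "shear_sum d h \<Longrightarrow> l \<bullet> v = 0 \<Longrightarrow> shear_sum d (\<lambda>\<xi>. h \<xi> + (l \<bullet> \<xi>) ^ d *\<^sub>R v)"

lemma shear_sum_single: "l \<bullet> v = 0 \<Longrightarrow> shear_sum d (\<lambda>\<xi>. (l \<bullet> \<xi>) ^ d *\<^sub>R v)"
  using shear_sum.step[OF shear_sum.zero, of l v d] by simp

lemma shear_sum_add: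
  assumes "shear_sum d h" "shear_sum d k"
  shows "shear_sum d (\<lambda>\<xi>. h \<xi> + k \<xi>)"
  using assms(2,1)
proof (induction rule: shear_sum.induct)
  case (zero d)
  then show ?case by simp
next
  case (step d k l v)
  from shear_sum.step[OF step.IH[OF step.prems] step.hyps(2)] show ?case by (simp add: add.assoc)
qed

lemma shear_sum_scale: "shear_sum d h \<Longrightarrow> shear_sum d (\<lambda>\<xi>. a *\<^sub>R h \<xi>)"
proof (induction rule: shear_sum.induct)
  case (zero d)
  then show ?case using shear_sum.zero by simp
next
  case (step d h l v)
  have "l \<bullet> (a *\<^sub>R v) = 0" using step.hyps by simp
  from shear_sum.step[OF step.IH this] show ?case by (simp add: algebra_simps)
qed

section \<open>The linear space of solvable right-hand sides\<close>

definition hom2 :: "nat \<Rightarrow> (real \<Rightarrow> real \<Rightarrow> real) \<Rightarrow> bool" where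
  "hom2 d q \<longleftrightarrow> (\<exists>c. \<forall>x y. q x y = (\<Sum>i\<le>d. c i * x ^ i * y ^ (d - i)))"

lemma hom2_zero: "hom2 d (\<lambda>_ _. 0)"
  unfolding hom2_def by (rule exI[of _ "\<lambda>_. 0"]) simp

lemma hom2_add:
  assumes "hom2 d p" "hom2 d q"
  shows "hom2 d (\<lambda>x y. p x y + q x y)"
proof -
  obtain b c where "\<And>x y. p x y = (\<Sum>i\<le>d. b i * x ^ i * y ^ (d - i))"
    "\<And>x y. q x y = (\<Sum>i\<le>d. c i * x ^ i * y ^ (d - i))"
    using assms unfolding hom2_def by blast
  then show ?thesis unfolding hom2_def
    by (intro exI[of _ "\<lambda>i. b i + c i"]) (simp add: sum.distrib distrib_right)
qed

lemma hom2_scale: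
  assumes "hom2 d p"
  shows "hom2 d (\<lambda>x y. a * p x y)"
proof -
  obtain b where "\<And>x y. p x y = (\<Sum>i\<le>d. b i * x ^ i * y ^ (d - i))"
    using assms unfolding hom2_def by blast
  then show ?thesis unfolding hom2_def
    by (intro exI[of _ "\<lambda>i. a * b i"]) (simp add: sum_distrib_left mult.assoc)
qed

lemma hom2_power_linear: "hom2 d (\<lambda>x y. (a * x + b * y) ^ d)"
  unfolding hom2_def
  by (rule exI[of _ "\<lambda>i. of_nat (d choose i) * a ^ i * b ^ (d - i)"])
    (simp add: binomial_ring power_mult_distrib mult_ac)

definition homological :: "nat \<Rightarrow> (real^3 \<Rightarrow> real^3) \<Rightarrow> bool" where
  "homological d R \<longleftrightarrow> (\<exists>h q. shear_sum d h \<and> hom2 d q \<and>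
     (\<forall>\<xi>. Jmat *v R \<xi> = Jmat *v (q (\<xi>$1) (\<xi>$2) *\<^sub>R e3) + Jmat *v h \<xi> - h (Jmat *v \<xi>)))"

definition div_free :: "(real^3 \<Rightarrow> real^3) \<Rightarrow> bool" where
  "div_free R \<longleftrightarrow> (\<forall>\<xi>. (\<Sum>i\<in>UNIV. pd i (\<lambda>\<xi>. R \<xi> $ i) \<xi>) = 0)"

text \<open>Homogeneity and zero divergence are bundled with solvability so that subtracting solved
  fields from a divergence-free homogeneous one keeps both properties for the remainder.\<close>

definition solvable_field :: "nat \<Rightarrow> (real^3 \<Rightarrow> real^3) \<Rightarrow> bool" where
  "solvable_field d R \<longleftrightarrow> homological d R \<and> (\<forall>i. hpoly d (\<lambda>\<xi>. R \<xi> $ i)) \<and> div_free R"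

lemma solvable_field_add:
  assumes "solvable_field d R" "solvable_field d S"
  shows "solvable_field d (\<lambda>\<xi>. R \<xi> + S \<xi>)"
proof -
  obtain h q where 1: "shear_sum d h" "hom2 d q"
    "\<And>\<xi>. Jmat *v R \<xi> = Jmat *v (q (\<xi>$1) (\<xi>$2) *\<^sub>R e3) + Jmat *v h \<xi> - h (Jmat *v \<xi>)"
    using assms(1) unfolding solvable_field_def homological_def by blast
  obtain k p where 2: "shear_sum d k" "hom2 d p"
    "\<And>\<xi>. Jmat *v S \<xi> = Jmat *v (p (\<xi>$1) (\<xi>$2) *\<^sub>R e3) + Jmat *v k \<xi> - k (Jmat *v \<xi>)"
    using assms(2) unfolding solvable_field_def homological_def by blast
  have "homological d (\<lambda>\<xi>. R \<xi> + S \<xi>)"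
    unfolding homological_def
  proof (intro exI conjI allI)
    show "shear_sum d (\<lambda>\<xi>. h \<xi> + k \<xi>)" by (rule shear_sum_add[OF 1(1) 2(1)])
    show "hom2 d (\<lambda>x y. q x y + p x y)" by (rule hom2_add[OF 1(2) 2(2)])
  qed (simp add: matrix_vector_right_distrib 1(3) 2(3) scaleR_left_distrib)
  moreover have h: "hpoly d (\<lambda>\<xi>. R \<xi> $ i)" "hpoly d (\<lambda>\<xi>. S \<xi> $ i)" for i
    using assms unfolding solvable_field_def by blast+
  then have "hpoly d (\<lambda>\<xi>. (R \<xi> + S \<xi>) $ i)" for i by (simp add: hpoly.add)
  moreover have "div_free (\<lambda>\<xi>. R \<xi> + S \<xi>)"
    using assms hpoly_differentiable[OF h(1)] hpoly_differentiable[OF h(2)]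
    unfolding solvable_field_def div_free_def by (simp add: pd_add sum.distrib)
  ultimately show ?thesis unfolding solvable_field_def by blast
qed

lemma solvable_field_scale:
  assumes "solvable_field d R"
  shows "solvable_field d (\<lambda>\<xi>. a *\<^sub>R R \<xi>)"
proof -
  obtain h q where 1: "shear_sum d h" "hom2 d q"
    "\<And>\<xi>. Jmat *v R \<xi> = Jmat *v (q (\<xi>$1) (\<xi>$2) *\<^sub>R e3) + Jmat *v h \<xi> - h (Jmat *v \<xi>)"
    using assms(1) unfolding solvable_field_def homological_def by blast
  have "homological d (\<lambda>\<xi>. a *\<^sub>R R \<xi>)"
    unfolding homological_def
  proof (intro exI conjI allI)
    show "shear_sum d (\<lambda>\<xi>. a *\<^sub>R h \<xi>)" by (rule shear_sum_scale[OF 1(1)])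
    show "hom2 d (\<lambda>x y. a * q x y)" by (rule hom2_scale[OF 1(2)])
  qed (simp add: matrix_vector_mult_scaleR 1(3) scaleR_right_distrib scaleR_right_diff_distrib
      flip: scaleR_scaleR)
  moreover have h: "hpoly d (\<lambda>\<xi>. R \<xi> $ i)" for i
    using assms unfolding solvable_field_def by blast
  then have "hpoly d (\<lambda>\<xi>. (a *\<^sub>R R \<xi>) $ i)" for i by (simp add: hpoly_cmult)
  moreover have "div_free (\<lambda>\<xi>. a *\<^sub>R R \<xi>)"
    using assms hpoly_differentiable[OF h(1)]
    unfolding solvable_field_def div_free_def by (simp add: pd_mult pd_const flip: sum_distrib_left)
  ultimately show ?thesis unfolding solvable_field_def by blast
qed

lemma solvable_field_zero: "solvable_field d (\<lambda>_. 0)"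
  unfolding solvable_field_def homological_def div_free_def
proof (intro conjI allI)
  show "\<exists>h q. shear_sum d h \<and> hom2 d q \<and> (\<forall>\<xi>. Jmat *v 0 =
      Jmat *v (q (\<xi> $ 1) (\<xi> $ 2) *\<^sub>R e3) + Jmat *v h \<xi> - h (Jmat *v \<xi>))"
    by (rule exI[of _ "\<lambda>_. 0"], rule exI[of _ "\<lambda>_ _. 0"]) (simp add: shear_sum.zero hom2_zero)
qed (simp_all add: hpoly_zero pd_const)

lemma solvable_field_sum:
  "(\<And>k. k \<in> I \<Longrightarrow> solvable_field d (R k)) \<Longrightarrow> solvable_field d (\<lambda>\<xi>. \<Sum>k\<in>I. R k \<xi>)"
  by (induction I rule: infinite_finite_induct) (simp_all add: solvable_field_zero solvable_field_add)

lemma solvable_field_diff: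
  "solvable_field d R \<Longrightarrow> solvable_field d S \<Longrightarrow> solvable_field d (\<lambda>\<xi>. R \<xi> - S \<xi>)"
  using solvable_field_add[OF _ solvable_field_scale, of d R S "-1"] by simp

text \<open>
  Replacing a curve \<open>P\<close> of degree \<open>m\<close> by \<open>P(2t) - 2\<^bsup>m\<^esup> P(t)\<close> kills its leading coefficient, so
  membership of the points in a subspace passes to the coefficients.
\<close>

lemma solvable_field_coeff:
  assumes A: "\<And>t. t \<in> A \<Longrightarrow> 2 * t \<in> A" "t0 \<in> A" "t0 \<noteq> (0::real)"
  shows "(\<And>t. t \<in> A \<Longrightarrow> solvable_field d (\<lambda>\<xi>. \<Sum>k\<le>(m::nat). t ^ k *\<^sub>R c k \<xi>))
    \<Longrightarrow> k \<le> m \<Longrightarrow> solvable_field d (c k)"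
proof (induction m arbitrary: c k)
  case 0
  then show ?case using A(2) by fastforce
next
  case (Suc m)
  have low: "solvable_field d (c k)" if k: "k \<le> m" for k
  proof -
    let ?c = "\<lambda>k \<xi>. (2 ^ k - 2 ^ Suc m :: real) *\<^sub>R c k \<xi>"
    have "solvable_field d (?c k)"
    proof (rule Suc.IH[OF _ k])
      fix t assume t: "t \<in> A"
      have "solvable_field d (\<lambda>\<xi>. (\<Sum>k\<le>Suc m. (2 * t) ^ k *\<^sub>R c k \<xi>)
          - (2 ^ Suc m) *\<^sub>R (\<Sum>k\<le>Suc m. t ^ k *\<^sub>R c k \<xi>))"
        by (intro solvable_field_diff solvable_field_scale Suc.prems(1) A(1) t)
      moreover have "(\<Sum>k\<le>Suc m. (2 * t) ^ k *\<^sub>R c k \<xi>)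
          - (2 ^ Suc m) *\<^sub>R (\<Sum>k\<le>Suc m. t ^ k *\<^sub>R c k \<xi>)
          = (\<Sum>k\<le>m. t ^ k *\<^sub>R ?c k \<xi>)" for \<xi>
        by (simp add: scaleR_sum_right sum_subtractf power_mult_distrib scaleR_diff_left
            scaleR_diff_right scaleR_right_distrib mult_ac)
      ultimately show "solvable_field d (\<lambda>\<xi>. \<Sum>k\<le>m. t ^ k *\<^sub>R ?c k \<xi>)" by simp
    qed
    from solvable_field_scale[OF this, of "inverse (2 ^ k - 2 ^ Suc m)"]
    show ?thesis using k power_strict_increasing[of k "Suc m" "2::real"] by simp
  qed
  show ?case
  proof (cases "k = Suc m")
    case True
    have "solvable_field d (\<lambda>\<xi>. inverse (t0 ^ Suc m) *\<^sub>R
        ((\<Sum>k\<le>Suc m. t0 ^ k *\<^sub>R c k \<xi>) - (\<Sum>k\<le>m. t0 ^ k *\<^sub>R c k \<xi>)))"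
      by (intro solvable_field_scale solvable_field_diff solvable_field_sum Suc.prems(1) A low) simp
    moreover have "inverse (t0 ^ Suc m) *\<^sub>R
        ((\<Sum>k\<le>Suc m. t0 ^ k *\<^sub>R c k \<xi>) - (\<Sum>k\<le>m. t0 ^ k *\<^sub>R c k \<xi>)) = c k \<xi>" for \<xi>
      using A(3) True by (simp del: power_Suc)
    ultimately show ?thesis by simp
  next
    case False
    then show ?thesis using low Suc.prems(2) by simp
  qed
qed

lemma poly_eq_sum_of_degree_le:
  "degree p \<le> m \<Longrightarrow> poly p t = (\<Sum>k\<le>m. t ^ k * coeff p k)" for p :: "real poly"
  unfolding poly_altdef
  by (subst mult.commute, rule sum.mono_neutral_left) (auto simp: coeff_eq_0)

text \<open>The form in which curves of fields are used: the entries are polynomials in t with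
  coefficients depending on \<xi>, known to be solvable for t in a set closed under doubling. The
  first part extracts a coefficient, the second extends solvability to every real t. Positive
  integers, negative reals and all reals serve as \<open>A\<close>.\<close>

lemma solvable_field_poly:
  fixes p1 p2 p3 :: "real^3 \<Rightarrow> real poly"
  assumes A: "\<And>t. t \<in> A \<Longrightarrow> 2 * t \<in> A" "t0 \<in> A" "t0 \<noteq> 0"
    and deg: "\<And>\<xi>. degree (p1 \<xi>) \<le> m" "\<And>\<xi>. degree (p2 \<xi>) \<le> m" "\<And>\<xi>. degree (p3 \<xi>) \<le> m"
    and sf: "\<And>t. t \<in> A \<Longrightarrow> solvable_field d (\<lambda>\<xi>. vector [poly (p1 \<xi>) t, poly (p2 \<xi>) t, poly (p3 \<xi>) t])"
  shows "solvable_field d (\<lambda>\<xi>. vector [coeff (p1 \<xi>) k, coeff (p2 \<xi>) k, coeff (p3 \<xi>) k])" (is ?th1)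
    and "solvable_field d (\<lambda>\<xi>. vector [poly (p1 \<xi>) t, poly (p2 \<xi>) t, poly (p3 \<xi>) t])" (is ?th2)
proof -
  let ?c = "\<lambda>k \<xi>. vector [coeff (p1 \<xi>) k, coeff (p2 \<xi>) k, coeff (p3 \<xi>) k] :: real^3"
  have eq: "vector [poly (p1 \<xi>) t, poly (p2 \<xi>) t, poly (p3 \<xi>) t] = (\<Sum>k\<le>m. t ^ k *\<^sub>R ?c k \<xi>)" for \<xi> t
    using deg by (simp add: vec_eq_iff forall_3 poly_eq_sum_of_degree_le)
  have c: "solvable_field d (?c k)" if "k \<le> m" for k
    by (rule solvable_field_coeff[OF A _ that]) (use sf in \<open>simp_all add: eq\<close>)
  show ?th1
  proof (cases "k \<le> m")
    case False
    then have "?c k = (\<lambda>_. 0)"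
      using deg[THEN le_less_trans, of k] by (intro ext) (simp add: vec_eq_iff forall_3 coeff_eq_0)
    then show ?thesis using solvable_field_zero by simp
  qed (rule c)
  show ?th2 unfolding eq by (intro solvable_field_sum solvable_field_scale c) simp
qed

text \<open>The divergence equals d (l . \<xi>)^(d-1) (l . v).\<close>

lemma shear_hpoly_div_free:
  assumes "l \<bullet> v = 0"
  shows "hpoly d (\<lambda>\<xi>. ((l \<bullet> \<xi>) ^ d *\<^sub>R v) $ i)" "div_free (\<lambda>\<xi>. (l \<bullet> \<xi>) ^ d *\<^sub>R v)"
proof -
  show "hpoly d (\<lambda>\<xi>. ((l \<bullet> \<xi>) ^ d *\<^sub>R v) $ i)"
    using hpoly_cmult[OF hpoly_power[OF hpoly_linear, of d l], of "v $ i"] by (simp add: mult.commute)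
  have "((\<lambda>\<xi>. (l \<bullet> \<xi>) ^ d * v $ i) has_derivative
      (\<lambda>w. real d * (l \<bullet> w) * (l \<bullet> \<xi>) ^ (d - 1) * v $ i)) (at \<xi>)" for i \<xi>
    by (auto intro!: derivative_eq_intros)
  from pd_eqI[OF this]
  have "pd i (\<lambda>\<xi>. (l \<bullet> \<xi>) ^ d * v $ i) \<xi> = (real d * (l \<bullet> \<xi>) ^ (d - 1)) * (l $ i * v $ i)" for i \<xi>
    by (simp add: inner_axis)
  then show "div_free (\<lambda>\<xi>. (l \<bullet> \<xi>) ^ d *\<^sub>R v)"
    using assms unfolding div_free_def
    by (simp add: inner_vec_def flip: sum_distrib_left)
qed

text \<open>
  The covector \<open>l = (2, 1 - s - t, s t)\<close> is chosen so that \<open>l J\<^bsup>\<tau>\<^esup> e\<^sub>3 = (\<tau> - s) (\<tau> - t)\<close>, while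
  \<open>(s (s - 1) / 2, s, 1) = J\<^bsup>s\<^esup> e\<^sub>3\<close>. Thus \<open>J\<close> translates both parameters by one, the member with
  \<open>s = 0\<close> points along \<open>e\<^sub>3\<close> and depends on \<open>x, y\<close> only, and exchanging \<open>s\<close> and \<open>t\<close> yields a second
  vector orthogonal to the same covector.
\<close>

definition pencil :: "nat \<Rightarrow> real \<Rightarrow> real \<Rightarrow> real^3 \<Rightarrow> real^3" where
  "pencil d s t \<xi> = (2 * \<xi>$1 + (1 - s - t) * \<xi>$2 + s * t * \<xi>$3) ^ d *\<^sub>R vector [s * (s - 1) / 2, s, 1]"

lemma pencil_shear:
  "pencil d s t = (\<lambda>\<xi>. (vector [2, 1 - s - t, s * t] \<bullet> \<xi>) ^ d *\<^sub>R vector [s * (s - 1) / 2, s, 1])"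
  by (rule ext) (simp add: pencil_def inner_vec_def sum_3)

lemma pencil_orth: "vector [2, 1 - s - t, s * t] \<bullet> (vector [s * (s - 1) / 2, s, 1] :: real^3) = 0"
  by (simp add: inner_vec_def sum_3 field_simps)

lemma solvable_field_pencil_0: "solvable_field d (pencil d 0 t)"
proof -
  have "homological d (pencil d 0 t)"
    unfolding homological_def
  proof (intro exI conjI allI)
    show "shear_sum d (\<lambda>_. 0)" by (rule shear_sum.zero)
    show "hom2 d (\<lambda>x y. (2 * x + (1 - t) * y) ^ d)" by (rule hom2_power_linear)
  qed (simp add: pencil_def e3_def)
  then show ?thesis
    unfolding solvable_field_def pencil_shear using shear_hpoly_div_free[OF pencil_orth] by blast
qed

text \<open>The translated member itself serves as h: from h (J \<xi>) = J
  (\<open>pencil d s t \<xi>\<close>) the expression J h - h o J is J applied to the difference, and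
  no term along e3 is left over.\<close>

lemma solvable_field_pencil_step:
  "solvable_field d (\<lambda>\<xi>. pencil d (s + 1) (t + 1) \<xi> - pencil d s t \<xi>)"
proof -
  have "homological d (\<lambda>\<xi>. pencil d (s + 1) (t + 1) \<xi> - pencil d s t \<xi>)"
    unfolding homological_def
  proof (intro exI conjI allI)
    show "shear_sum d (pencil d (s + 1) (t + 1))"
      unfolding pencil_shear by (rule shear_sum_single[OF pencil_orth])
    show "hom2 d (\<lambda>x y. 0)" by (rule hom2_zero)
    fix \<xi> :: "real^3"
    have "2 * (\<xi>$1 + \<xi>$2) + (1 - (s + 1) - (t + 1)) * (\<xi>$2 + \<xi>$3) + (s + 1) * (t + 1) * \<xi>$3
        = 2 * \<xi>$1 + (1 - s - t) * \<xi>$2 + s * t * \<xi>$3" by (simp add: algebra_simps)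
    then have "pencil d (s + 1) (t + 1) (Jmat *v \<xi>) = Jmat *v pencil d s t \<xi>"
      by (simp add: pencil_def Jmat_mult vec_eq_iff forall_3 field_simps)
    then show "Jmat *v (pencil d (s + 1) (t + 1) \<xi> - pencil d s t \<xi>)
      = Jmat *v (0 *\<^sub>R e3) + Jmat *v pencil d (s + 1) (t + 1) \<xi> - pencil d (s + 1) (t + 1) (Jmat *v \<xi>)"
      by (simp add: matrix_vector_mult_diff_distrib)
  qed
  moreover have h: "hpoly d (\<lambda>\<xi>. pencil d s t \<xi> $ i)" "div_free (pencil d s t)" for s t i
    unfolding pencil_shear using shear_hpoly_div_free[OF pencil_orth] by blast+
  then have "hpoly d (\<lambda>\<xi>. (pencil d (s + 1) (t + 1) \<xi> - pencil d s t \<xi>) $ i)" for i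
    by (simp add: hpoly_diff)
  moreover have "div_free (\<lambda>\<xi>. pencil d (s + 1) (t + 1) \<xi> - pencil d s t \<xi>)"
    using h(2)[of s t] h(2)[of "s + 1" "t + 1"] hpoly_differentiable[OF h(1)] unfolding div_free_def
    by (simp add: pd_diff sum_subtractf)
  ultimately show ?thesis unfolding solvable_field_def by blast
qed

text \<open>With u = t - s fixed, the steps lead from s = 0 to every natural s. The entries are
  polynomial in s, so the integers decide all real s.\<close>

lemma solvable_field_pencil: "solvable_field d (pencil d s t)"
proof -
  define u where "u = t - s"
  have nat: "solvable_field d (pencil d (real n) (real n + u))" for n
  proof (induction n)
    case 0
    then show ?case using solvable_field_pencil_0[of d u] by simp
  next
    case (Suc n)
    from solvable_field_add[OF Suc solvable_field_pencil_step[of d "real n" "real n + u"]]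
    show ?case by (simp add: add_ac)
  qed
  \<comment> \<open>2x + (1 - 2s - u) y + s (s + u) z collected in powers of s; \<open>?p1\<close>
    and \<open>?p2\<close> carry the further factors s (s - 1) / 2 and s.\<close>
  let ?L = "\<lambda>\<xi>::real^3. [:2 * \<xi>$1 + (1 - u) * \<xi>$2, u * \<xi>$3 - 2 * \<xi>$2, \<xi>$3:] ^ d"
  let ?p1 = "\<lambda>\<xi>. [:0, -1/2, 1/2:] * ?L \<xi>" and ?p2 = "\<lambda>\<xi>. [:0, 1:] * ?L \<xi>"
  have eq: "vector [poly (?p1 \<xi>) s, poly (?p2 \<xi>) s, poly (?L \<xi>) s] = pencil d s (s + u) \<xi>" for \<xi> s
  proof -
    have "poly (?L \<xi>) s = (2 * \<xi>$1 + (1 - s - (s + u)) * \<xi>$2 + s * (s + u) * \<xi>$3) ^ d"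
      by (simp add: algebra_simps)
    then show ?thesis
      by (simp only: poly_mult) (simp add: pencil_def vec_eq_iff forall_3 field_simps)
  qed
  have degL: "degree (?L \<xi>) \<le> 2 * d" for \<xi>
    by (rule order_trans[OF degree_power_le]) (simp add: degree_pCons_eq_if)
  have "solvable_field d (\<lambda>\<xi>. vector [poly (?p1 \<xi>) s, poly (?p2 \<xi>) s, poly (?L \<xi>) s])"
  proof (rule solvable_field_poly(2))
    let ?A = "real ` {1..}"
    show "2 * t \<in> ?A" if "t \<in> ?A" for t
      using that by (auto intro!: image_eqI[of _ _ "2 * _"])
    show "1 \<in> ?A" by (auto intro!: image_eqI[of _ _ 1])
    show "degree (?p1 \<xi>) \<le> 2 * d + 2" for \<xi>
      by (rule order_trans[OF degree_mult_le]) (use degL[of \<xi>] in simp)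
    show "degree (?p2 \<xi>) \<le> 2 * d + 2" for \<xi>
      by (rule order_trans[OF degree_mult_le]) (use degL[of \<xi>] in simp)
    show "degree (?L \<xi>) \<le> 2 * d + 2" for \<xi> using degL[of \<xi>] by simp
    show "solvable_field d (\<lambda>\<xi>. vector [poly (?p1 \<xi>) t, poly (?p2 \<xi>) t, poly (?L \<xi>) t])" if "t \<in> ?A" for t
      using that nat unfolding eq by auto
  qed simp
  then show ?thesis unfolding eq by (simp add: u_def)
qed

text \<open>
  The condition \<open>\<pi> < 0\<close> makes the quadratic with root sum \<open>1 - \<rho>\<close> and root product \<open>\<pi>\<close> have two
  distinct real roots.
\<close>

lemma solvable_field_pencil_diff:
  assumes "\<pi> < 0"
  shows "solvable_field d (\<lambda>\<xi>. (2 * \<xi>$1 + \<rho> * \<xi>$2 + \<pi> * \<xi>$3) ^ d *\<^sub>R vector [- \<rho> / 2, 1, 0])" (is "solvable_field d ?u")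
    and "solvable_field d (\<lambda>\<xi>. (2 * \<xi>$1 + \<rho> * \<xi>$2 + \<pi> * \<xi>$3) ^ d *\<^sub>R vector [- \<pi> / 2, 0, 1])" (is "solvable_field d ?v")
proof -
  define r where "r = sqrt ((1 - \<rho>)\<^sup>2 - 4 * \<pi>)"
  have pos: "(1 - \<rho>)\<^sup>2 - 4 * \<pi> > 0" using assms zero_le_power2[of "1 - \<rho>"] by linarith
  then have r: "r > 0" "r\<^sup>2 = (1 - \<rho>)\<^sup>2 - 4 * \<pi>" by (simp_all add: r_def)
  define s t where "s = (1 - \<rho> + r) / 2" and "t = (1 - \<rho> - r) / 2"
  have st: "s - t = r" "s + t = 1 - \<rho>" "s * t = \<pi>"
    using r(2) by (auto simp: s_def t_def power2_eq_square field_simps)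
  have \<rho>: "\<rho> = 1 - s - t" and ne: "s - t \<noteq> 0" using st r by auto
  \<comment> \<open>Both pencil vectors are orthogonal to the same covector (2, \<rho>, \<pi>).
    Since \<rho> = 1 - s - t, their difference is (s - t) (-\<rho>/2, 1, 0); removing s times this
    vector from the first one leaves (-\<pi>/2, 0, 1). The square root r has disappeared from
    both.\<close>
  have u: "?u \<xi> = inverse (s - t) *\<^sub>R (pencil d s t \<xi> - pencil d t s \<xi>)" for \<xi>
  proof -
    have "pencil d s t \<xi> - pencil d t s \<xi> =
        (2 * \<xi>$1 + \<rho> * \<xi>$2 + \<pi> * \<xi>$3) ^ d *\<^sub>R (vector [s * (s - 1) / 2, s, 1] - vector [t * (t - 1) / 2, t, 1])"
      by (simp add: pencil_def \<rho> st(3)[symmetric] scaleR_diff_right algebra_simps)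
    also have "vector [s * (s - 1) / 2, s, 1] - vector [t * (t - 1) / 2, t, 1] =
        (s - t) *\<^sub>R (vector [- \<rho> / 2, 1, 0] :: real^3)"
      by (simp add: vec_eq_iff forall_3 \<rho> field_simps)
    finally show ?thesis using ne by simp
  qed
  show *: "solvable_field d ?u" unfolding u
    by (intro solvable_field_scale solvable_field_diff solvable_field_pencil)
  have v: "?v \<xi> = pencil d s t \<xi> - s *\<^sub>R ?u \<xi>" for \<xi>
  proof -
    have "pencil d s t \<xi> - s *\<^sub>R ?u \<xi> =
        (2 * \<xi>$1 + \<rho> * \<xi>$2 + \<pi> * \<xi>$3) ^ d *\<^sub>R (vector [s * (s - 1) / 2, s, 1] - s *\<^sub>R vector [- \<rho> / 2, 1, 0])"
      by (simp add: pencil_def \<rho> st(3)[symmetric] scaleR_diff_right mult.commute)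
    also have "vector [s * (s - 1) / 2, s, 1] - s *\<^sub>R vector [- \<rho> / 2, 1, 0] = (vector [- \<pi> / 2, 0, 1] :: real^3)"
      by (simp add: vec_eq_iff forall_3 \<rho> st(3)[symmetric] field_simps)
    finally show ?thesis by simp
  qed
  show "solvable_field d ?v" unfolding v
    by (intro solvable_field_diff solvable_field_scale solvable_field_pencil *)
qed

section \<open>Monomial components from the coefficients of the shear family\<close>

lemma coeff_linear_power_all:
  "coeff ([:a, b:] ^ n) i = of_nat (n choose i) * b ^ i * a ^ (n - i)" for a b :: real
proof (cases "i \<le> n")
  case False
  have "degree ([:a, b:] ^ n) \<le> n"
    by (rule order_trans[OF degree_power_le]) (simp add: degree_pCons_eq_if)
  with False show ?thesis by (simp add: coeff_eq_0 binomial_eq_0)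
qed (rule coeff_linear_poly_power)

text \<open>
  The coefficient of \<open>\<pi>\<^bsup>c\<^esup>\<close> in \<open>(2 x + \<rho> y + \<pi> z)\<^bsup>d\<^esup>\<close>, as a polynomial in \<open>\<rho>\<close>.
\<close>

definition lift_poly :: "nat \<Rightarrow> nat \<Rightarrow> real^3 \<Rightarrow> real poly" where
  "lift_poly d c \<xi> = smult (of_nat (d choose c) * \<xi>$3 ^ c) ([:2 * \<xi>$1, \<xi>$2:] ^ (d - c))"

text \<open>The coefficient of rho^b pi^c in (2 x + rho y + pi z)^d: a multinomial multiple of
  x^(d-b-c) y^b z^c. When b + c > d a binomial factor vanishes, so the truncated exponents do no
  harm.\<close>

lemma coeff_lift_poly:
  "coeff (lift_poly d c \<xi>) b =
    of_nat (d choose c) * \<xi>$3 ^ c * (of_nat (d - c choose b) * \<xi>$2 ^ b * (2 * \<xi>$1) ^ (d - c - b))"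
  by (simp add: lift_poly_def coeff_linear_power_all)

text \<open>Coefficients of pi^c, extracted over pi < 0 with rho fixed, followed by those of rho^b
  over all real rho. The factor -rho/2 in the first field shifts the rho-index, hence
  \<open>pCons 0\<close>; the factor -pi/2 in the second shifts the pi-index, hence the predecessor
  of \<open>c\<close>.\<close>

lemma solvable_field_lift:
  shows "solvable_field d (\<lambda>\<xi>. vector [coeff (pCons 0 (smult (-1/2) (lift_poly d c \<xi>))) b, coeff (lift_poly d c \<xi>) b, 0])"
    and "solvable_field d (\<lambda>\<xi>. vector
      [coeff (case c of 0 \<Rightarrow> 0 | Suc c \<Rightarrow> smult (-1/2) (lift_poly d c \<xi>)) b, 0, coeff (lift_poly d c \<xi>) b])"
proof -
  let ?L = "\<lambda>\<rho> (\<xi>::real^3). [:2 * \<xi>$1 + \<rho> * \<xi>$2, \<xi>$3:] ^ d"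
  have degL: "degree (?L \<rho> \<xi>) \<le> d" for \<rho> \<xi>
    by (rule order_trans[OF degree_power_le]) (simp add: degree_pCons_eq_if)
  have L: "coeff (?L \<rho> \<xi>) c = poly (lift_poly d c \<xi>) \<rho>" for \<rho> \<xi> c
    by (simp add: coeff_linear_power_all lift_poly_def mult.commute)
  have degE: "degree (lift_poly d c \<xi>) \<le> d" for c \<xi>
    unfolding lift_poly_def
    by (intro order_trans[OF degree_smult_le] order_trans[OF degree_power_le]) (simp add: degree_pCons_eq_if)
  have neg: "2 * t \<in> {..<0}" if "t \<in> {..<0}" for t :: real using that by simp
  have m1: "-1 \<in> {..<0::real}" "-1 \<noteq> (0::real)" by simp_all
  have "solvable_field d (\<lambda>\<xi>. vector [coeff (smult (-\<rho>/2) (?L \<rho> \<xi>)) c, coeff (?L \<rho> \<xi>) c, coeff 0 c])" for \<rho>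
  proof (rule solvable_field_poly(1)[OF neg m1])
    fix t :: real assume "t \<in> {..<0}"
    then have "t < 0" by simp
    from solvable_field_pencil_diff(1)[OF this, of d \<rho>]
    have "solvable_field d (\<lambda>\<xi>. vector [(2 * \<xi>$1 + \<rho> * \<xi>$2 + t * \<xi>$3) ^ d * (-\<rho>/2),
        (2 * \<xi>$1 + \<rho> * \<xi>$2 + t * \<xi>$3) ^ d, 0])"
      by (rule back_subst[of "solvable_field d"]) (simp add: fun_eq_iff vec_eq_iff forall_3)
    then show "solvable_field d (\<lambda>\<xi>. vector [poly (smult (-\<rho>/2) (?L \<rho> \<xi>)) t, poly (?L \<rho> \<xi>) t, poly 0 t])"
      by (simp add: mult.commute)
  qed (use degL in \<open>auto intro: order_trans[OF degree_smult_le]\<close>)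
  then have 1: "solvable_field d (\<lambda>\<xi>. vector
      [poly (pCons 0 (smult (-1/2) (lift_poly d c \<xi>))) \<rho>, poly (lift_poly d c \<xi>) \<rho>, poly 0 \<rho>])" for \<rho>
    by (simp add: L)
  have deg1: "degree (pCons 0 (smult (-1/2) (lift_poly d c \<xi>))) \<le> Suc d" for c \<xi>
    using degE by (intro order_trans[OF degree_pCons_le]) simp
  have pos: "2 * t \<in> UNIV" if "t \<in> UNIV" for t :: real by simp
  have "solvable_field d (\<lambda>\<xi>. vector [coeff (pCons 0 (smult (-1/2) (lift_poly d c \<xi>))) b, coeff (lift_poly d c \<xi>) b, coeff 0 b])"
    by (rule solvable_field_poly(1)[OF pos UNIV_I one_neq_zero deg1 le_SucI[OF degE] _ 1]) simp_all
  then show "solvable_field d (\<lambda>\<xi>. vector [coeff (pCons 0 (smult (-1/2) (lift_poly d c \<xi>))) b, coeff (lift_poly d c \<xi>) b, 0])"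
    by simp
  have "solvable_field d (\<lambda>\<xi>. vector [coeff (pCons 0 (smult (-1/2) (?L \<rho> \<xi>))) c, coeff 0 c, coeff (?L \<rho> \<xi>) c])" for \<rho>
  proof (rule solvable_field_poly(1)[OF neg m1])
    fix t :: real assume "t \<in> {..<0}"
    then have "t < 0" by simp
    from solvable_field_pencil_diff(2)[OF this, of d \<rho>]
    have "solvable_field d (\<lambda>\<xi>. vector [(2 * \<xi>$1 + \<rho> * \<xi>$2 + t * \<xi>$3) ^ d * (-t/2), 0,
        (2 * \<xi>$1 + \<rho> * \<xi>$2 + t * \<xi>$3) ^ d])"
      by (rule back_subst[of "solvable_field d"]) (simp add: fun_eq_iff vec_eq_iff forall_3)
    then show "solvable_field d (\<lambda>\<xi>. vector [poly (pCons 0 (smult (-1/2) (?L \<rho> \<xi>))) t, poly 0 t, poly (?L \<rho> \<xi>) t])"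
      by (simp add: mult.commute)
  next
    show "degree (pCons 0 (smult (-1/2) (?L \<rho> \<xi>))) \<le> Suc d" for \<xi>
      using degL by (intro order_trans[OF degree_pCons_le]) simp
    show "degree (?L \<rho> \<xi>) \<le> Suc d" for \<xi> using degL le_SucI by blast
  qed simp_all
  moreover have "coeff (pCons 0 (smult (-1/2) (?L \<rho> \<xi>))) c =
      poly (case c of 0 \<Rightarrow> 0 | Suc c \<Rightarrow> smult (-1/2) (lift_poly d c \<xi>)) \<rho>" for \<rho> \<xi>
    by (simp add: coeff_pCons L split: nat.split)
  ultimately have 2: "solvable_field d (\<lambda>\<xi>. vector
      [poly (case c of 0 \<Rightarrow> 0 | Suc c \<Rightarrow> smult (-1/2) (lift_poly d c \<xi>)) \<rho>, poly 0 \<rho>, poly (lift_poly d c \<xi>) \<rho>])" for \<rho>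
    by (simp add: L)
  have deg2: "degree (case c of 0 \<Rightarrow> 0 | Suc c \<Rightarrow> smult (-1/2) (lift_poly d c \<xi>)) \<le> d" for \<xi>
    using degE by (simp split: nat.split)
  have "solvable_field d (\<lambda>\<xi>. vector
      [coeff (case c of 0 \<Rightarrow> 0 | Suc c \<Rightarrow> smult (-1/2) (lift_poly d c \<xi>)) b, coeff 0 b, coeff (lift_poly d c \<xi>) b])"
    by (rule solvable_field_poly(1)[OF pos UNIV_I one_neq_zero deg2 _ degE 2]) simp_all
  then show "solvable_field d (\<lambda>\<xi>. vector
      [coeff (case c of 0 \<Rightarrow> 0 | Suc c \<Rightarrow> smult (-1/2) (lift_poly d c \<xi>)) b, 0, coeff (lift_poly d c \<xi>) b])"
    by simp
qed

lemma solvable_field_mono2: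
  assumes "i + j + k = d"
  shows "\<exists>R. solvable_field d R \<and> (\<forall>\<xi>. R \<xi> $ 2 = a * (\<xi>$1 ^ i * \<xi>$2 ^ j * \<xi>$3 ^ k) \<and> R \<xi> $ 3 = 0)"
proof -
  \<comment> \<open>The multinomial coefficient of x^i y^j z^k, with 2^i from the leading entry 2 of
    the covector. The first component of the field is left uncontrolled and is repaired only at the
    end.\<close>
  define K :: real where "K = of_nat (d choose k) * of_nat (i + j choose j) * 2 ^ i"
  have "K \<noteq> 0" using assms by (simp add: K_def)
  moreover have "coeff (lift_poly d k \<xi>) j = K * (\<xi>$1 ^ i * \<xi>$2 ^ j * \<xi>$3 ^ k)" for \<xi>
  proof -
    have "d - k = i + j" using assms by simp
    then show ?thesis by (simp add: coeff_lift_poly K_def power_mult_distrib mult_ac)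
  qed
  ultimately have K: "(a / K) * coeff (lift_poly d k \<xi>) j = a * (\<xi>$1 ^ i * \<xi>$2 ^ j * \<xi>$3 ^ k)" for \<xi>
    by simp
  show ?thesis
  proof (intro exI conjI allI)
    show "solvable_field d (\<lambda>\<xi>. (a / K) *\<^sub>R vector
        [coeff (pCons 0 (smult (-1/2) (lift_poly d k \<xi>))) j, coeff (lift_poly d k \<xi>) j, 0])"
      by (intro solvable_field_scale solvable_field_lift)
  qed (simp_all only: vector_scaleR_component vector_3 real_scaleR_def K mult_zero_right)
qed

lemma solvable_field_mono3:
  assumes "i + j + k = d"
  shows "\<exists>R. solvable_field d R \<and> (\<forall>\<xi>. R \<xi> $ 2 = 0 \<and> R \<xi> $ 3 = a * (\<xi>$1 ^ i * \<xi>$2 ^ j * \<xi>$3 ^ k))"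
proof -
  define K :: real where "K = of_nat (d choose k) * of_nat (i + j choose j) * 2 ^ i"
  have "K \<noteq> 0" using assms by (simp add: K_def)
  moreover have "coeff (lift_poly d k \<xi>) j = K * (\<xi>$1 ^ i * \<xi>$2 ^ j * \<xi>$3 ^ k)" for \<xi>
  proof -
    have "d - k = i + j" using assms by simp
    then show ?thesis by (simp add: coeff_lift_poly K_def power_mult_distrib mult_ac)
  qed
  ultimately have K: "(a / K) * coeff (lift_poly d k \<xi>) j = a * (\<xi>$1 ^ i * \<xi>$2 ^ j * \<xi>$3 ^ k)" for \<xi>
    by simp
  show ?thesis
  proof (intro exI conjI allI)
    show "solvable_field d (\<lambda>\<xi>. (a / K) *\<^sub>R vector
        [coeff (case k of 0 \<Rightarrow> 0 | Suc c \<Rightarrow> smult (-1/2) (lift_poly d c \<xi>)) j, 0, coeff (lift_poly d k \<xi>) j])"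
      by (intro solvable_field_scale solvable_field_lift)
  qed (simp_all only: vector_scaleR_component vector_3 real_scaleR_def K mult_zero_right)
qed

text \<open>The pi-index is pushed one past the top degree: for c = k + 1 and b = j one has b + c =
  d + 1, so the third entry vanishes, while the shifted first entry still has total index d and
  survives.\<close>

lemma solvable_field_mono1:
  assumes "j + k = d"
  shows "solvable_field d (\<lambda>\<xi>. vector [a * (\<xi>$2 ^ j * \<xi>$3 ^ k), 0, 0])"
proof -
  define K :: real where "K = - of_nat (d choose k) / 2"
  have "K \<noteq> 0" using assms by (simp add: K_def)
  have "coeff (lift_poly d (Suc k) \<xi>) j = 0" for \<xi>
    using assms by (cases "j = 0") (auto simp: coeff_lift_poly binomial_eq_0)
  moreover have "coeff (smult (-1/2) (lift_poly d k \<xi>)) j = K * (\<xi>$2 ^ j * \<xi>$3 ^ k)" for \<xi>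
  proof -
    have "d - k = j" using assms by simp
    then show ?thesis by (simp add: coeff_lift_poly K_def mult_ac)
  qed
  ultimately have "solvable_field d (\<lambda>\<xi>. vector [K * (\<xi>$2 ^ j * \<xi>$3 ^ k), 0, 0])"
    using solvable_field_lift(2)[of d "Suc k" j] by simp
  from solvable_field_scale[OF this, of "a / K"] show ?thesis
    by (rule back_subst[of "solvable_field d"]) (use \<open>K \<noteq> 0\<close> in \<open>simp add: fun_eq_iff vec_eq_iff forall_3\<close>)
qed

lemma solvable_field_component2:
  "monspan d q \<Longrightarrow> \<exists>R. solvable_field d R \<and> (\<forall>\<xi>. R \<xi> $ 2 = q \<xi> \<and> R \<xi> $ 3 = 0)"
proof (induction rule: monspan.induct)
  case (mono i j k d a)
  then show ?case by (rule solvable_field_mono2)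
next
  case (add d p q)
  then obtain R S where "solvable_field d R" "\<forall>\<xi>. R \<xi> $ 2 = p \<xi> \<and> R \<xi> $ 3 = 0"
    "solvable_field d S" "\<forall>\<xi>. S \<xi> $ 2 = q \<xi> \<and> S \<xi> $ 3 = 0" by blast
  then show ?case by (intro exI[of _ "\<lambda>\<xi>. R \<xi> + S \<xi>"]) (simp add: solvable_field_add)
qed

lemma solvable_field_component3:
  "monspan d q \<Longrightarrow> \<exists>R. solvable_field d R \<and> (\<forall>\<xi>. R \<xi> $ 2 = 0 \<and> R \<xi> $ 3 = q \<xi>)"
proof (induction rule: monspan.induct)
  case (mono i j k d a)
  then show ?case by (rule solvable_field_mono3)
next
  case (add d p q)
  then obtain R S where "solvable_field d R" "\<forall>\<xi>. R \<xi> $ 2 = 0 \<and> R \<xi> $ 3 = p \<xi>"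
    "solvable_field d S" "\<forall>\<xi>. S \<xi> $ 2 = 0 \<and> S \<xi> $ 3 = q \<xi>" by blast
  then show ?case by (intro exI[of _ "\<lambda>\<xi>. R \<xi> + S \<xi>"]) (simp add: solvable_field_add)
qed

lemma solvable_field_component1:
  "monspan d q \<Longrightarrow> solvable_field d (\<lambda>\<xi>. vector [q (vector [0, \<xi>$2, \<xi>$3]), 0, 0])"
proof (induction rule: monspan.induct)
  case (mono i j k d a)
  show ?case
  proof (cases i)
    case 0
    then show ?thesis using solvable_field_mono1[of j k d a] mono by simp
  next
    case (Suc i')
    have "(vector [0, 0, 0] :: real^3) = 0" by (simp add: vec_eq_iff forall_3)
    then show ?thesis using Suc solvable_field_zero by simp
  qed
next
  case (add d p q)
  from solvable_field_add[OF add.IH] show ?case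
    by (rule back_subst[of "solvable_field d"]) (simp add: fun_eq_iff vec_eq_iff forall_3)
qed

lemma eq_at_0_if_pd_1_eq_0:
  assumes "\<And>\<xi>. q differentiable (at \<xi>)" "\<And>\<xi>. pd 1 q \<xi> = 0"
  shows "q \<xi> = q (vector [0, \<xi>$2, \<xi>$3])"
proof -
  let ?x = "\<lambda>u. vector [0, \<xi>$2, \<xi>$3] + u *\<^sub>R axis 1 1 :: real^3"
  have "((\<lambda>u. q (?x u)) has_real_derivative 0) (at u)" for u
  proof -
    have "(?x has_derivative (\<lambda>s. s *\<^sub>R axis 1 1)) (at u)"
      by (auto intro!: derivative_eq_intros)
    from has_derivative_compose[OF this has_derivative_pd[OF assms(1)]]
    have "((\<lambda>u. q (?x u)) has_derivative (\<lambda>s. 0 * s)) (at u)"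
      by (simp add: sum_3 assms(2) axis_def)
    then show ?thesis by (simp only: has_field_derivative_def)
  qed
  then have "q (?x (\<xi>$1)) = q (?x 0)" by (intro DERIV_isconst_all) blast
  moreover have "?x (\<xi>$1) = \<xi>" by (simp add: vec_eq_iff forall_3 axis_def)
  ultimately show ?thesis by simp
qed

text \<open>Solvable fields match the second and third components. What remains points along the
  first axis and has zero divergence, hence its entry does not depend on x and is a combination of
  monomials in y and z.\<close>

lemma homological_equation_solvable:
  assumes h: "\<And>i. hpoly d (\<lambda>\<xi>. R \<xi> $ i)" and div: "div_free R"
  shows "homological d R"
proof -
  obtain R2 where R2: "solvable_field d R2" "\<And>\<xi>. R2 \<xi> $ 2 = R \<xi> $ 2" "\<And>\<xi>. R2 \<xi> $ 3 = 0"
    using solvable_field_component2[OF hpoly_imp_monspan[OF h]] by metis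
  obtain R3 where R3: "solvable_field d R3" "\<And>\<xi>. R3 \<xi> $ 2 = 0" "\<And>\<xi>. R3 \<xi> $ 3 = R \<xi> $ 3"
    using solvable_field_component3[OF hpoly_imp_monspan[OF h]] by metis
  define S where "S \<xi> = R \<xi> - (R2 \<xi> + R3 \<xi>)" for \<xi>
  have sf: "solvable_field d (\<lambda>\<xi>. R2 \<xi> + R3 \<xi>)" by (rule solvable_field_add[OF R2(1) R3(1)])
  then have h': "hpoly d (\<lambda>\<xi>. (R2 \<xi> + R3 \<xi>) $ i)" and div': "div_free (\<lambda>\<xi>. R2 \<xi> + R3 \<xi>)" for i
    unfolding solvable_field_def by blast+
  have hS: "hpoly d (\<lambda>\<xi>. S \<xi> $ i)" for i
    using hpoly_diff[OF h h'] unfolding S_def by simp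
  have "div_free S"
    using div div' hpoly_differentiable[OF h] hpoly_differentiable[OF h'] unfolding div_free_def
    by (simp add: S_def pd_diff sum_subtractf del: vector_add_component)
  moreover have S23: "S \<xi> $ 2 = 0" "S \<xi> $ 3 = 0" for \<xi> by (simp_all add: S_def R2 R3)
  ultimately have "pd 1 (\<lambda>\<xi>. S \<xi> $ 1) \<xi> = 0" for \<xi>
    by (simp add: div_free_def sum_3 pd_const)
  from eq_at_0_if_pd_1_eq_0[OF hpoly_differentiable[OF hS] this]
  have S1: "S \<xi> $ 1 = S (vector [0, \<xi>$2, \<xi>$3]) $ 1" for \<xi> .
  have "S = (\<lambda>\<xi>. vector [S (vector [0, \<xi>$2, \<xi>$3]) $ 1, 0, 0])"
    using S1 S23 by (simp add: fun_eq_iff vec_eq_iff forall_3)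
  then have "solvable_field d S"
    using solvable_field_component1[OF hpoly_imp_monspan[OF hS[of 1]]] by metis
  from solvable_field_add[OF this sf] have "solvable_field d R" by (simp add: S_def)
  then show ?thesis unfolding solvable_field_def by blast
qed

section \<open>Compositions of polynomial shears\<close>

text \<open>The finite Neumann series I - N + N^2, since N^3 = 0.\<close>

definition Jinv :: "real^3^3" where
  "Jinv = vector [vector [1,-1,1], vector [0,1,-1], vector [0,0,1]]"

lemma Jinv_mult: "Jinv *v \<xi> = vector [\<xi>$1 - \<xi>$2 + \<xi>$3, \<xi>$2 - \<xi>$3, \<xi>$3]"
  by (simp add: Jinv_def vec_eq_iff forall_3 matrix_vector_mult_def sum_3)

lemma Jinv_Jmat: "Jinv *v (Jmat *v \<xi>) = \<xi>" and Jmat_Jinv: "Jmat *v (Jinv *v \<xi>) = \<xi>"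
  by (simp_all add: Jinv_mult Jmat_mult vec_eq_iff forall_3)

lemma det_Jmat: "det Jmat = 1"
  by (simp add: det_3 Jmat_def Nmat_def mat_def)

lemma e3_nth: "e3 $ 1 = 0" "e3 $ 2 = 0" "e3 $ 3 = 1"
  by (simp_all add: e3_def)

text \<open>The inverse is carried along as second argument. A new shear acts after \<psi>; since l
  . v = 0 it preserves l . y, so its inverse just subtracts the same term. The bound
  \<open>2 \<le> d\<close> keeps all maps tangent to the identity.\<close>

inductive shear_aut :: "(real^3 \<Rightarrow> real^3) \<Rightarrow> (real^3 \<Rightarrow> real^3) \<Rightarrow> bool" where
  id: "shear_aut (\<lambda>\<xi>. \<xi>) (\<lambda>\<xi>. \<xi>)"
| shear: "shear_aut \<psi> \<theta> \<Longrightarrow> l \<bullet> v = 0 \<Longrightarrow> 2 \<le> d \<Longrightarrow>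
    shear_aut (\<lambda>\<xi>. \<psi> \<xi> + (l \<bullet> \<psi> \<xi>) ^ d *\<^sub>R v) (\<lambda>\<eta>. \<theta> (\<eta> - (l \<bullet> \<eta>) ^ d *\<^sub>R v))"

lemma shear_aut_comp:
  assumes "shear_aut \<psi>' \<theta>'" "shear_aut \<psi> \<theta>"
  shows "shear_aut (\<lambda>\<xi>. \<psi>' (\<psi> \<xi>)) (\<lambda>\<eta>. \<theta> (\<theta>' \<eta>))"
  using assms(1)
proof (induction rule: shear_aut.induct)
  case id
  then show ?case using assms(2) by simp
next
  case (shear \<psi>' \<theta>' l v d)
  from shear_aut.shear[OF shear.IH shear.hyps(2,3)] show ?case .
qed

text \<open>The inverse of a shear is the shear with -v. Thus every property proved for the first
  map holds for its inverse too, and the right inverse law follows from the left one.\<close>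

lemma shear_aut_swap: "shear_aut \<psi> \<theta> \<Longrightarrow> shear_aut \<theta> \<psi>"
proof (induction rule: shear_aut.induct)
  case id
  show ?case by (rule shear_aut.id)
next
  case (shear \<psi> \<theta> l v d)
  have "l \<bullet> (- v) = 0" using shear.hyps by simp
  from shear_aut_comp[OF shear.IH shear_aut.shear[OF shear_aut.id this shear.hyps(3)]]
  show ?case by simp
qed

lemma shear_aut_left_inverse: "shear_aut \<psi> \<theta> \<Longrightarrow> \<theta> (\<psi> \<xi>) = \<xi>"
  by (induction rule: shear_aut.induct) (simp_all add: inner_add_right)

lemma shear_aut_right_inverse: "shear_aut \<psi> \<theta> \<Longrightarrow> \<psi> (\<theta> \<eta>) = \<eta>"
  using shear_aut_left_inverse[OF shear_aut_swap] .

lemma shear_aut_pol: "shear_aut \<psi> \<theta> \<Longrightarrow> pol (\<lambda>\<xi>. \<psi> \<xi> $ i)"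
proof (induction arbitrary: i rule: shear_aut.induct)
  case id
  show ?case by (rule pol_coord)
next
  case (shear \<psi> \<theta> l v d)
  have "pol (\<lambda>\<xi>. (l \<bullet> \<psi> \<xi>) ^ d * v $ i)"
    unfolding inner_vec_def inner_real_def
    by (intro pol_mult pol_power pol_sum pol_const shear.IH)
  from pol_add[OF shear.IH this] show ?case by simp
qed

lemma shear_aut_near_id: "shear_aut \<psi> \<theta> \<Longrightarrow> vanish 2 (\<lambda>\<xi>. \<psi> \<xi> - \<xi>)"
proof (induction rule: shear_aut.induct)
  case id
  show ?case by simp
next
  case (shear \<psi> \<theta> l v d)
  have \<psi>: "vanish 1 \<psi>"
    using vanish_add[OF vanish_mono[OF shear.IH, of 1] vanish_id] by simp
  have "vanish d (\<lambda>\<xi>. (l \<bullet> \<psi> \<xi>) ^ d *\<^sub>R v)"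
    using vanish_comp[OF hpoly_vanish[OF hpoly_power[OF hpoly_linear, of d l]] \<psi>]
    by (intro vanish_bounded_linear[OF bounded_linear_scaleR_left]) simp
  from vanish_add[OF shear.IH vanish_mono[OF this shear.hyps(3)]]
  show ?case by (simp add: algebra_simps)
qed

lemma shear_aut_vanish_1: "shear_aut \<psi> \<theta> \<Longrightarrow> vanish 1 \<psi>"
  using vanish_add[OF vanish_mono[OF shear_aut_near_id, of \<psi> \<theta> 1] vanish_id] by simp

text \<open>The matrix determinant lemma: det (I + c v l^T) = 1 + c (l . v).\<close>

lemma det_rank_one_update:
  fixes l v :: "real^3"
  assumes "l \<bullet> v = 0"
  shows "det (\<chi> i j. (if i = j then 1 else 0) + c * v $ i * l $ j) = 1"
proof -
  have "det (\<chi> i j. (if i = j then 1 else 0) + c * v $ i * l $ j) = 1 + c * (l \<bullet> v)"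
    by (simp add: det_3 inner_vec_def sum_3 algebra_simps)
  then show ?thesis using assms by simp
qed

lemma shear_aut_derivative:
  "shear_aut \<psi> \<theta> \<Longrightarrow> \<exists>M. (\<psi> has_derivative (*v) M) (at \<xi>) \<and> det M = 1"
proof (induction arbitrary: \<xi> rule: shear_aut.induct)
  case id
  have "(*v) (mat 1 :: real^3^3) = (\<lambda>\<xi>. \<xi>)" by (rule ext) simp
  then have "((\<lambda>\<xi>. \<xi>) has_derivative (*v) (mat 1 :: real^3^3)) (at \<xi>)" by simp
  then show ?case using det_I by blast
next
  case (shear \<psi> \<theta> l v d)
  obtain M where M: "(\<psi> has_derivative (*v) M) (at \<xi>)" "det M = 1" using shear.IH by blast
  define c where "c = real d * (l \<bullet> \<psi> \<xi>) ^ (d - 1)"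
  define S :: "real^3^3" where "S = (\<chi> i j. (if i = j then 1 else 0) + c * v $ i * l $ j)"
  have S: "S *v w = w + (c * (l \<bullet> w)) *\<^sub>R v" for w
    by (simp add: S_def vec_eq_iff forall_3 matrix_vector_mult_def sum_3 inner_vec_def algebra_simps)
  have "((\<lambda>y. y + (l \<bullet> y) ^ d *\<^sub>R v) has_derivative (\<lambda>w. w + (c * (l \<bullet> w)) *\<^sub>R v)) (at (\<psi> \<xi>))"
    unfolding c_def by (auto intro!: derivative_eq_intros)
  moreover have "(*v) S = (\<lambda>w. w + (c * (l \<bullet> w)) *\<^sub>R v)" by (rule ext, rule S)
  ultimately have "((\<lambda>y. y + (l \<bullet> y) ^ d *\<^sub>R v) has_derivative (*v) S) (at (\<psi> \<xi>))" by simp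
  from has_derivative_compose[OF M(1) this]
  have "((\<lambda>\<xi>. \<psi> \<xi> + (l \<bullet> \<psi> \<xi>) ^ d *\<^sub>R v) has_derivative (*v) (S ** M)) (at \<xi>)"
    by (simp add: matrix_vector_mul_assoc)
  moreover have "det (S ** M) = 1"
    using det_rank_one_update[OF shear.hyps(2), of c] M(2) by (simp add: det_mul S_def)
  ultimately show ?case by blast
qed

lemma shear_sum_hpoly: "shear_sum d h \<Longrightarrow> hpoly d (\<lambda>\<xi>. h \<xi> $ i)"
proof (induction rule: shear_sum.induct)
  case (zero d)
  show ?case using hpoly_zero by simp
next
  case (step d h l v)
  from hpoly.add[OF step.IH shear_hpoly_div_free(1)[OF step.hyps(2)]] show ?case by simp
qed

lemma hpoly_vec_Lipschitz:
  fixes H :: "real^3 \<Rightarrow> real^3"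
  assumes "\<And>i. hpoly d (\<lambda>\<xi>. H \<xi> $ i)" "vanish 1 A" "vanish 1 B" "vanish (Suc k) (\<lambda>\<xi>. A \<xi> - B \<xi>)"
  shows "vanish (k + d) (\<lambda>\<xi>. H (A \<xi>) - H (B \<xi>))"
proof (rule vanish_vec)
  fix i show "vanish (k + d) (\<lambda>\<xi>. (H (A \<xi>) - H (B \<xi>)) $ i)"
    using hpoly_Lipschitz[OF assms(1)[of i] assms(2-4)] by simp
qed

lemma hpoly_vec_vanish:
  fixes H :: "real^3 \<Rightarrow> real^3"
  assumes "\<And>i. hpoly d (\<lambda>\<xi>. H \<xi> $ i)"
  shows "vanish d H"
  by (rule vanish_vec) (rule hpoly_vanish[OF assms])

text \<open>Composition replaces l . \<xi> by l . \<psi> \<xi>. As \<psi> differs from the identity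
  by order 2, the d-th power changes only by order d + 1, so composing agrees with adding to the
  order required.\<close>

lemma shear_sum_realize:
  assumes "shear_sum d h" "2 \<le> d"
  shows "\<exists>\<psi> \<theta>. shear_aut \<psi> \<theta> \<and> vanish (Suc d) (\<lambda>\<xi>. \<psi> \<xi> - (\<xi> + h \<xi>))"
  using assms
proof (induction rule: shear_sum.induct)
  case (zero d)
  show ?case using shear_aut.id by (intro exI conjI) auto
next
  case (step d h l v)
  then obtain \<psi> \<theta> where *: "shear_aut \<psi> \<theta>" "vanish (Suc d) (\<lambda>\<xi>. \<psi> \<xi> - (\<xi> + h \<xi>))" by blast
  have "vanish (1 + d) (\<lambda>\<xi>. (l \<bullet> \<psi> \<xi>) ^ d *\<^sub>R v - (l \<bullet> \<xi>) ^ d *\<^sub>R v)"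
    by (rule hpoly_vec_Lipschitz[OF shear_hpoly_div_free(1)[OF step.hyps(2)]
          shear_aut_vanish_1[OF *(1)] vanish_id])
      (use shear_aut_near_id[OF *(1)] in \<open>simp add: numeral_2_eq_2\<close>)
  from vanish_add[OF *(2) this[simplified]]
  have "vanish (Suc d) (\<lambda>\<xi>. (\<psi> \<xi> + (l \<bullet> \<psi> \<xi>) ^ d *\<^sub>R v) - (\<xi> + (h \<xi> + (l \<bullet> \<xi>) ^ d *\<^sub>R v)))"
    by (simp add: algebra_simps)
  with shear_aut.shear[OF *(1) step.hyps(2) step.prems] show ?case by blast
qed

text \<open>Evaluating \<psi> = id + h + O(d+1) at \<theta> \<eta> gives \<eta> = \<theta> \<eta> +
  h (\<theta> \<eta>) + O(d+1), and h (\<theta> \<eta>) may be replaced by h \<eta> because \<theta>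
  is tangent to the identity.\<close>

lemma shear_aut_inverse_approx:
  assumes \<psi>: "shear_aut \<psi> \<theta>" "vanish (Suc d) (\<lambda>\<xi>. \<psi> \<xi> - (\<xi> + h \<xi>))" and h: "\<And>i. hpoly d (\<lambda>\<xi>. h \<xi> $ i)"
  shows "vanish (Suc d) (\<lambda>\<eta>. \<theta> \<eta> - (\<eta> - h \<eta>))"
proof -
  have \<theta>: "vanish 1 \<theta>" "vanish (Suc 1) (\<lambda>\<eta>. \<theta> \<eta> - \<eta>)"
    using shear_aut_vanish_1[OF shear_aut_swap[OF \<psi>(1)]] shear_aut_near_id[OF shear_aut_swap[OF \<psi>(1)]]
    by (simp_all add: numeral_2_eq_2)
  have "vanish (Suc d) (\<lambda>\<eta>. \<psi> (\<theta> \<eta>) - (\<theta> \<eta> + h (\<theta> \<eta>)))"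
    by (rule vanish_comp[OF \<psi>(2) \<theta>(1)])
  then have 1: "vanish (Suc d) (\<lambda>\<eta>. \<eta> - (\<theta> \<eta> + h (\<theta> \<eta>)))"
    by (simp add: shear_aut_right_inverse[OF \<psi>(1)])
  have 2: "vanish (Suc d) (\<lambda>\<eta>. h (\<theta> \<eta>) - h \<eta>)"
    using hpoly_vec_Lipschitz[OF h \<theta>(1) vanish_id \<theta>(2)] by simp
  from vanish_minus[OF vanish_add[OF 1 2]] show ?thesis by (simp add: algebra_simps)
qed

section \<open>Normal-form polynomials and the linearized determinant\<close>

lemma poly2_ord2_pol:
  fixes A B :: "real^3 \<Rightarrow> real^3"
  assumes "poly2_ord2 p"
  shows "pol (\<lambda>\<xi>. p (\<xi>$1) (\<xi>$2))" "vanish 2 (\<lambda>\<xi>. p (\<xi>$1) (\<xi>$2))"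
    and "vanish 1 A \<Longrightarrow> vanish 1 B \<Longrightarrow> vanish (Suc k) (\<lambda>\<xi>. A \<xi> - B \<xi>) \<Longrightarrow>
      vanish (k + 2) (\<lambda>\<xi>. p (A \<xi> $ 1) (A \<xi> $ 2) - p (B \<xi> $ 1) (B \<xi> $ 2))"
proof -
  obtain n c where c: "\<And>i j. i + j < 2 \<Longrightarrow> c i j = 0"
    "\<And>x y. p x y = (\<Sum>i\<le>(n::nat). \<Sum>j\<le>n. c i j * x ^ i * y ^ j)"
    using assms unfolding poly2_ord2_def by blast
  have h: "hpoly (i + j) (\<lambda>\<xi>. c i j * \<xi>$1 ^ i * \<xi>$2 ^ j)" for i j
    using hpoly_monomial[of i j 0 "c i j"] by (simp add: mult.assoc)
  show "pol (\<lambda>\<xi>. p (\<xi>$1) (\<xi>$2))"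
    unfolding c(2) by (intro pol_sum hpoly_pol[OF h])
  have "vanish 2 (\<lambda>\<xi>::real^3. c i j * \<xi>$1 ^ i * \<xi>$2 ^ j)" for i j
  proof (cases "i + j < 2")
    case False
    then show ?thesis by (intro vanish_mono[OF hpoly_vanish[OF h]]) simp
  qed (simp add: c(1))
  then show "vanish 2 (\<lambda>\<xi>. p (\<xi>$1) (\<xi>$2))"
    unfolding c(2) by (intro vanish_sum)
  \<comment> \<open>All monomials that occur have degree at least 2, which gains at least one order
    over the difference A - B. Conjugation by a map that is the identity up to order d therefore
    leaves p unchanged modulo order d + 1.\<close>
  assume AB: "vanish 1 A" "vanish 1 B" "vanish (Suc k) (\<lambda>\<xi>. A \<xi> - B \<xi>)"
  have "vanish (k + 2) (\<lambda>\<xi>. c i j * A \<xi>$1 ^ i * A \<xi>$2 ^ j - c i j * B \<xi>$1 ^ i * B \<xi>$2 ^ j)" for i j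
  proof (cases "i + j < 2")
    case False
    then show ?thesis by (intro vanish_mono[OF hpoly_Lipschitz[OF h AB]]) simp
  qed (simp add: c(1))
  then show "vanish (k + 2) (\<lambda>\<xi>. p (A \<xi> $ 1) (A \<xi> $ 2) - p (B \<xi> $ 1) (B \<xi> $ 2))"
    unfolding c(2) sum_subtractf[symmetric] by (intro vanish_sum)
qed

lemma poly2_ord2_zero: "poly2_ord2 (\<lambda>_ _. 0)"
  unfolding poly2_ord2_def by (intro exI[of _ 0] exI[of _ "\<lambda>_ _. 0"]) simp

lemma poly2_ord2_add:
  assumes "poly2_ord2 p" "poly2_ord2 q"
  shows "poly2_ord2 (\<lambda>x y. p x y + q x y)"
proof -
  obtain m b where b: "\<And>i j. i + j < 2 \<Longrightarrow> b i j = 0"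
    "\<And>x y. p x y = (\<Sum>i\<le>(m::nat). \<Sum>j\<le>m. b i j * x ^ i * y ^ j)"
    using assms(1) unfolding poly2_ord2_def by blast
  obtain n c where c: "\<And>i j. i + j < 2 \<Longrightarrow> c i j = 0"
    "\<And>x y. q x y = (\<Sum>i\<le>(n::nat). \<Sum>j\<le>n. c i j * x ^ i * y ^ j)"
    using assms(2) unfolding poly2_ord2_def by blast
  have pad: "(\<Sum>i\<le>m. \<Sum>j\<le>m. a i j * x ^ i * y ^ j) =
      (\<Sum>i\<le>N. \<Sum>j\<le>N. (if i \<le> m \<and> j \<le> m then a i j else 0) * x ^ i * y ^ j)"
    if "m \<le> N" for m N :: nat and a and x y :: real
  proof -
    have "(\<Sum>i\<le>m. \<Sum>j\<le>m. a i j * x ^ i * y ^ j) =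
        (\<Sum>i\<le>m. \<Sum>j\<le>N. (if i \<le> m \<and> j \<le> m then a i j else 0) * x ^ i * y ^ j)"
      using that by (intro sum.cong sum.mono_neutral_cong_left) auto
    also have "\<dots> = (\<Sum>i\<le>N. \<Sum>j\<le>N. (if i \<le> m \<and> j \<le> m then a i j else 0) * x ^ i * y ^ j)"
      using that by (intro sum.mono_neutral_cong_left) auto
    finally show ?thesis .
  qed
  show ?thesis unfolding poly2_ord2_def
  proof (intro exI conjI allI impI)
    show "p x y + q x y = (\<Sum>i\<le>max m n. \<Sum>j\<le>max m n.
        ((if i \<le> m \<and> j \<le> m then b i j else 0) + (if i \<le> n \<and> j \<le> n then c i j else 0)) * x ^ i * y ^ j)"
      for x y
      unfolding b(2) c(2) pad[OF max.cobounded1[of m n]] pad[OF max.cobounded2[of n m]]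
      by (simp only: distrib_right sum.distrib)
  qed (simp add: b(1) c(1))
qed

lemma hom2_poly2_ord2:
  assumes "hom2 d q" "2 \<le> d"
  shows "poly2_ord2 q"
proof -
  obtain b where b: "\<And>x y. q x y = (\<Sum>i\<le>d. b i * x ^ i * y ^ (d - i))"
    using assms(1) unfolding hom2_def by blast
  show ?thesis unfolding poly2_ord2_def
  proof (intro exI conjI allI impI)
    fix x y
    have "(\<Sum>j\<le>d. (if i + j = d then b i else 0) * x ^ i * y ^ j) = b i * x ^ i * y ^ (d - i)"
      if "i \<le> d" for i
    proof -
      have "(\<Sum>j\<le>d. (if i + j = d then b i else 0) * x ^ i * y ^ j) =
          (\<Sum>j\<le>d. if j = d - i then b i * x ^ i * y ^ j else 0)"
        using that by (intro sum.cong) auto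
      then show ?thesis by simp
    qed
    then show "q x y = (\<Sum>i\<le>d. \<Sum>j\<le>d. (if i + j = d then b i else 0) * x ^ i * y ^ j)"
      by (simp add: b)
  qed (use assms(2) in auto)
qed

definition normal_map :: "(real \<Rightarrow> real \<Rightarrow> real) \<Rightarrow> real^3 \<Rightarrow> real^3" where
  "normal_map p \<xi> = Jmat *v (\<xi> + p (\<xi>$1) (\<xi>$2) *\<^sub>R e3)"

lemma pd_3_eq_0:
  assumes "pol (\<lambda>\<xi>. p (\<xi>$1) (\<xi>$2))"
  shows "pd 3 (\<lambda>\<xi>. p (\<xi>$1) (\<xi>$2)) \<xi> = 0"
  by (rule pd_eq_0_if_const_on_line[OF pol_differentiable[OF assms]]) (simp add: axis_def)

text \<open>The entries \<open>a\<close> and \<open>b\<close> contain the derivatives of p and are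
  only of order 1. In the expansion they occur only multiplied by \<open>k 1 3\<close> or
  \<open>k 2 3\<close>, so everything beyond 1 plus the trace is one order smaller than the
  k's.\<close>

lemma det_linearization:
  fixes k :: "3 \<Rightarrow> 3 \<Rightarrow> real^3 \<Rightarrow> real"
  assumes k: "\<And>i j. vanish (Suc e) (k i j)" and ab: "vanish 1 a" "vanish 1 b"
    and M: "\<And>\<xi>. M \<xi> = vector [vector [1 + k 1 1 \<xi>, k 1 2 \<xi>, k 1 3 \<xi>],
      vector [k 2 1 \<xi>, 1 + k 2 2 \<xi>, k 2 3 \<xi>], vector [a \<xi>, b \<xi>, 1 + k 3 3 \<xi>]]"
  shows "vanish (Suc (Suc e)) (\<lambda>\<xi>. det (M \<xi> :: real^3^3) - 1 - (\<Sum>i\<in>UNIV. k i i \<xi>))"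
proof -
  have k1: "vanish 1 (k i j)" for i j using k by (rule vanish_mono) simp
  have m1: "vanish 1 (\<lambda>\<xi>. f \<xi> * g \<xi>)" if "vanish 1 f" "vanish 1 g" for f g :: "real^3 \<Rightarrow> real"
    using vanish_mult[OF that] by (rule vanish_mono) simp
  have m2: "vanish (Suc (Suc e)) (\<lambda>\<xi>. k i j \<xi> * f \<xi>)" if "vanish 1 f" for f i j
    using vanish_mult[OF k that] by simp
  have "vanish (Suc (Suc e)) (\<lambda>\<xi>. k 1 1 \<xi> * (k 2 2 \<xi> + k 3 3 \<xi> + k 2 2 \<xi> * k 3 3 \<xi> - k 2 3 \<xi> * b \<xi>)
      + k 2 2 \<xi> * k 3 3 \<xi> - k 2 3 \<xi> * b \<xi>
      - k 1 2 \<xi> * (k 2 1 \<xi> + k 2 1 \<xi> * k 3 3 \<xi> - k 2 3 \<xi> * a \<xi>)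
      + k 1 3 \<xi> * (k 2 1 \<xi> * b \<xi> - a \<xi> - k 2 2 \<xi> * a \<xi>))"
    by (rule vanish_add vanish_diff m2 | rule m1 k1 ab)+
  moreover have "det (M \<xi>) - 1 - (\<Sum>i\<in>UNIV. k i i \<xi>) =
      k 1 1 \<xi> * (k 2 2 \<xi> + k 3 3 \<xi> + k 2 2 \<xi> * k 3 3 \<xi> - k 2 3 \<xi> * b \<xi>)
      + k 2 2 \<xi> * k 3 3 \<xi> - k 2 3 \<xi> * b \<xi>
      - k 1 2 \<xi> * (k 2 1 \<xi> + k 2 1 \<xi> * k 3 3 \<xi> - k 2 3 \<xi> * a \<xi>)
      + k 1 3 \<xi> * (k 2 1 \<xi> * b \<xi> - a \<xi> - k 2 2 \<xi> * a \<xi>)" for \<xi>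
    by (simp add: M det_3 sum_3 algebra_simps)
  ultimately show ?thesis by simp
qed

section \<open>Normalization degree by degree\<close>

text \<open>The new polynomial is p plus the homogeneous part of degree d supplied by the
  homological equation; lower terms stay as they are.\<close>

lemma normal_map_step:
  assumes d: "2 \<le> d" and p: "poly2_ord2 p" and P: "\<And>i. pol (\<lambda>\<xi>. P \<xi> $ i)"
    and v: "vanish d (\<lambda>\<xi>. P \<xi> - normal_map p \<xi>)" and det: "vanish d (\<lambda>\<xi>. det (jac P \<xi>) - 1)"
  shows "\<exists>\<psi> \<theta> q. shear_aut \<psi> \<theta> \<and> poly2_ord2 q \<and>
    vanish (Suc d) (\<lambda>\<eta>. \<psi> (P (\<theta> \<eta>)) - normal_map q \<eta>)"
proof -
  \<comment> \<open>With d = e + 2, the first derivatives of the defect have order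
    \<open>Suc e\<close>, and truncated subtraction is avoided.\<close>
  obtain e where e: "d = Suc (Suc e)" using d by (metis Suc_le_D numeral_2_eq_2 Suc_le_mono)
  let ?p = "\<lambda>\<xi>::real^3. p (\<xi>$1) (\<xi>$2)"
  have pp: "pol ?p" "vanish 2 ?p" using poly2_ord2_pol(1,2)[OF p] .
  \<comment> \<open>The defect after stripping the factor J, which has determinant 1: P = J (\<xi> +
    p e3 + K).\<close>
  define K where "K \<xi> = Jinv *v P \<xi> - (\<xi> + ?p \<xi> *\<^sub>R e3)" for \<xi>
  have K: "K = (\<lambda>\<xi>. Jinv *v (P \<xi> - normal_map p \<xi>))"
    by (rule ext) (simp add: K_def normal_map_def matrix_vector_mult_diff_distrib Jinv_Jmat)
  have PK: "P \<xi> = Jmat *v (\<xi> + ?p \<xi> *\<^sub>R e3 + K \<xi>)" for \<xi>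
    by (simp add: K_def Jmat_Jinv)
  have vK: "vanish d K" unfolding K by (rule vanish_matrix[OF v])
  have polK: "pol (\<lambda>\<xi>. K \<xi> $ i)" for i
    using exhaust_3[of i] by (auto simp: K_def Jinv_mult e3_nth intro!: pol_diff pol_add P pol_coord pp pol_const)
  have "\<forall>i. \<exists>r. hpoly d r \<and> vanish (Suc d) (\<lambda>\<xi>. K \<xi> $ i - r \<xi>) \<and> pol (\<lambda>\<xi>. K \<xi> $ i - r \<xi>)"
    using pol_leading_term[OF polK vanish_nth[OF vK]] by metis
  from choice[OF this] obtain r where r: "\<And>i. hpoly d (r i)"
    "\<And>i. vanish (Suc d) (\<lambda>\<xi>. K \<xi> $ i - r i \<xi>)" "\<And>i. pol (\<lambda>\<xi>. K \<xi> $ i - r i \<xi>)" by blast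
  define R :: "real^3 \<Rightarrow> real^3" where "R \<xi> = (\<chi> i. r i \<xi>)" for \<xi>
  have hR: "hpoly d (\<lambda>\<xi>. R \<xi> $ i)" for i using r(1) by (simp add: R_def)
  have KR: "vanish (Suc d) (\<lambda>\<xi>. K \<xi> - R \<xi>)" by (rule vanish_vec) (use r(2) in \<open>simp add: R_def\<close>)

  define k where "k i j = pd j (\<lambda>\<xi>. K \<xi> $ i)" for i j
  have vk: "vanish (Suc e) (k i j)" for i j
    unfolding k_def using vanish_nth[OF vK] by (intro vanish_pd polK) (simp add: e)
  have vp: "vanish 1 (pd j ?p)" for j
    using vanish_pd[OF pp(1), of 1 j] pp(2) by (simp add: numeral_2_eq_2)
  let ?N = "\<lambda>\<xi>. \<xi> + ?p \<xi> *\<^sub>R e3 + K \<xi>"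
  have jN: "jac ?N \<xi> = vector [vector [1 + k 1 1 \<xi>, k 1 2 \<xi>, k 1 3 \<xi>],
      vector [k 2 1 \<xi>, 1 + k 2 2 \<xi>, k 2 3 \<xi>], vector [pd 1 ?p \<xi> + k 3 1 \<xi>, pd 2 ?p \<xi> + k 3 2 \<xi>, 1 + k 3 3 \<xi>]]"
    for \<xi>
  proof -
    have x: "pd j (\<lambda>\<xi>::real^3. \<xi> $ i) \<xi> = axis j 1 $ i" for i j
      by (rule pd_eqI) (intro bounded_linear_imp_has_derivative bounded_linear_vec_nth)
    show ?thesis
      by (simp add: jac_def vec_eq_iff forall_3 e3_nth pd_add differentiable_add pol_differentiable[OF pol_coord]
          pol_differentiable[OF pp(1)] pol_differentiable[OF polK] x axis_def k_def pd_3_eq_0[OF pp(1)] pd_const)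
  qed
  have detP: "det (jac P \<xi>) = det (jac ?N \<xi>)" for \<xi>
  proof -
    have "(?N has_derivative (*v) (jac ?N \<xi>)) (at \<xi>)"
    proof (rule has_derivative_jac)
      fix i
      have "pol (\<lambda>\<xi>. \<xi> $ i + ?p \<xi> * e3 $ i + K \<xi> $ i)"
        by (intro pol_add pol_coord pol_mult pp pol_const polK)
      then show "(\<lambda>\<xi>. ?N \<xi> $ i) differentiable at \<xi>"
        using pol_differentiable by simp
    qed
    from has_derivative_compose[OF this bounded_linear_imp_has_derivative[OF matrix_vector_mul_bounded_linear], of Jmat]
    have "(P has_derivative (*v) (Jmat ** jac ?N \<xi>)) (at \<xi>)"
      by (simp add: PK[abs_def] matrix_vector_mul_assoc)
    from jac_eqI[OF this] show ?thesis by (simp add: det_mul det_Jmat)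
  qed
  have "vanish (Suc (Suc e)) (\<lambda>\<xi>. det (jac ?N \<xi>) - 1 - (\<Sum>i\<in>UNIV. k i i \<xi>))"
    by (rule det_linearization[OF vk _ _ jN]) (intro vanish_add vp vanish_mono[OF vk], simp)+
  from vanish_diff[OF det[unfolded detP e] this]
  have tr: "vanish d (\<lambda>\<xi>. \<Sum>i\<in>UNIV. k i i \<xi>)" by (simp add: e)
  have rem: "vanish d (\<lambda>\<xi>. k i i \<xi> - pd i (\<lambda>\<xi>. R \<xi> $ i) \<xi>)" for i
  proof -
    have "vanish d (pd i (\<lambda>\<xi>. K \<xi> $ i - r i \<xi>))" by (rule vanish_pd[OF r(3) r(2)])
    moreover have "pd i (\<lambda>\<xi>. K \<xi> $ i - r i \<xi>) = (\<lambda>\<xi>. k i i \<xi> - pd i (\<lambda>\<xi>. R \<xi> $ i) \<xi>)"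
      by (rule ext) (simp add: k_def R_def pd_diff pol_differentiable[OF polK] hpoly_differentiable[OF r(1)])
    ultimately show ?thesis by (simp only:)
  qed
  \<comment> \<open>The trace of DK has order d by volume preservation, and passing from K to its
    leading part R changes the trace only by order d. The divergence of R is homogeneous of degree d
    - 1, so it must be zero.\<close>
  have "vanish d (\<lambda>\<xi>. (\<Sum>i\<in>UNIV. k i i \<xi>) - (\<Sum>i\<in>UNIV. k i i \<xi> - pd i (\<lambda>\<xi>. R \<xi> $ i) \<xi>))"
    by (rule vanish_diff[OF tr vanish_sum[OF rem]])
  then have "vanish (Suc (Suc e)) (\<lambda>\<xi>. \<Sum>i\<in>UNIV. pd i (\<lambda>\<xi>. R \<xi> $ i) \<xi>)"
    by (simp add: sum_subtractf e)
  moreover have "hpoly (Suc e) (\<lambda>\<xi>. \<Sum>i\<in>UNIV. pd i (\<lambda>\<xi>. R \<xi> $ i) \<xi>)"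
    by (rule hpoly_sum) (use hpoly_pd[OF hR] in \<open>simp add: e\<close>)
  ultimately have "div_free R"
    unfolding div_free_def using hpoly_eq_0 by blast
  from homological_equation_solvable[OF hR this]
  obtain h q where h: "shear_sum d h" "hom2 d q"
    "\<And>\<xi>. Jmat *v R \<xi> = Jmat *v (q (\<xi>$1) (\<xi>$2) *\<^sub>R e3) + Jmat *v h \<xi> - h (Jmat *v \<xi>)"
    unfolding homological_def by blast
  obtain \<psi> \<theta> where \<psi>: "shear_aut \<psi> \<theta>" "vanish (Suc d) (\<lambda>\<xi>. \<psi> \<xi> - (\<xi> + h \<xi>))"
    using shear_sum_realize[OF h(1) d] by blast
  note hh = shear_sum_hpoly[OF h(1)]
  have \<theta>: "vanish (Suc d) (\<lambda>\<eta>. \<theta> \<eta> - (\<eta> - h \<eta>))" by (rule shear_aut_inverse_approx[OF \<psi> hh])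
  have \<theta>1: "vanish 1 \<theta>" and \<theta>2: "vanish 2 (\<lambda>\<eta>. \<theta> \<eta> - \<eta>)"
    using shear_aut_vanish_1 shear_aut_near_id shear_aut_swap[OF \<psi>(1)] by blast+
  have \<theta>d: "vanish d (\<lambda>\<eta>. \<theta> \<eta> - \<eta>)"
    using vanish_diff[OF vanish_mono[OF \<theta>, of d] hpoly_vec_vanish[OF hh]] by simp

  have PJ: "vanish 2 (\<lambda>\<xi>. P \<xi> - Jmat *v \<xi>)"
  proof -
    have "vanish 2 (\<lambda>\<xi>. Jmat *v (?p \<xi> *\<^sub>R e3 + K \<xi>))"
      by (intro vanish_matrix vanish_add vanish_mono[OF vK d]
          vanish_bounded_linear[OF bounded_linear_scaleR_left] pp)
    then show ?thesis by (simp add: PK matrix_vector_right_distrib)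
  qed
  have J1: "vanish 1 (\<lambda>\<eta>. Jmat *v \<eta>)" by (intro vanish_matrix vanish_id)
  have P1: "vanish 1 P" using vanish_add[OF vanish_mono[OF PJ, of 1] J1] by simp
  have P\<theta>1: "vanish 1 (\<lambda>\<eta>. P (\<theta> \<eta>))" by (rule vanish_comp[OF P1 \<theta>1])
  \<comment> \<open>Inside h, of degree d, the inner map may be replaced by J at the cost of order d
    + 1, because the two differ by order 2.\<close>
  have P\<theta>J: "vanish (Suc 1) (\<lambda>\<eta>. P (\<theta> \<eta>) - Jmat *v \<eta>)"
    using vanish_add[OF vanish_comp[OF PJ \<theta>1] vanish_matrix[OF \<theta>2, of Jmat]]
    by (simp add: matrix_vector_mult_diff_distrib numeral_2_eq_2)
  have a: "vanish (Suc d) (\<lambda>\<eta>. \<psi> (P (\<theta> \<eta>)) - (P (\<theta> \<eta>) + h (P (\<theta> \<eta>))))"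
    by (rule vanish_comp[OF \<psi>(2) P\<theta>1])
  have b: "vanish (Suc d) (\<lambda>\<eta>. h (P (\<theta> \<eta>)) - h (Jmat *v \<eta>))"
    using hpoly_vec_Lipschitz[OF hh P\<theta>1 J1 P\<theta>J] by simp
  have c: "vanish (Suc d) (\<lambda>\<eta>. K (\<theta> \<eta>) - R \<eta>)"
    using vanish_add[OF vanish_comp[OF KR \<theta>1] hpoly_vec_Lipschitz[OF hR \<theta>1 vanish_id, of 1, simplified]]
      \<theta>2 by (simp add: numeral_2_eq_2)
  \<comment> \<open>Here \<theta> - id has order d = (e + 1) + 1, and the gain for p yields (e + 1)
    + 2 = d + 1.\<close>
  have "vanish (Suc d) (\<lambda>\<eta>. ?p (\<theta> \<eta>) - ?p \<eta>)"
    using poly2_ord2_pol(3)[OF p \<theta>1 vanish_id, of "Suc e"] \<theta>d by (simp add: e)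
  then have "vanish (Suc d) (\<lambda>\<eta>. (?p (\<theta> \<eta>) - ?p \<eta>) *\<^sub>R e3)"
    by (rule vanish_bounded_linear[OF bounded_linear_scaleR_left])
  from vanish_matrix[OF vanish_add[OF vanish_add[OF \<theta> this] c], of Jmat]
  have g: "vanish (Suc d) (\<lambda>\<eta>. P (\<theta> \<eta>) - (Jmat *v (\<eta> + ?p \<eta> *\<^sub>R e3 + R \<eta>) - Jmat *v h \<eta>))"
    by (simp add: PK matrix_vector_right_distrib matrix_vector_mult_diff_distrib scaleR_diff_left algebra_simps)
  let ?q = "\<lambda>x y. p x y + q x y"
  have "vanish (Suc d) (\<lambda>\<eta>. \<psi> (P (\<theta> \<eta>)) - normal_map ?q \<eta>)"
    using vanish_add[OF vanish_add[OF a b] g] h(3)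
    by (simp add: normal_map_def matrix_vector_right_distrib scaleR_left_distrib algebra_simps)
  moreover have "poly2_ord2 ?q" by (rule poly2_ord2_add[OF p hom2_poly2_ord2[OF h(2) d]])
  ultimately show ?thesis using \<psi>(1) by blast
qed

text \<open>The induction starts at d = 1 with p = 0, as T = J + O(2). Conjugation by maps of
  determinant 1 turns det DT into det DT o \<theta>, so the determinant condition of order D
  persists through all steps up to d = D.\<close>

lemma normal_form_pol:
  assumes T: "\<And>i. pol (\<lambda>\<xi>. T \<xi> $ i)" "vanish 2 (\<lambda>\<xi>. T \<xi> - Jmat *v \<xi>)"
    and det: "vanish D (\<lambda>\<xi>. det (jac T \<xi>) - 1)" and d: "1 \<le> d" "d \<le> D"
  shows "\<exists>\<psi> \<theta> p. shear_aut \<psi> \<theta> \<and> poly2_ord2 p \<and> vanish (Suc d) (\<lambda>\<eta>. \<psi> (T (\<theta> \<eta>)) - normal_map p \<eta>)"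
  using d
proof (induction d rule: dec_induct)
  case base
  have "vanish (Suc 1) (\<lambda>\<eta>. T \<eta> - normal_map (\<lambda>_ _. 0) \<eta>)"
    using T(2) by (simp add: normal_map_def numeral_2_eq_2)
  then show ?case using shear_aut.id poly2_ord2_zero by blast
next
  case (step d)
  then obtain \<psi> \<theta> p where *: "shear_aut \<psi> \<theta>" "poly2_ord2 p"
    "vanish (Suc d) (\<lambda>\<eta>. \<psi> (T (\<theta> \<eta>)) - normal_map p \<eta>)" by auto
  let ?P = "\<lambda>\<eta>. \<psi> (T (\<theta> \<eta>))"
  note \<theta> = shear_aut_swap[OF *(1)]
  have P: "pol (\<lambda>\<eta>. ?P \<eta> $ i)" for i
    by (rule pol_comp[OF shear_aut_pol[OF *(1)]], rule pol_comp[OF T(1) shear_aut_pol[OF \<theta>]])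
  have "det (jac ?P \<eta>) = det (jac T (\<theta> \<eta>))" for \<eta>
  proof -
    obtain A where A: "(\<theta> has_derivative (*v) A) (at \<eta>)" "det A = 1"
      using shear_aut_derivative[OF \<theta>] by blast
    have B: "(T has_derivative (*v) (jac T (\<theta> \<eta>))) (at (\<theta> \<eta>))"
      by (rule has_derivative_jac) (rule pol_differentiable[OF T(1)])
    obtain C where C: "(\<psi> has_derivative (*v) C) (at (T (\<theta> \<eta>)))" "det C = 1"
      using shear_aut_derivative[OF *(1)] by blast
    from has_derivative_compose[OF has_derivative_compose[OF A(1) B] C(1)]
    have "(?P has_derivative (*v) (C ** jac T (\<theta> \<eta>) ** A)) (at \<eta>)"
      by (simp add: matrix_vector_mul_assoc matrix_mul_assoc)
    from jac_eqI[OF this] show ?thesis by (simp add: det_mul A C)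
  qed
  then have "vanish D (\<lambda>\<eta>. det (jac ?P \<eta>) - 1)"
    using vanish_comp[OF det shear_aut_vanish_1[OF \<theta>]] by simp
  then have "vanish (Suc d) (\<lambda>\<eta>. det (jac ?P \<eta>) - 1)"
    using step.prems by (rule vanish_mono)
  from normal_map_step[OF _ *(2) P *(3) this] step.hyps(1)
  obtain \<psi>' \<theta>' q where q: "shear_aut \<psi>' \<theta>'" "poly2_ord2 q"
    "vanish (Suc (Suc d)) (\<lambda>\<eta>. \<psi>' (?P (\<theta>' \<eta>)) - normal_map q \<eta>)" by auto
  then show ?case using shear_aut_comp[OF q(1) *(1)] by blast
qed

section \<open>The Taylor polynomial of a volume-preserving map\<close>

lemma vanish_mult_diff:
  fixes a b a' b' :: "real^3 \<Rightarrow> real"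
  assumes "vanish D (\<lambda>\<xi>. a \<xi> - a' \<xi>)" "vanish D (\<lambda>\<xi>. b \<xi> - b' \<xi>)" "vanish 0 b" "vanish 0 a'"
  shows "vanish D (\<lambda>\<xi>. a \<xi> * b \<xi> - a' \<xi> * b' \<xi>)"
proof -
  have "vanish D (\<lambda>\<xi>. (a \<xi> - a' \<xi>) * b \<xi>)" using vanish_mult[OF assms(1,3)] by simp
  moreover have "vanish D (\<lambda>\<xi>. a' \<xi> * (b \<xi> - b' \<xi>))" using vanish_mult[OF assms(4,2)] by simp
  ultimately have "vanish D (\<lambda>\<xi>. (a \<xi> - a' \<xi>) * b \<xi> + a' \<xi> * (b \<xi> - b' \<xi>))"
    by (rule vanish_add)
  then show ?thesis by (simp add: algebra_simps)
qed

lemma vanish_det_diff: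
  fixes A B :: "real^3 \<Rightarrow> real^3^3"
  assumes AB: "\<And>i j. vanish D (\<lambda>\<xi>. A \<xi> $ i $ j - B \<xi> $ i $ j)" and B: "\<And>i j. vanish 0 (\<lambda>\<xi>. B \<xi> $ i $ j)"
  shows "vanish D (\<lambda>\<xi>. det (A \<xi>) - det (B \<xi>))"
proof -
  have A: "vanish 0 (\<lambda>\<xi>. A \<xi> $ i $ j)" for i j
    using vanish_add[OF vanish_mono[OF AB[of i j], of 0] B[of i j]] by simp
  have m0: "vanish 0 (\<lambda>\<xi>. f \<xi> * g \<xi>)" if "vanish 0 f" "vanish 0 g" for f g :: "real^3 \<Rightarrow> real"
    using vanish_mult[OF that] by simp
  have "vanish D (\<lambda>\<xi>. A \<xi> $ i $ j * A \<xi> $ k $ l * A \<xi> $ m $ n - B \<xi> $ i $ j * B \<xi> $ k $ l * B \<xi> $ m $ n)"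
    for i j k l m n
    by (intro vanish_mult_diff AB A B m0)
  note t = this
  have "vanish D (\<lambda>\<xi>.
      (A \<xi>$1$1 * A \<xi>$2$2 * A \<xi>$3$3 - B \<xi>$1$1 * B \<xi>$2$2 * B \<xi>$3$3)
      + (A \<xi>$1$2 * A \<xi>$2$3 * A \<xi>$3$1 - B \<xi>$1$2 * B \<xi>$2$3 * B \<xi>$3$1)
      + (A \<xi>$1$3 * A \<xi>$2$1 * A \<xi>$3$2 - B \<xi>$1$3 * B \<xi>$2$1 * B \<xi>$3$2)
      - (A \<xi>$1$1 * A \<xi>$2$3 * A \<xi>$3$2 - B \<xi>$1$1 * B \<xi>$2$3 * B \<xi>$3$2)
      - (A \<xi>$1$2 * A \<xi>$2$1 * A \<xi>$3$3 - B \<xi>$1$2 * B \<xi>$2$1 * B \<xi>$3$3)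
      - (A \<xi>$1$3 * A \<xi>$2$2 * A \<xi>$3$1 - B \<xi>$1$3 * B \<xi>$2$2 * B \<xi>$3$1))"
    by (intro vanish_diff[OF vanish_diff[OF vanish_diff[OF vanish_add[OF vanish_add]]]] t)
  then show ?thesis by (simp add: det_3 algebra_simps)
qed

text \<open>The approximation has order D + 1, its derivative only order D; hence the determinant of
  the polynomial map is 1 to order D rather than exactly.\<close>

lemma smooth_volume_preserving_Taylor:
  assumes U: "open U" "0 \<in> U" and f: "smooth_on U f" "vol_pres_on U f"
  obtains T where "\<And>i. pol (\<lambda>\<xi>. T \<xi> $ i)" "vanish (Suc D) (\<lambda>\<xi>. f \<xi> - T \<xi>)"
    "vanish D (\<lambda>\<xi>. det (jac T \<xi>) - 1)"
proof -
  have sm: "Ck k U (\<lambda>\<xi>. f \<xi> $ i)" for k i using f(1) unfolding smooth_on_def by blast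
  have "\<exists>t. pol t \<and> vanish (Suc D) (\<lambda>\<xi>. f \<xi> $ i - t \<xi>)" for i by (rule Taylor_pol[OF U sm])
  then obtain t where t: "\<And>i. pol (t i)" "\<And>i. vanish (Suc D) (\<lambda>\<xi>. f \<xi> $ i - t i \<xi>)" by metis
  define T :: "real^3 \<Rightarrow> real^3" where "T \<xi> = (\<chi> i. t i \<xi>)" for \<xi>
  have T: "(\<lambda>\<xi>. T \<xi> $ i) = t i" for i by (simp add: T_def)
  have d: "vanish D (\<lambda>\<xi>. jac f \<xi> $ i $ j - jac T \<xi> $ i $ j)" for i j
    using Taylor_pol_pd[OF U sm t(1) t(2)] by (simp add: jac_def T)
  have "vanish 0 q" if q: "pol q" for q
  proof -
    obtain n Q where *: "\<And>k. hpoly k (Q k)" "\<And>\<xi>. q \<xi> = (\<Sum>k\<le>n. Q k \<xi>)"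
      using q by (rule pol_expand) blast
    show ?thesis unfolding *(2)
      by (intro vanish_sum vanish_mono[OF hpoly_vanish[OF *(1)]]) simp
  qed
  then have b: "vanish 0 (\<lambda>\<xi>. jac T \<xi> $ i $ j)" for i j
    by (simp add: jac_def T pol_pd t(1))
  have "\<forall>\<^sub>F \<xi> in nhds 0. det (jac f \<xi>) = 1"
    using eventually_nhds_in_open[OF U]
  proof eventually_elim
    case (elim \<xi>)
    then have *: "f differentiable (at \<xi>)" "det (matrix (frechet_derivative f (at \<xi>))) = 1"
      using f(2) unfolding vol_pres_on_def by blast+
    then have D: "(f has_derivative frechet_derivative f (at \<xi>)) (at \<xi>)"
      by (simp add: frechet_derivative_works)
    then have "(f has_derivative (*v) (matrix (frechet_derivative f (at \<xi>)))) (at \<xi>)"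
      by (simp add: has_derivative_linear)
    from jac_eqI[OF this] *(2) show ?case by simp
  qed
  then have eq: "\<forall>\<^sub>F \<xi> in nhds 0. - (det (jac f \<xi>) - det (jac T \<xi>)) = det (jac T \<xi>) - 1"
    by eventually_elim simp
  show thesis
  proof (rule that[of T])
    show "pol (\<lambda>\<xi>. T \<xi> $ i)" for i unfolding T by (rule t)
    show "vanish (Suc D) (\<lambda>\<xi>. f \<xi> - T \<xi>)" by (rule vanish_vec) (use t(2) in \<open>simp add: T_def\<close>)
    show "vanish D (\<lambda>\<xi>. det (jac T \<xi>) - 1)"
      by (rule vanish_cong[OF eq vanish_minus[OF vanish_det_diff[OF d b]]])
  qed
qed

section \<open>Polynomial inverse of the normal form\<close>

lemma finite_degree_le: "finite {(i, j, k). i + j + k \<le> (n::nat)}"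
  by (rule finite_subset[of _ "{..n} \<times> {..n} \<times> {..n}"]) auto

lemma poly3_deg_le_add:
  assumes "poly3_deg_le n p" "poly3_deg_le n q"
  shows "poly3_deg_le n (\<lambda>\<xi>. p \<xi> + q \<xi>)"
proof -
  let ?S = "{(i, j, k). i + j + k \<le> n}"
  obtain b c where "\<And>\<xi>. p \<xi> = (\<Sum>(i,j,k)\<in>?S. b i j k * \<xi>$1 ^ i * \<xi>$2 ^ j * \<xi>$3 ^ k)"
    "\<And>\<xi>. q \<xi> = (\<Sum>(i,j,k)\<in>?S. c i j k * \<xi>$1 ^ i * \<xi>$2 ^ j * \<xi>$3 ^ k)"
    using assms unfolding poly3_deg_le_def by blast
  then show ?thesis unfolding poly3_deg_le_def
    by (intro exI[of _ "\<lambda>i j k. b i j k + c i j k"]) (simp add: split_def distrib_right sum.distrib)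
qed

lemma poly3_deg_le_monomial:
  assumes "i + j + k \<le> n"
  shows "poly3_deg_le n (\<lambda>\<xi>. a * (\<xi>$1 ^ i * \<xi>$2 ^ j * \<xi>$3 ^ k))"
  unfolding poly3_deg_le_def
proof (intro exI allI)
  fix \<xi> :: "real^3"
  let ?S = "{(i, j, k). i + j + k \<le> n}"
  let ?c = "\<lambda>i' j' k'. if (i', j', k') = (i, j, k) then a else 0"
  have "(\<Sum>(i',j',k')\<in>?S. ?c i' j' k' * \<xi>$1 ^ i' * \<xi>$2 ^ j' * \<xi>$3 ^ k') =
      (\<Sum>x\<in>?S. if x = (i, j, k) then a * (\<xi>$1 ^ i * \<xi>$2 ^ j * \<xi>$3 ^ k) else 0)"
    by (intro sum.cong) (auto split: if_splits)
  also have "\<dots> = a * (\<xi>$1 ^ i * \<xi>$2 ^ j * \<xi>$3 ^ k)"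
    using assms by (simp add: finite_degree_le)
  finally show "a * (\<xi>$1 ^ i * \<xi>$2 ^ j * \<xi>$3 ^ k) =
      (\<Sum>(i',j',k')\<in>?S. ?c i' j' k' * \<xi>$1 ^ i' * \<xi>$2 ^ j' * \<xi>$3 ^ k')" by simp
qed

lemma poly3_deg_le_iff_pol_le: "poly3_deg_le n q \<longleftrightarrow> pol_le n q"
proof
  assume "poly3_deg_le n q"
  then obtain c where c: "q = (\<lambda>\<xi>. \<Sum>(i,j,k)\<in>{(i,j,k). i + j + k \<le> n}. c i j k * \<xi>$1 ^ i * \<xi>$2 ^ j * \<xi>$3 ^ k)"
    unfolding poly3_deg_le_def by blast
  show "pol_le n q" unfolding c
  proof (rule pol_le_sum)
    fix x assume "x \<in> {(i, j, k). i + j + k \<le> n}"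
    then obtain i j k where "x = (i, j, k)" "i + j + k \<le> n" by auto
    then show "pol_le n (\<lambda>\<xi>. case x of (i, j, k) \<Rightarrow> c i j k * \<xi>$1 ^ i * \<xi>$2 ^ j * \<xi>$3 ^ k)"
      using hpoly_pol_le[OF hpoly_monomial[of i j k "c i j k"]] by (simp add: mult.assoc)
  qed
next
  assume "pol_le n q"
  then obtain Q where Q: "\<And>k. hpoly k (Q k)" "\<And>\<xi>. q \<xi> = (\<Sum>k\<le>n. Q k \<xi>)"
    unfolding pol_le_def by blast
  have mono: "poly3_deg_le n r" if "monspan d r" "d \<le> n" for d r
    using that by (induction rule: monspan.induct) (auto intro: poly3_deg_le_monomial poly3_deg_le_add)
  have zero: "poly3_deg_le n (\<lambda>_. 0)"
    using poly3_deg_le_monomial[of 0 0 0 n 0] by simp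
  have "poly3_deg_le n (\<lambda>\<xi>. \<Sum>k\<in>I. Q k \<xi>)" if "I \<subseteq> {..n}" for I
    using finite_subset[OF that finite_atMost] that
  proof (induction I rule: finite_induct)
    case empty
    then show ?case using zero by simp
  next
    case (insert k I)
    then show ?case
      using poly3_deg_le_add[OF mono[OF hpoly_imp_monspan[OF Q(1)[of k]]]] by simp
  qed
  moreover have "q = (\<lambda>\<xi>. \<Sum>k\<le>n. Q k \<xi>)" by (rule ext, rule Q(2))
  ultimately show "poly3_deg_le n q" by simp
qed

lemma poly2_pol: "poly2 p \<Longrightarrow> pol (\<lambda>\<xi>. p (\<xi>$1) (\<xi>$2))"
  unfolding poly2_def by (auto intro!: pol_sum pol_mult pol_const pol_power pol_coord)

text \<open>The derivative is J (I + e3 grad p^T). As p does not depend on the third variable, the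
  second factor is unit lower triangular.\<close>

lemma vol_pres_on_normal_map:
  assumes p: "pol (\<lambda>\<xi>. p (\<xi>$1) (\<xi>$2))"
  shows "vol_pres_on UNIV (normal_map p)"
proof (rule vol_pres_onI)
  fix \<xi> :: "real^3"
  let ?p = "\<lambda>\<xi>::real^3. p (\<xi>$1) (\<xi>$2)"
  define S :: "real^3^3" where "S = (\<chi> i j. (if i = j then 1 else 0) + e3 $ i * pd j ?p \<xi>)"
  have S: "(*v) S = (\<lambda>w. w + (\<Sum>i\<in>UNIV. w $ i * pd i ?p \<xi>) *\<^sub>R e3)"
    by (rule ext) (simp add: S_def vec_eq_iff forall_3 matrix_vector_mult_def sum_3 e3_nth algebra_simps)
  have "((\<lambda>\<xi>. \<xi> + ?p \<xi> *\<^sub>R e3) has_derivative (*v) S) (at \<xi>)"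
    unfolding S by (intro has_derivative_add has_derivative_ident has_derivative_scaleR_left
        has_derivative_pd pol_differentiable p)
  from has_derivative_compose[OF this bounded_linear_imp_has_derivative[OF matrix_vector_mul_bounded_linear], of Jmat]
  show "(normal_map p has_derivative (*v) (Jmat ** jac (\<lambda>\<xi>. \<xi> + ?p \<xi> *\<^sub>R e3) \<xi>)) (at \<xi>)"
    using jac_eqI[OF \<open>(_ has_derivative (*v) S) _\<close>]
    by (simp add: normal_map_def[abs_def] matrix_vector_mul_assoc)
  have "det S = 1" by (simp add: S_def det_3 e3_nth pd_3_eq_0[OF p])
  then show "det (Jmat ** jac (\<lambda>\<xi>. \<xi> + ?p \<xi> *\<^sub>R e3) \<xi>) = 1"
    using jac_eqI[OF \<open>(_ has_derivative (*v) S) _\<close>] by (simp add: det_mul det_Jmat)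
qed

text \<open>Adding p e3 leaves the first two coordinates alone, so p can be evaluated at J^(-1)
  \<eta> and subtracted.\<close>

definition normal_map_inv :: "(real \<Rightarrow> real \<Rightarrow> real) \<Rightarrow> real^3 \<Rightarrow> real^3" where
  "normal_map_inv p \<eta> = Jinv *v \<eta> - p ((Jinv *v \<eta>)$1) ((Jinv *v \<eta>)$2) *\<^sub>R e3"

lemma normal_map_inverse:
  "normal_map_inv p (normal_map p \<xi>) = \<xi>" "normal_map p (normal_map_inv p \<eta>) = \<eta>"
  by (simp_all add: normal_map_def normal_map_inv_def Jinv_Jmat Jmat_Jinv e3_nth)

text \<open>The bound on one coordinate is a hypothesis because the degree comparison runs over
  every n, including n = 0. Row i of M is copied into all rows of \<open>?A\<close>, whose first
  output is then the required linear form.\<close>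

lemma pol_le_all_coords:
  assumes "pol_le n (\<lambda>\<xi>. \<xi> $ 1)"
  shows "pol_le n (\<lambda>\<xi>. (M *v \<xi>) $ i)"
proof -
  let ?A = "(\<chi> a b. M $ i $ b) :: real^3^3"
  have "(?A *v \<xi>) $ 1 = (M *v \<xi>) $ i" for \<xi> by (simp add: matrix_vector_mult_def)
  then show ?thesis using pol_le_comp_matrix[OF assms, of ?A] by simp
qed

text \<open>Both sides say that the coordinates and p satisfy the bound n. For the inverse this is
  seen after composing with J, which does not raise degrees. Equality of the least bounds follows
  without computing the degree.\<close>

lemma pol_le_normal_map_inv_iff:
  "(\<forall>i. pol_le n (\<lambda>\<xi>. normal_map p \<xi> $ i)) \<longleftrightarrow> (\<forall>i. pol_le n (\<lambda>\<xi>. normal_map_inv p \<xi> $ i))"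
proof -
  let ?p = "\<lambda>\<xi>::real^3. p (\<xi>$1) (\<xi>$2)"
  have "(\<forall>i. pol_le n (\<lambda>\<xi>. normal_map p \<xi> $ i)) \<longleftrightarrow> pol_le n (\<lambda>\<xi>. \<xi> $ 1) \<and> pol_le n ?p"
  proof safe
    assume n: "\<forall>i. pol_le n (\<lambda>\<xi>. normal_map p \<xi> $ i)"
    have "pol_le n (\<lambda>\<xi>. normal_map p \<xi> $ 1 - normal_map p \<xi> $ 2 + normal_map p \<xi> $ 3)"
      using n by (intro pol_le_add pol_le_diff) auto
    then show x: "pol_le n (\<lambda>\<xi>. \<xi> $ 1)" by (simp add: normal_map_def Jmat_mult e3_nth)
    from pol_le_all_coords[OF x, of "mat 1"] n
    have "pol_le n (\<lambda>\<xi>. normal_map p \<xi> $ 3 - \<xi> $ 3)" by (intro pol_le_diff) simp_all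
    then show "pol_le n ?p" by (simp add: normal_map_def Jmat_mult e3_nth)
  next
    fix i assume x: "pol_le n (\<lambda>\<xi>. \<xi> $ 1)" and p: "pol_le n ?p"
    have "pol_le n (\<lambda>\<xi>. (Jmat *v \<xi>) $ i + (Jmat *v e3) $ i * ?p \<xi>)"
      by (intro pol_le_add pol_le_cmult p pol_le_all_coords x)
    then show "pol_le n (\<lambda>\<xi>. normal_map p \<xi> $ i)"
      by (simp add: normal_map_def matrix_vector_right_distrib matrix_vector_mult_scaleR mult.commute)
  qed
  moreover have "(\<forall>i. pol_le n (\<lambda>\<xi>. normal_map_inv p \<xi> $ i)) \<longleftrightarrow> pol_le n (\<lambda>\<xi>. \<xi> $ 1) \<and> pol_le n ?p"
  proof safe
    assume "\<forall>i. pol_le n (\<lambda>\<xi>. normal_map_inv p \<xi> $ i)"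
    then have n: "pol_le n (\<lambda>\<xi>. normal_map_inv p (Jmat *v \<xi>) $ i)" for i
      using pol_le_comp_matrix by blast
    show x: "pol_le n (\<lambda>\<xi>. \<xi> $ 1)"
      using n[of 1] by (simp add: normal_map_inv_def Jinv_Jmat e3_nth)
    from pol_le_all_coords[OF x, of "mat 1"] n
    have "pol_le n (\<lambda>\<xi>. \<xi> $ 3 - normal_map_inv p (Jmat *v \<xi>) $ 3)" by (intro pol_le_diff) simp_all
    then show "pol_le n ?p" by (simp add: normal_map_inv_def Jinv_Jmat e3_nth)
  next
    fix i assume x: "pol_le n (\<lambda>\<xi>. \<xi> $ 1)" and p: "pol_le n ?p"
    have "pol_le n (\<lambda>\<xi>. (Jinv *v \<xi>) $ i - e3 $ i * ?p (Jinv *v \<xi>))"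
      by (intro pol_le_diff pol_le_cmult pol_le_comp_matrix[OF p] pol_le_all_coords x)
    then show "pol_le n (\<lambda>\<xi>. normal_map_inv p \<xi> $ i)"
      by (simp add: normal_map_inv_def mult.commute)
  qed
  ultimately show ?thesis by simp
qed

lemma normal_map_polynomial_inverse:
  assumes "poly2 p"
  shows "\<exists>G. polymap3 G \<and> polymap3_deg G = polymap3_deg (normal_map p) \<and>
    (\<forall>\<xi>. G (normal_map p \<xi>) = \<xi>) \<and> (\<forall>\<eta>. normal_map p (G \<eta>) = \<eta>)"
proof (intro exI conjI allI)
  have iff: "(\<forall>i. poly3_deg_le n (\<lambda>\<xi>. normal_map_inv p \<xi> $ i)) \<longleftrightarrow>
      (\<forall>i. poly3_deg_le n (\<lambda>\<xi>. normal_map p \<xi> $ i))" for n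
    unfolding poly3_deg_le_iff_pol_le pol_le_normal_map_inv_iff ..
  then show "polymap3_deg (normal_map_inv p) = polymap3_deg (normal_map p)"
    unfolding polymap3_deg_def by simp
  obtain m where m: "pol_le m (\<lambda>\<xi>. p (\<xi>$1) (\<xi>$2))"
    using poly2_pol[OF assms] unfolding pol_def by blast
  have "pol_le (Suc m) (\<lambda>\<xi>. (Jmat *v \<xi>) $ i + (Jmat *v e3) $ i * p (\<xi>$1) (\<xi>$2))" for i
    by (intro pol_le_add pol_le_cmult pol_le_mono[OF m] hpoly_pol_le[OF hpoly_matrix]) simp_all
  then have "\<forall>i. poly3_deg_le (Suc m) (\<lambda>\<xi>. normal_map p \<xi> $ i)"
    unfolding poly3_deg_le_iff_pol_le
    by (simp add: normal_map_def matrix_vector_right_distrib matrix_vector_mult_scaleR mult.commute)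
  with iff show "polymap3 (normal_map_inv p)" unfolding polymap3_def by blast
qed (simp_all add: normal_map_inverse)

section \<open>Assembly for the smooth map\<close>

lemma shear_aut_diffeo:
  assumes "shear_aut \<psi> \<theta>"
  shows "diffeo_on UNIV \<psi>" "vol_pres_on UNIV \<psi>" "inv_into UNIV \<psi> = \<theta>" "range \<psi> = UNIV"
proof -
  note l = shear_aut_left_inverse[OF assms] and r = shear_aut_right_inverse[OF assms]
  show inv: "inv_into UNIV \<psi> = \<theta>" by (rule inv_equality[OF l r])
  show range: "range \<psi> = UNIV" using r by (metis surj_def)
  have "inj \<psi>" using l by (metis injI)
  then show "diffeo_on UNIV \<psi>"
    unfolding diffeo_on_def range inv
    using smooth_on_pol[OF shear_aut_pol[OF assms]] smooth_on_pol[OF shear_aut_pol[OF shear_aut_swap[OF assms]]]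
    by simp
  have "\<forall>\<xi>. \<exists>M. (\<psi> has_derivative (*v) M) (at \<xi>) \<and> det M = 1"
    using shear_aut_derivative[OF assms] by blast
  from choice[OF this] obtain M where "\<And>\<xi>. (\<psi> has_derivative (*v) (M \<xi>)) (at \<xi>)" "\<And>\<xi>. det (M \<xi>) = 1"
    by blast
  then show "vol_pres_on UNIV \<psi>" by (rule vol_pres_onI)
qed

text \<open>The polynomial \<psi> is Lipschitz in the sense of \<open>pol_Lipschitz\<close>, so
  exchanging \<open>f\<close> for its Taylor polynomial alters the conjugate only by order D +
  1.\<close>

lemma normal_form:
  assumes U: "open U" "0 \<in> U" and f: "smooth_on U f" "vol_pres_on U f"
    and fJ: "vanish 2 (\<lambda>\<xi>. f \<xi> - Jmat *v \<xi>)" and D: "1 \<le> D"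
  shows "\<exists>\<psi> \<theta> p. shear_aut \<psi> \<theta> \<and> poly2_ord2 p \<and> vanish (Suc D) (\<lambda>\<eta>. \<psi> (f (\<theta> \<eta>)) - normal_map p \<eta>)"
proof -
  obtain T where T: "\<And>i. pol (\<lambda>\<xi>. T \<xi> $ i)" "vanish (Suc D) (\<lambda>\<xi>. f \<xi> - T \<xi>)"
    "vanish D (\<lambda>\<xi>. det (jac T \<xi>) - 1)"
    using smooth_volume_preserving_Taylor[OF U f] by blast
  have TJ: "vanish 2 (\<lambda>\<xi>. T \<xi> - Jmat *v \<xi>)"
    using vanish_diff[OF fJ vanish_mono[OF T(2), of 2]] D by simp
  obtain \<psi> \<theta> p where *: "shear_aut \<psi> \<theta>" "poly2_ord2 p"
    "vanish (Suc D) (\<lambda>\<eta>. \<psi> (T (\<theta> \<eta>)) - normal_map p \<eta>)"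
    using normal_form_pol[OF T(1) TJ T(3) D order_refl] by blast
  have J: "vanish 1 (\<lambda>\<xi>. Jmat *v \<xi>)" by (intro vanish_matrix vanish_id)
  have f1: "vanish 1 f" using vanish_add[OF vanish_mono[OF fJ, of 1] J] by simp
  have T1: "vanish 1 T" using vanish_add[OF vanish_mono[OF TJ, of 1] J] by simp
  have \<theta>: "vanish 1 \<theta>" by (rule shear_aut_vanish_1[OF shear_aut_swap[OF *(1)]])
  have "vanish (Suc D) (\<lambda>\<eta>. \<psi> (f (\<theta> \<eta>)) - \<psi> (T (\<theta> \<eta>)))"
  proof (rule vanish_vec)
    fix i
    show "vanish (Suc D) (\<lambda>\<eta>. (\<psi> (f (\<theta> \<eta>)) - \<psi> (T (\<theta> \<eta>))) $ i)"
      using pol_Lipschitz[OF shear_aut_pol[OF *(1)] vanish_comp[OF f1 \<theta>] vanish_comp[OF T1 \<theta>]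
        vanish_comp[OF T(2) \<theta>], of i] by simp
  qed
  from vanish_trans[OF this *(3)] * show ?thesis by blast
qed

theorem theorem2:
  fixes f :: "real^3 \<Rightarrow> real^3" and U :: "(real^3) set"
  assumes "0 \<in> U" and "diffeo_on U f" and "vol_pres_on U f"
    and "(f has_derivative (\<lambda>v. Jmat *v v)) (at 0)"
    and "\<exists>b. (\<forall>\<xi>\<in>U. f \<xi> = Jmat *v (\<xi> + b \<xi>)) \<and> bigO0 2 b"
  shows "(\<forall>D::nat. D \<ge> 2 \<longrightarrow>
           (\<exists>\<psi> h V p. 0 \<in> V \<and> diffeo_on V \<psi> \<and> vol_pres_on V \<psi> \<and>
              (\<forall>\<xi>\<in>V. \<psi> \<xi> = \<xi> + h \<xi>) \<and> bigO0 2 h \<and> poly2_ord2 p \<and>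
              (\<exists>C r. r > 0 \<and> (\<forall>\<eta>. norm \<eta> < r \<longrightarrow>
                  \<eta> \<in> \<psi> ` V \<and> inv_into V \<psi> \<eta> \<in> U \<and> f (inv_into V \<psi> \<eta>) \<in> V \<and>
                  norm (\<psi> (f (inv_into V \<psi> \<eta>)) - Jmat *v (\<eta> + p (\<eta>$1) (\<eta>$2) *\<^sub>R e3))
                    \<le> C * norm \<eta> ^ (D + 1)))))
       \<and> (\<forall>p. poly2 p \<longrightarrow>
           (let g = (\<lambda>\<xi>::real^3. Jmat *v (\<xi> + p (\<xi>$1) (\<xi>$2) *\<^sub>R e3)) in
              vol_pres_on UNIV g \<and>
              (\<exists>G. polymap3 G \<and> polymap3_deg G = polymap3_deg g \<and>
                   (\<forall>\<xi>. G (g \<xi>) = \<xi>) \<and> (\<forall>\<eta>. g (G \<eta>) = \<eta>))))"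
proof (intro conjI allI impI)
  fix D :: nat assume D: "2 \<le> D"
  have U: "open U" "0 \<in> U" and sm: "smooth_on U f"
    using assms(1,2) unfolding diffeo_on_def by auto
  obtain b where b: "\<And>\<xi>. \<xi> \<in> U \<Longrightarrow> f \<xi> = Jmat *v (\<xi> + b \<xi>)" "vanish 2 b"
    using assms(5) unfolding bigO0_iff_vanish by blast
  have fJ: "vanish 2 (\<lambda>\<xi>. f \<xi> - Jmat *v \<xi>)"
  proof (rule vanish_cong[OF _ vanish_matrix[OF b(2), of Jmat]])
    show "\<forall>\<^sub>F \<xi> in nhds 0. Jmat *v b \<xi> = f \<xi> - Jmat *v \<xi>"
      using eventually_nhds_in_open[OF U]
      by eventually_elim (simp add: b(1) matrix_vector_right_distrib)
  qed
  obtain \<psi> \<theta> p where *: "shear_aut \<psi> \<theta>" "poly2_ord2 p"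
    "vanish (Suc D) (\<lambda>\<eta>. \<psi> (f (\<theta> \<eta>)) - normal_map p \<eta>)"
    using normal_form[OF U sm assms(3) fJ, of D] D by auto
  note \<psi> = shear_aut_diffeo[OF *(1)]
  obtain C where C: "\<forall>\<^sub>F \<eta> in nhds 0. norm (\<psi> (f (\<theta> \<eta>)) - normal_map p \<eta>) \<le> C * norm \<eta> ^ Suc D"
    using *(3) by (rule vanishE)
  \<comment> \<open>The values of \<open>f\<close> matter only on U; the limit at 0 keeps \<theta>
    \<eta> in U for small \<eta>.\<close>
  have "(\<theta> \<longlongrightarrow> 0) (nhds 0)"
    by (rule vanish_imp_tendsto[OF shear_aut_vanish_1[OF shear_aut_swap[OF *(1)]]])
  then have "\<forall>\<^sub>F \<eta> in nhds 0. \<theta> \<eta> \<in> U" using U by (rule topological_tendstoD)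
  from eventually_conj[OF this C]
  obtain r where r: "r > 0" "\<And>\<eta>. norm \<eta> < r \<Longrightarrow> \<theta> \<eta> \<in> U \<and>
      norm (\<psi> (f (\<theta> \<eta>)) - normal_map p \<eta>) \<le> C * norm \<eta> ^ Suc D"
    unfolding eventually_nhds_metric by auto
  show "\<exists>\<psi> h V p. 0 \<in> V \<and> diffeo_on V \<psi> \<and> vol_pres_on V \<psi> \<and>
      (\<forall>\<xi>\<in>V. \<psi> \<xi> = \<xi> + h \<xi>) \<and> bigO0 2 h \<and> poly2_ord2 p \<and>
      (\<exists>C r. r > 0 \<and> (\<forall>\<eta>. norm \<eta> < r \<longrightarrow>
          \<eta> \<in> \<psi> ` V \<and> inv_into V \<psi> \<eta> \<in> U \<and> f (inv_into V \<psi> \<eta>) \<in> V \<and>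
          norm (\<psi> (f (inv_into V \<psi> \<eta>)) - Jmat *v (\<eta> + p (\<eta>$1) (\<eta>$2) *\<^sub>R e3))
            \<le> C * norm \<eta> ^ (D + 1)))"
  \<comment> \<open>Shears are global automorphisms, so V is the whole space, and h is \<psi> minus
    the identity.\<close>
  proof (intro exI conjI)
    show "bigO0 2 (\<lambda>\<xi>. \<psi> \<xi> - \<xi>)"
      unfolding bigO0_iff_vanish by (rule shear_aut_near_id[OF *(1)])
    show "\<forall>\<eta>. norm \<eta> < r \<longrightarrow> \<eta> \<in> range \<psi> \<and> inv_into UNIV \<psi> \<eta> \<in> U \<and> f (inv_into UNIV \<psi> \<eta>) \<in> UNIV \<and>
        norm (\<psi> (f (inv_into UNIV \<psi> \<eta>)) - Jmat *v (\<eta> + p (\<eta>$1) (\<eta>$2) *\<^sub>R e3)) \<le> C * norm \<eta> ^ (D + 1)"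
      using r(2) unfolding \<psi>(3,4) normal_map_def by simp
  qed (use \<psi>(1,2) *(2) r(1) in auto)
next
  fix p assume p: "poly2 p"
  have g: "(\<lambda>\<xi>. Jmat *v (\<xi> + p (\<xi>$1) (\<xi>$2) *\<^sub>R e3)) = normal_map p"
    by (rule ext) (simp add: normal_map_def)
  show "let g = (\<lambda>\<xi>::real^3. Jmat *v (\<xi> + p (\<xi>$1) (\<xi>$2) *\<^sub>R e3)) in vol_pres_on UNIV g \<and>
      (\<exists>G. polymap3 G \<and> polymap3_deg G = polymap3_deg g \<and> (\<forall>\<xi>. G (g \<xi>) = \<xi>) \<and> (\<forall>\<eta>. g (G \<eta>) = \<eta>))"
    unfolding Let_def g
    using vol_pres_on_normal_map[OF poly2_pol[OF p]] normal_map_polynomial_inverse[OF p] by (rule conjI)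
qed

end
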